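(* The superharmonic space satisfies $$SH^B_n=\sum_{I\subseteq[n]}\mathbb C[\mathbf x_n]\odot d_{2I-1}(\delta^B_n),$$ i.e. $SH^B_n$ is the smallest $\mathbb C$-subspace of $\Omega_n$ containing $\delta^B_n$ and closed under $\partial_1,\dots,\partial_n$ and under $d_1,d_3,\dots,d_{2n-1}$.
   Context: $\mathbb C[\mathbf x_n]=\mathbb C[x_1,\dots,x_n]$; $\Omega_n=\mathbb C[\mathbf x_n]\otimes\wedge\{\theta_1,\dots,\theta_n\}$ with anticommuting $\theta_i$ commuting with the $x_j$. $\mathfrak B_n$ (signed permutations) acts on $\Omega_n$ by algebra automorphisms via $\pi(x_i)=x_{\pi(i)}$, $\pi(\theta_i)=\theta_{\pi(i)}$, $x_{-i}=-x_i$, $\theta_{-i}=-\theta_i$; $SI^B_n$ is the ideal of $\Omega_n$ generated by invariants with zero constant term. $\partial_i$ acts on $\Omega_n$ as $\partial/\partial x_i$ (θ's constant); $\partial^\theta_i$ acts on the exterior factor by $\theta_{j_1}\cdots\theta_{j_r}\mapsto(-1)^{s-1}\theta_{j_1}\cdots\widehat{\theta_{j_s}}\cdots\theta_{j_r}$ if $j_s=i$ and $\mapsto0$ if $i\notin\{j_1,\dots,j_r\}$. For $f,g\in\Omega_n$, $f\odot g=(\partial f)(g)$, where $\partial f$ is obtained from $f$ by substituting $x_i\mapsto\partial_i$, $\theta_i\mapsto\partial^\theta_i$. The superharmonic space is $SH^B_n=\{g\in\Omega_n: f\odot g=0\text{ for all }f\in SI^B_n\}$. For $j\ge1$, $d_j(f)=\sum_{i=1}^n\partial_i^j(f)\,\theta_i$;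 for $I=\{i_1<\dots<i_k\}\subseteq[n]$, $d_{2I-1}=d_{2i_1-1}\circ\cdots\circ d_{2i_k-1}$ (the identity if $I=\emptyset$). $\delta^B_n=\prod_{i=1}^nx_i\prod_{1\le i<j\le n}(x_i^2-x_j^2)$. $\mathbb C[\mathbf x_n]\odot g=\{f\odot g:f\in\mathbb C[\mathbf x_n]\}$. *)

theory Defs
  imports Complex_Main "HOL-Combinatorics.Permutations"
begin

text \<open>
  Model of the superspace Omega_n = C[x_1..x_n] tensor Lambda{theta_1..theta_n}.
  An element is a coefficient function on basis monomials x^a theta_S, where
  a :: nat => nat is an exponent vector and S :: nat set; theta_S denotes the
  product theta_{s_1} ... theta_{s_k} with s_1 < ... < s_k.
  Variables are indexed by 1..n.
\<close>

type_synonym mon = "(nat \<Rightarrow> nat) \<times> nat set"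
type_synonym om = "mon \<Rightarrow> complex"

definition supp :: "om \<Rightarrow> mon set" where
  "supp f = {m. f m \<noteq> 0}"

definition Omega :: "nat \<Rightarrow> om set" where
  "Omega n = {f. finite (supp f) \<and>
      (\<forall>a S. f (a, S) \<noteq> 0 \<longrightarrow> (\<forall>i. i \<notin> {1..n} \<longrightarrow> a i = 0) \<and> S \<subseteq> {1..n})}"

definition om_zero :: om where "om_zero = (\<lambda>_. 0)"

definition basis :: "mon \<Rightarrow> om" where
  "basis m = (\<lambda>k. if k = m then 1 else 0)"

definition om_one :: om where "om_one = basis (\<lambda>_. 0, {})"

definition xv :: "nat \<Rightarrow> om" where "xv i = basis ((\<lambda>_. 0)(i := 1), {})"
definition thv :: "nat \<Rightarrow> om" where "thv i = basis (\<lambda>_. 0, {i})"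

definition om_add :: "om \<Rightarrow> om \<Rightarrow> om" where "om_add f g = (\<lambda>k. f k + g k)"
definition om_smult :: "complex \<Rightarrow> om \<Rightarrow> om" where "om_smult c f = (\<lambda>k. c * f k)"
definition om_diff :: "om \<Rightarrow> om \<Rightarrow> om" where "om_diff f g = (\<lambda>k. f k - g k)"

definition mulx :: "nat \<Rightarrow> om \<Rightarrow> om" where
  "mulx i g = (\<lambda>(b, T). if 0 < b i then g (b(i := b i - 1), T) else 0)"

text \<open>left multiplication by theta_i: theta_i theta_T = (-1)^{#{t in T. t < i}} theta_{T + i} if i notin T, else 0\<close>
definition multh :: "nat \<Rightarrow> om \<Rightarrow> om" where
  "multh i g = (\<lambda>(b, U). if i \<in> U then (-1) ^ card {t \<in> U. t < i} * g (b, U - {i}) else 0)"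

definition dx :: "nat \<Rightarrow> om \<Rightarrow> om" where
  "dx i g = (\<lambda>(b, T). of_nat (b i + 1) * g (b(i := b i + 1), T))"

text \<open>partial^theta_i: theta_{j_1}..theta_{j_r} (increasing) maps to (-1)^{s-1} times the product
  with theta_{j_s} removed if j_s = i, and to 0 if i is not among the j's\<close>
definition dth :: "nat \<Rightarrow> om \<Rightarrow> om" where
  "dth i g = (\<lambda>(b, U). if i \<notin> U then (-1) ^ card {t \<in> U. t < i} * g (b, insert i U) else 0)"

text \<open>Operator obtained by substituting operators X_i for x_i and T_i for theta_i into the
  monomial x^a theta_{s_1}...theta_{s_k} (s_1 < ... < s_k), applied to g:
  X_1^{a_1} ... X_n^{a_n} (T_{s_1} (T_{s_2} (... (T_{s_k} g))))\<close>
definition monop :: "nat \<Rightarrow> (nat \<Rightarrow> om \<Rightarrow> om) \<Rightarrow> (nat \<Rightarrow> om \<Rightarrow> om) \<Rightarrow> mon \<Rightarrow> om \<Rightarrow> om" where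
  "monop n X T m g = fold (\<lambda>i h. (X i ^^ fst m i) h) [1..<Suc n] (foldr T (sorted_list_of_set (snd m)) g)"

definition lin_ext :: "(mon \<Rightarrow> om \<Rightarrow> om) \<Rightarrow> om \<Rightarrow> om \<Rightarrow> om" where
  "lin_ext P f g = (\<lambda>k. \<Sum>m\<in>supp f. f m * P m g k)"

definition om_mult :: "nat \<Rightarrow> om \<Rightarrow> om \<Rightarrow> om" where
  "om_mult n f g = lin_ext (monop n mulx multh) f g"

definition odot :: "nat \<Rightarrow> om \<Rightarrow> om \<Rightarrow> om" where
  "odot n f g = lin_ext (monop n dx dth) f g"

definition signed_perm :: "nat \<Rightarrow> (int \<Rightarrow> int) \<Rightarrow> bool" where
  "signed_perm n \<pi> \<longleftrightarrow> \<pi> permutes ({- int n .. int n} - {0}) \<and> (\<forall>i. \<pi> (- i) = - \<pi> i)"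

text \<open>Action of pi: the algebra automorphism with pi(x_i) = x_{pi(i)}, pi(theta_i) = theta_{pi(i)},
  where x_{-j} = -x_j and theta_{-j} = -theta_j.\<close>
definition sgnc :: "int \<Rightarrow> complex" where "sgnc k = of_int (sgn k)"

definition act :: "nat \<Rightarrow> (int \<Rightarrow> int) \<Rightarrow> om \<Rightarrow> om" where
  "act n \<pi> f = lin_ext
     (\<lambda>m _. monop n
        (\<lambda>i h. om_smult (sgnc (\<pi> (int i))) (mulx (nat \<bar>\<pi> (int i)\<bar>) h))
        (\<lambda>i h. om_smult (sgnc (\<pi> (int i))) (multh (nat \<bar>\<pi> (int i)\<bar>) h))
        m om_one) f om_zero"

definition invariants0 :: "nat \<Rightarrow> om set" where
  "invariants0 n = {f \<in> Omega n. (\<forall>\<pi>. signed_perm n \<pi> \<longrightarrow> act n \<pi> f = f) \<and> f (\<lambda>_. 0, {}) = 0}"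

inductive_set gen_ideal :: "nat \<Rightarrow> om set \<Rightarrow> om set" for n G where
  gen: "g \<in> G \<Longrightarrow> g \<in> gen_ideal n G"
| zero: "om_zero \<in> gen_ideal n G"
| add: "a \<in> gen_ideal n G \<Longrightarrow> b \<in> gen_ideal n G \<Longrightarrow> om_add a b \<in> gen_ideal n G"
| lmult: "a \<in> gen_ideal n G \<Longrightarrow> h \<in> Omega n \<Longrightarrow> om_mult n h a \<in> gen_ideal n G"
| rmult: "a \<in> gen_ideal n G \<Longrightarrow> h \<in> Omega n \<Longrightarrow> om_mult n a h \<in> gen_ideal n G"

definition SI :: "nat \<Rightarrow> om set" where "SI n = gen_ideal n (invariants0 n)"

definition SH :: "nat \<Rightarrow> om set" where
  "SH n = {g \<in> Omega n. \<forall>f \<in> SI n. odot n f g = om_zero}"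

definition Poly :: "nat \<Rightarrow> om set" where
  "Poly n = {f \<in> Omega n. \<forall>a S. S \<noteq> {} \<longrightarrow> f (a, S) = 0}"

definition dj :: "nat \<Rightarrow> nat \<Rightarrow> om \<Rightarrow> om" where
  "dj n j f = foldr om_add [om_mult n ((dx i ^^ j) f) (thv i). i \<leftarrow> [1..<Suc n]] om_zero"

definition dI :: "nat \<Rightarrow> nat set \<Rightarrow> om \<Rightarrow> om" where
  "dI n I f = foldr (\<lambda>i h. dj n (2 * i - 1) h) (sorted_list_of_set I) f"

definition deltaB :: "nat \<Rightarrow> om" where
  "deltaB n = om_mult n
     (foldr (om_mult n) [xv i. i \<leftarrow> [1..<Suc n]] om_one)
     (foldr (om_mult n) [om_diff (om_mult n (xv i) (xv i)) (om_mult n (xv j) (xv j)).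
                          i \<leftarrow> [1..<Suc n], j \<leftarrow> [Suc i..<Suc n]] om_one)"

end

theory Submission
  imports Defs "HOL-Library.Poly_Mapping" "HOL-Library.Function_Algebras"
begin

text \<open>
  Let \<open>H\<close> be the space of all \<open>g\<close> killed by the invariants \<open>p\<^sub>2\<^sub>r = \<Sum> x\<^sub>i\<^bsup>2r\<^esup>\<close> and
  \<open>\<omega>\<^sub>r = \<Sum> x\<^sub>i\<^bsup>2r-1\<^esup> \<theta>\<^sub>i\<close> and let \<open>V\<close> be the right-hand side. The theorem follows from
  \<open>V \<subseteq> SH \<subseteq> H \<subseteq> V\<close>, where the middle inclusion is trivial.

  \<open>V \<subseteq> SH\<close>: the adjoint of an odd \<open>d\<^sub>j\<close> is contraction with \<open>\<Sum> x\<^sub>i\<^sup>j \<partial>\<^sub>\<theta>\<^sub>i\<close>, which preserves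
  the invariants; and \<open>\<delta>\<close> is killed by the invariant polynomials without constant term because
  an anti-invariant polynomial has degree at least \<open>n\<^sup>2\<close>.

  \<open>H \<subseteq> V\<close>: dually, if \<open>f\<close> is orthogonal to \<open>V\<close>, then all contractions of \<open>f\<close> with the vector
  fields \<open>v\<^sub>r = \<Sum> x\<^sub>i\<^bsup>2r-1\<^esup> \<partial>\<^sub>\<theta>\<^sub>i\<close> down to polynomials annihilate \<open>\<delta>\<close>, that is, they lie in the ideal
  \<open>I = (p\<^sub>2, ..., p\<^sub>2\<^sub>n)\<close>. Let \<open>J\<close> have minimal element sum among the \<open>J\<close> such that \<open>\<theta>\<^sub>J\<close> has a
  nonzero coefficient \<open>g\<close> in \<open>f\<close>, and put \<open>y\<^sub>i = x\<^sub>i\<^sup>2\<close>. Contracting with polynomial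
  combinations of the \<open>v\<^sub>r\<close> that vanish at all \<open>l > j\<close> gives \<open>g \<Prod>\<^sub>j\<^sub>\<in>\<^sub>J \<phi>\<^sub>j \<in> I\<close>, where
  \<open>\<phi>\<^sub>j = x\<^sub>j \<Prod>\<^sub>i\<^sub>>\<^sub>j (y\<^sub>j - y\<^sub>i)\<close>. The colon ideal of \<open>I\<close> by this product is generated by the
  \<open>p\<^sub>2\<^sub>r\<close> with \<open>r \<le> n - |J|\<close> and the \<open>\<pi>\<^sub>j = x\<^sub>j \<Prod> (y\<^sub>j - y\<^sub>c)\<close> (\<open>j \<in> J\<close>; \<open>c < j\<close>, \<open>c\<close> not in \<open>J\<close>),
  and for each of these generators \<open>q\<close> the ideal generated by the \<open>p\<^sub>2\<^sub>r\<close> and \<open>\<omega>\<^sub>r\<close>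
  contains \<open>q \<theta>\<^sub>J\<close> plus terms \<open>\<theta>\<^sub>T\<close> with larger element sum, so \<open>g \<theta>\<^sub>J\<close> can be eliminated.

  The colon ideal is computed by adding the elements of \<open>J\<close> in increasing order: if \<open>j\<close> is the
  maximum of \<open>J\<close>, then \<open>p\<^sub>2\<^sub>m\<^sub>+\<^sub>2\<close> with \<open>m = n - |J|\<close> equals \<open>\<pi>\<^sub>j \<phi>\<^sub>j\<close> modulo the other generators, and
  all sequences involved are regular. For \<open>J = {1, ..., n}\<close> the same chain shows that the socle
  modulo \<open>I\<close> is spanned by \<open>\<delta>\<close>, hence \<open>I\<close> is the full annihilator of \<open>\<delta>\<close>.
\<close>

subsection \<open>Nonzerodivisors modulo an ideal\<close>

text \<open>A ring is a module over itself: \<open>ideal.span G\<close> is the ideal generated by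
  \<open>G\<close>, and \<open>ideal.subspace I\<close> says that \<open>I\<close> is an
  ideal.\<close>

interpretation ideal: module "(*) :: 'a::comm_ring_1 \<Rightarrow> 'a \<Rightarrow> 'a"
  by unfold_locales (simp_all add: algebra_simps)

declare ideal.scale_scale [simp del]

definition nzd :: "'a::comm_ring_1 \<Rightarrow> 'a set \<Rightarrow> bool" where
  "nzd a G \<longleftrightarrow> (\<forall>g. a * g \<in> ideal.span G \<longrightarrow> g \<in> ideal.span G)"

lemma nzdD: "nzd a G \<Longrightarrow> a * g \<in> ideal.span G \<Longrightarrow> g \<in> ideal.span G"
  by (auto simp: nzd_def)

lemma span_multR: "x \<in> ideal.span G \<Longrightarrow> x * c \<in> ideal.span (G :: 'a::comm_ring_1 set)"
  using ideal.span_scale[of x G c] by (simp add: mult.commute)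

lemma span_insertI: "x - k * a \<in> ideal.span G \<Longrightarrow> x \<in> ideal.span (insert a G)"
  unfolding ideal.span_breakdown_eq by blast

lemma span_insertE:
  assumes "x \<in> ideal.span (insert a G)"
  obtains k where "x - k * a \<in> ideal.span G"
  using assms unfolding ideal.span_breakdown_eq by blast

lemma nzd_mult: "nzd a G \<Longrightarrow> nzd b G \<Longrightarrow> nzd (a * b) G"
  unfolding nzd_def mult.assoc by blast

lemma nzd_one: "nzd 1 G"
  unfolding nzd_def by simp

lemma nzd_prod: "(\<And>i. i \<in> F \<Longrightarrow> nzd (f i) G) \<Longrightarrow> nzd (\<Prod>i\<in>F. f i) G"
  by (induction F rule: infinite_finite_induct) (auto intro: nzd_mult nzd_one)

lemma nzd_factor: "nzd (a * b) G \<Longrightarrow> nzd b G"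
  unfolding nzd_def by (metis ideal.span_scale mult.assoc)

lemma nzd_cong_mod:
  assumes "a - b \<in> ideal.span G" "nzd a G" shows "nzd b G"
  unfolding nzd_def
proof (intro allI impI)
  fix g assume "b * g \<in> ideal.span G"
  moreover have "(a - b) * g \<in> ideal.span G" by (rule span_multR[OF assms(1)])
  ultimately have "(a - b) * g + b * g \<in> ideal.span G" by (rule ideal.span_add[rotated])
  then show "g \<in> ideal.span G" using nzdD[OF assms(2)] by (simp add: algebra_simps)
qed

text \<open>Modulo \<open>G\<close>, \<open>a\<close> is a multiple of \<open>b\<close>, and a
  factor of a nonzerodivisor is a nonzerodivisor.\<close>

lemma nzd_of_mem_insert:
  assumes "a \<in> ideal.span (insert b G)" "nzd a G" shows "nzd b G"
proof -
  obtain k where "a - k * b \<in> ideal.span G" by (rule span_insertE[OF assms(1)])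
  then have "nzd (k * b) G" using assms(2) by (rule nzd_cong_mod)
  then show ?thesis by (rule nzd_factor)
qed

text \<open>Multiply, over all \<open>l\<close>, the congruences that express \<open>z\<close> as a
  multiple of \<open>x l\<close> modulo \<open>G\<close>.\<close>

lemma prod_mod_prod:
  assumes "finite F" "\<And>l. l \<in> F \<Longrightarrow> z \<in> ideal.span (insert (x l) G)"
  shows "z ^ card F \<in> ideal.span (insert (\<Prod>l\<in>F. x l) G)"
  using assms
proof (induction F rule: finite_induct)
  case empty
  then show ?case by (simp add: ideal.span_base)
next
  case (insert l F)
  obtain k where k: "z - k * x l \<in> ideal.span G" using insert.prems span_insertE by blast
  obtain m where m: "z ^ card F - m * prod x F \<in> ideal.span G"
    using insert.IH insert.prems span_insertE by blast
  have "z * (z ^ card F - m * prod x F) + (m * prod x F) * (z - k * x l) \<in> ideal.span G"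
    by (intro ideal.span_add ideal.span_scale k m)
  then have "z * z ^ card F - (m * k) * (x l * prod x F) \<in> ideal.span G"
    by (simp add: algebra_simps)
  then have "z * z ^ card F \<in> ideal.span (insert (x l * prod x F) G)" by (rule span_insertI)
  then show ?case using insert.hyps by simp
qed

section \<open>Polynomials and ideals generated by variables\<close>

type_synonym mpol = "(nat \<Rightarrow> nat) \<Rightarrow>\<^sub>0 complex"

abbreviation lookup where "lookup \<equiv> Poly_Mapping.lookup"
abbreviation keys where "keys \<equiv> Poly_Mapping.keys"
abbreviation single where "single \<equiv> Poly_Mapping.single"

definition X :: "nat \<Rightarrow> mpol" where "X i = single ((\<lambda>_. 0)(i := 1)) 1"

lemma sum_single: "(\<Sum>a\<in>keys p. single a (lookup p a)) = p"
  by (rule poly_mapping_eqI) (simp add: lookup_sum lookup_single when_def in_keys_iff)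

lemma mpol_induct [case_names single add]:
  assumes "\<And>a c. P (single a c)" "\<And>p q. P p \<Longrightarrow> P q \<Longrightarrow> P (p + q)"
  shows "P (p::mpol)"
proof -
  have "P (\<Sum>a\<in>F. single a (lookup p a))" if "finite F" for F
    using that by induction (use assms(1)[of 0 0] in \<open>auto intro: assms\<close>)
  from this[of "keys p"] show ?thesis by (simp add: sum_single)
qed

lemma lookup_X_mult:
  "lookup (X i * p) a = (if 0 < a i then lookup p (a(i := a i - 1)) else 0)"
proof (induction p rule: mpol_induct)
  case (single b c)
  have eq: "(\<lambda>_. 0)(i := 1) + b = a \<longleftrightarrow> 0 < a i \<and> b = a(i := a i - 1)"
    by (auto simp: fun_eq_iff)
  show ?case
    unfolding X_def mult_single lookup_single when_def eq
    by (cases "0 < a i"; cases "b = a(i := a i - 1)") (simp_all only: simp_thms if_True if_False mult_1)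
next
  case (add p q)
  have "lookup (X i * (p + q)) a = lookup (X i * p) a + lookup (X i * q) a"
    unfolding distrib_left by (rule lookup_add)
  moreover have "lookup (p + q) (a(i := a i - 1)) = lookup p (a(i := a i - 1)) + lookup q (a(i := a i - 1))"
    by (rule lookup_add)
  ultimately show ?case unfolding add by (cases "0 < a i") (simp_all only: if_True if_False add_0)
qed

text \<open>An ideal generated by variables is a monomial ideal, so membership is tested on each
  monomial of \<open>g\<close> separately.\<close>

lemma span_X_iff:
  "g \<in> ideal.span (X ` A) \<longleftrightarrow> (\<forall>m\<in>keys g. \<exists>a\<in>A. 0 < m a)"
proof
  assume "g \<in> ideal.span (X ` A)"
  then show "\<forall>m\<in>keys g. \<exists>a\<in>A. 0 < m a"
  proof (induction rule: ideal.span_induct_alt)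
    case base
    then show ?case by simp
  next
    case (step c x y)
    then obtain l where l: "l \<in> A" "x = X l" by auto
    show ?case
    proof
      fix m assume "m \<in> keys (c * x + y)"
      then have "m \<in> keys (X l * c) \<or> m \<in> keys y"
        using keys_add[of "X l * c" y] l by (auto simp: mult.commute)
      then show "\<exists>a\<in>A. 0 < m a"
      proof
        assume "m \<in> keys (X l * c)"
        then have "0 < m l" by (metis in_keys_iff lookup_X_mult)
        then show ?thesis using l by blast
      next
        assume "m \<in> keys y"
        then show ?thesis using step.IH by blast
      qed
    qed
  qed
next
  assume *: "\<forall>m\<in>keys g. \<exists>a\<in>A. 0 < m a"
  have "single m c \<in> ideal.span (X ` A)" if m: "m \<in> keys g" for m c
  proof -
    obtain a where a: "a \<in> A" "0 < m a" using * m by blast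
    have eq: "m(a := m a - 1) + (\<lambda>_. 0)(a := 1) = m"
      by (rule ext) (use a in simp)
    have "single m c = single (m(a := m a - 1)) c * X a"
      unfolding X_def mult_single eq by simp
    moreover have "single (m(a := m a - 1)) c * X a \<in> ideal.span (X ` A)"
      using a(1) by (intro ideal.span_scale ideal.span_base) simp
    ultimately show ?thesis by simp
  qed
  then have "(\<Sum>m\<in>keys g. single m (lookup g m)) \<in> ideal.span (X ` A)"
    by (intro ideal.span_sum)
  then show "g \<in> ideal.span (X ` A)" by (simp only: sum_single)
qed

text \<open>Multiplication by \<open>X l\<close> shifts the monomials of \<open>g\<close>
  injectively and leaves the exponents at indices in \<open>A\<close> unchanged.\<close>

lemma nzd_X:
  assumes "l \<notin> A" shows "nzd (X l) (X ` A)"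
  unfolding nzd_def span_X_iff
proof (intro allI impI ballI)
  fix g m assume *: "\<forall>m\<in>keys (X l * g). \<exists>a\<in>A. 0 < m a" and m: "m \<in> keys g"
  have "m(l := m l + 1) \<in> keys (X l * g)" using m by (simp add: in_keys_iff lookup_X_mult)
  with * obtain a where a: "a \<in> A" "0 < (m(l := m l + 1)) a" by blast
  then have "0 < m a" using assms by (cases "a = l") auto
  then show "\<exists>a\<in>A. 0 < m a" using a(1) by blast
qed

subsection \<open>Grading\<close>

text \<open>Exponent vectors may have infinite support, so only indices in \<open>{1..n}\<close> are
  counted; the other variables get degree 0.\<close>

definition mdeg :: "nat \<Rightarrow> (nat \<Rightarrow> nat) \<Rightarrow> nat" where "mdeg n a = (\<Sum>i=1..n. a i)"

lemma mdeg_add: "mdeg n (a + b) = mdeg n a + mdeg n b"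
  by (simp add: mdeg_def sum.distrib)

definition homog :: "nat \<Rightarrow> nat \<Rightarrow> mpol \<Rightarrow> bool" where
  "homog n d p \<longleftrightarrow> (\<forall>a\<in>keys p. mdeg n a = d)"

definition hcomp :: "nat \<Rightarrow> nat \<Rightarrow> mpol \<Rightarrow> mpol" where
  "hcomp n d p = (\<Sum>a\<in>{a\<in>keys p. mdeg n a = d}. single a (lookup p a))"

lemma lookup_hcomp: "lookup (hcomp n d p) a = (if mdeg n a = d then lookup p a else 0)"
  by (auto simp: hcomp_def lookup_sum lookup_single when_def in_keys_iff)

lemma hcomp_add: "hcomp n d (p + q) = hcomp n d p + hcomp n d q"
  by (rule poly_mapping_eqI) (simp add: lookup_hcomp lookup_add)

lemma hcomp_zero [simp]: "hcomp n d 0 = 0"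
  by (rule poly_mapping_eqI) (simp add: lookup_hcomp)

lemma hcomp_single: "hcomp n d (single a c) = (if mdeg n a = d then single a c else 0)"
  by (rule poly_mapping_eqI) (auto simp: lookup_hcomp lookup_single when_def)

lemma hcomp_sum: "hcomp n d (sum f A) = (\<Sum>x\<in>A. hcomp n d (f x))"
  by (induction A rule: infinite_finite_induct) (auto simp: hcomp_add)

lemma hcomp_homog: "homog n d (hcomp n d p)"
  by (auto simp: homog_def in_keys_iff lookup_hcomp split: if_splits)

lemma sum_hcomp: "(\<Sum>d\<in>mdeg n ` keys p. hcomp n d p) = p"
  by (rule poly_mapping_eqI) (auto simp: lookup_sum lookup_hcomp in_keys_iff)

lemma hcomp_id: "homog n d p \<Longrightarrow> hcomp n d p = p"
  by (rule poly_mapping_eqI) (auto simp: lookup_hcomp homog_def in_keys_iff)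

lemma hcomp_mult_homog:
  assumes "homog n e q"
  shows "hcomp n d (k * q) = (if e \<le> d then hcomp n (d - e) k * q else 0)"
proof (induction k rule: mpol_induct)
  case (single a c)
  have "hcomp n d (single a c * q) = hcomp n d (\<Sum>b\<in>keys q. single a c * single b (lookup q b))"
    by (subst (1) sum_single[of q, symmetric]) (simp only: sum_distrib_left)
  also have "\<dots> = (\<Sum>b\<in>keys q. if mdeg n a + e = d then single a c * single b (lookup q b) else 0)"
    unfolding hcomp_sum
    by (rule sum.cong) (use assms in \<open>auto simp: mult_single hcomp_single mdeg_add homog_def\<close>)
  also have "\<dots> = (if mdeg n a + e = d then single a c * q else 0)"
    by (subst (3) sum_single[of q, symmetric]) (simp add: sum_distrib_left)
  finally show ?case by (auto simp: hcomp_single)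
qed (auto simp: hcomp_add algebra_simps)

lemma span_hcomp:
  assumes "\<forall>q\<in>G. \<exists>e. homog n e q" "p \<in> ideal.span G"
  shows "hcomp n d p \<in> ideal.span G"
  using assms(2)
proof (induction rule: ideal.span_induct_alt)
  case base
  then show ?case by (simp add: ideal.span_zero)
next
  case (step c x y)
  obtain e where "homog n e x" using assms(1) step by blast
  then show ?case
    using step by (simp add: hcomp_add hcomp_mult_homog ideal.span_add ideal.span_scale ideal.span_base)
qed

lemma homog_mult:
  assumes "homog n d p" "homog n e q" shows "homog n (d + e) (p * q)"
proof -
  have "hcomp n (d + e) (p * q) = p * q"
    by (simp add: hcomp_mult_homog[OF assms(2)] hcomp_id[OF assms(1)])
  then show ?thesis by (metis hcomp_homog)
qed

lemma homog_one: "homog n 0 1"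
  by (simp add: homog_def mdeg_def)

lemma homog_X: "homog n (if i \<in> {1..n} then 1 else 0) (X i)"
proof -
  have "mdeg n ((\<lambda>_. 0)(i := Suc 0)) = (\<Sum>j=1..n. if j = i then 1 else 0)"
    by (simp add: mdeg_def if_distrib)
  then show ?thesis by (simp add: homog_def X_def)
qed

lemma homog_X1: "i \<in> {1..n} \<Longrightarrow> homog n 1 (X i)"
  using homog_X[of n i] by simp

lemma homog_power: "homog n d p \<Longrightarrow> homog n (d * k) (p ^ k)"
  by (induction k) (auto simp: homog_one homog_mult)

lemma homog_sum: "(\<And>i. i \<in> F \<Longrightarrow> homog n d (f i)) \<Longrightarrow> homog n d (sum f F)"
proof (induction F rule: infinite_finite_induct)
  case (insert x F)
  then show ?case using keys_add[of "f x" "sum f F"] by (auto simp: homog_def)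
qed (simp_all add: homog_def)

lemma homog_diff: "homog n d p \<Longrightarrow> homog n d q \<Longrightarrow> homog n d (p - q)"
  using keys_diff[of p q] by (auto simp: homog_def)

lemma homog_prod: "(\<And>i. i \<in> F \<Longrightarrow> homog n d (f i)) \<Longrightarrow> homog n (d * card F) (prod f F)"
proof (induction F rule: infinite_finite_induct)
  case (insert x F)
  then have "homog n (d + d * card F) (f x * prod f F)" by (intro homog_mult) auto
  then show ?case using insert by (simp add: algebra_simps)
qed (auto simp: homog_one)

text \<open>A graded Nakayama argument: \<open>K = (Q : b)\<close> satisfies \<open>K \<subseteq> Q + a K\<close>,
  and \<open>a\<close> has positive degree.\<close>
lemma nzd_swap:
  assumes G: "\<forall>q\<in>G. \<exists>e. homog n e q"
    and a: "homog n da a" "0 < da" and b: "homog n db b"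
    and na: "nzd a G" and nb: "nzd b (insert a G)"
  shows "nzd b G" "nzd a (insert b G)"
proof -
  have hom: "g \<in> ideal.span G" if "homog n d g" "b * g \<in> ideal.span G" for d g
    using that
  proof (induction d arbitrary: g rule: less_induct)
    case (less d)
    have "b * g \<in> ideal.span (insert a G)" using less.prems ideal.span_mono[of G "insert a G"] by auto
    then have "g \<in> ideal.span (insert a G)" by (rule nzdD[OF nb])
    then obtain k where k: "g - k * a \<in> ideal.span G" by (rule span_insertE)
    \<comment> \<open>Passing to the degree \<open>d\<close> component makes the cofactor
      \<open>h\<close> of \<open>a\<close> homogeneous of degree \<open>d - da\<close>, to which the
      induction hypothesis applies.\<close>
    then have "hcomp n d (g - k * a) \<in> ideal.span G" by (rule span_hcomp[OF G])
    moreover have "hcomp n d (g - k * a) = g - hcomp n d (k * a)"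
    proof -
      have "hcomp n d (g - k * a) + hcomp n d (k * a) = g"
        unfolding hcomp_add[symmetric] using hcomp_id[OF less.prems(1)] by simp
      then show ?thesis by (simp add: eq_diff_eq)
    qed
    ultimately have k': "g - hcomp n d (k * a) \<in> ideal.span G" by simp
    show ?case
    proof (cases "da \<le> d")
      case False
      then show ?thesis using k' by (simp add: hcomp_mult_homog[OF a(1)])
    next
      case True
      define h where "h = hcomp n (d - da) k"
      have gh: "g - h * a \<in> ideal.span G" using k' True by (simp add: hcomp_mult_homog[OF a(1)] h_def)
      have "b * g - b * (g - h * a) \<in> ideal.span G"
        by (rule ideal.span_diff[OF less.prems(2) ideal.span_scale[OF gh]])
      then have "a * (b * h) \<in> ideal.span G" by (simp add: algebra_simps)
      then have "b * h \<in> ideal.span G" by (rule nzdD[OF na])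
      then have hG: "h \<in> ideal.span G"
        using less.IH[of "d - da" h] True a(2) hcomp_homog[of n "d - da" k] by (simp add: h_def)
      show ?thesis using ideal.span_add[OF gh ideal.span_scale[OF hG, of a]] by (simp add: mult.commute)
    qed
  qed
  show nbG: "nzd b G"
    unfolding nzd_def
  proof (intro allI impI)
    fix g assume bg: "b * g \<in> ideal.span G"
    have "hcomp n d g \<in> ideal.span G" for d
    proof (rule hom[OF hcomp_homog])
      have "hcomp n (d + db) (g * b) \<in> ideal.span G"
        using bg by (intro span_hcomp[OF G]) (simp_all add: mult.commute)
      then show "b * hcomp n d g \<in> ideal.span G"
        unfolding hcomp_mult_homog[OF b] by (simp add: mult.commute)
    qed
    then have "(\<Sum>d\<in>mdeg n ` keys g. hcomp n d g) \<in> ideal.span G" by (intro ideal.span_sum)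
    then show "g \<in> ideal.span G" by (simp only: sum_hcomp)
  qed
  show "nzd a (insert b G)"
    unfolding nzd_def
  proof (intro allI impI)
    fix g assume "a * g \<in> ideal.span (insert b G)"
    then obtain k where k: "a * g - k * b \<in> ideal.span G" by (rule span_insertE)
    \<comment> \<open>So \<open>k * b\<close> lies in the ideal of \<open>a\<close> and
      \<open>G\<close>. Cancelling \<open>b\<close> there gives \<open>k = h * a\<close> modulo
      \<open>G\<close>, and then \<open>a\<close> is cancelled from
      \<open>a * (g - h * b)\<close>.\<close>
    have "a * g - (a * g - k * b) \<in> ideal.span (insert a G)"
    proof (rule ideal.span_diff)
      show "a * g \<in> ideal.span (insert a G)" by (intro span_multR ideal.span_base) simp
      show "a * g - k * b \<in> ideal.span (insert a G)" using k ideal.span_mono[of G "insert a G"] by auto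
    qed
    then have "b * k \<in> ideal.span (insert a G)" by (simp add: mult.commute)
    then have "k \<in> ideal.span (insert a G)" by (rule nzdD[OF nb])
    then obtain h where h: "k - h * a \<in> ideal.span G" by (rule span_insertE)
    have "(a * g - k * b) + b * (k - h * a) \<in> ideal.span G"
      by (intro ideal.span_add ideal.span_scale k h)
    then have "a * (g - h * b) \<in> ideal.span G" by (simp add: algebra_simps)
    then have "g - h * b \<in> ideal.span G" by (rule nzdD[OF na])
    then show "g \<in> ideal.span (insert b G)" by (rule span_insertI)
  qed
qed

subsection \<open>Power sums\<close>

text \<open>Expanded in powers of \<open>y i\<close>, the product has coefficients that depend only
  on \<open>z\<close>. The sum is therefore a combination of power sums, with coefficient 1 at the
  top one.\<close>

lemma power_sum_reduce:
  fixes y :: "nat \<Rightarrow> 'a::comm_ring_1"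
  assumes "finite C"
  shows "(\<Sum>i\<in>I. y i ^ a * (\<Prod>c\<in>C. y i - z c)) - (\<Sum>i\<in>I. y i ^ (a + card C))
    \<in> ideal.span ((\<lambda>r. \<Sum>i\<in>I. y i ^ r) ` {a..<a + card C})"
  using assms
proof (induction C arbitrary: a rule: finite_induct)
  case empty
  then show ?case by simp
next
  case (insert c C)
  define S where "S = (\<lambda>a. \<Sum>i\<in>I. y i ^ a * (\<Prod>c\<in>C. y i - z c))"
  define p where "p = (\<lambda>r. \<Sum>i\<in>I. y i ^ r)"
  let ?T = "ideal.span (p ` {a..<a + card (insert c C)})"
  have le: "ideal.span (p ` {a+1..<a+1 + card C}) \<subseteq> ?T" "ideal.span (p ` {a..<a + card C}) \<subseteq> ?T"
    using insert.hyps by (auto intro!: ideal.span_mono image_mono)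
  have 1: "S (a + 1) - p (a + 1 + card C) \<in> ?T"
    using insert.IH[of "a + 1"] le unfolding S_def p_def by blast
  have 2: "z c * (S a - p (a + card C)) \<in> ?T"
    using insert.IH[of a] le unfolding S_def p_def by (blast intro: ideal.span_scale)
  have 3: "z c * p (a + card C) \<in> ?T"
    using insert.hyps by (intro ideal.span_scale ideal.span_base) simp
  have "S (a + 1) - p (a + 1 + card C) - z c * (S a - p (a + card C)) - z c * p (a + card C) \<in> ?T"
    by (rule ideal.span_diff[OF ideal.span_diff[OF 1 2] 3])
  then have 4: "S (a + 1) - z c * S a - p (a + card (insert c C)) \<in> ?T"
    using insert.hyps by (simp add: algebra_simps)
  have eq: "(\<Sum>i\<in>I. y i ^ a * (\<Prod>c\<in>insert c C. y i - z c)) = S (a + 1) - z c * S a"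
    using insert.hyps by (simp add: S_def sum_distrib_left left_diff_distrib right_diff_distrib sum_subtractf ac_simps)
  show ?case
    using 4 unfolding eq p_def .
qed

text \<open>With exponent 0 the constant term of the product meets the zeroth power sum, the number
  \<open>card I\<close>; all other terms, including the top one, are multiples of the listed power
  sums.\<close>

lemma power_sum_reduce0:
  fixes y :: "nat \<Rightarrow> 'a::comm_ring_1"
  assumes "finite C"
  shows "(\<Sum>i\<in>I. \<Prod>c\<in>C. y i - z c) - of_nat (card I) * ((- 1) ^ card C * (\<Prod>c\<in>C. z c))
    \<in> ideal.span ((\<lambda>r. \<Sum>i\<in>I. y i ^ r) ` {1..card C})"
  using assms
proof (induction C rule: finite_induct)
  case empty
  then show ?case by simp
next
  case (insert c C)
  define p where "p = (\<lambda>r. \<Sum>i\<in>I. y i ^ r)"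
  let ?T = "ideal.span (p ` {1..card (insert c C)})"
  define A where "A = (\<Sum>i\<in>I. y i ^ 1 * (\<Prod>c\<in>C. y i - z c))"
  define B where "B = (\<Sum>i\<in>I. \<Prod>c\<in>C. y i - z c)"
  define E where "E = of_nat (card I) * ((- 1) ^ card C * (\<Prod>c\<in>C. z c))"
  have "A - p (1 + card C) \<in> ideal.span (p ` {1..<1 + card C})"
    unfolding A_def p_def by (rule power_sum_reduce) fact
  moreover have "ideal.span (p ` {1..<1 + card C}) \<subseteq> ?T"
    using insert.hyps by (auto intro!: ideal.span_mono image_mono)
  moreover have "p (1 + card C) \<in> ?T"
    using insert.hyps by (intro ideal.span_base) simp
  ultimately have "(A - p (1 + card C)) + p (1 + card C) \<in> ?T"
    by (blast intro: ideal.span_add)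
  then have 1: "A \<in> ?T" by simp
  have "ideal.span (p ` {1..card C}) \<subseteq> ?T"
    using insert.hyps by (auto intro!: ideal.span_mono image_mono)
  then have 2: "z c * (B - E) \<in> ?T"
    using insert.IH unfolding p_def B_def E_def by (blast intro: ideal.span_scale)
  have "A - z c * (B - E) \<in> ?T" by (rule ideal.span_diff[OF 1 2])
  moreover have "A - z c * (B - E)
      = (A - z c * B) - of_nat (card I) * ((- 1) ^ card (insert c C) * prod z (insert c C))"
    using insert.hyps by (simp add: E_def algebra_simps)
  moreover have eq: "(\<Sum>i\<in>I. \<Prod>c\<in>insert c C. y i - z c) = A - z c * B"
    using insert.hyps by (simp add: A_def B_def sum_distrib_left left_diff_distrib sum_subtractf)
  ultimately show ?case unfolding eq p_def by simp
qed

lemma span_of_nat_cancel: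
  assumes "of_nat N * p \<in> ideal.span (G :: mpol set)" "0 < N" shows "p \<in> ideal.span G"
proof -
  have "(single 0 (1 / of_nat N) :: mpol) * of_nat N = 1"
    using assms(2) unfolding single_of_nat[symmetric] mult_single by simp
  then have "single 0 (1 / of_nat N) * (of_nat N * p) = p"
    by (simp only: mult.assoc[symmetric] mult_1)
  then show ?thesis using ideal.span_scale[OF assms(1), of "single 0 (1 / of_nat N)"] by simp
qed

section \<open>Regularity of the even power sums\<close>

definition psum :: "nat \<Rightarrow> nat \<Rightarrow> mpol" where
  "psum n r = (\<Sum>i=1..n. X i ^ (2 * r))"

text \<open>Modulo these generators only the variables with index in \<open>B\<close> survive. For
  \<open>B\<close> inside \<open>{1..n}\<close> this also disposes of the variables of
  \<open>mpol\<close> with index out of range.\<close>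

definition xgens :: "nat \<Rightarrow> nat set \<Rightarrow> nat \<Rightarrow> mpol set" where
  "xgens n B r = X ` (- B) \<union> psum n ` {1..r}"

lemma homog_psum: "homog n (2 * r) (psum n r)"
  unfolding psum_def using homog_power[OF homog_X1] by (intro homog_sum) fastforce

lemma homog_xgens: "\<forall>q\<in>xgens n B r. \<exists>e. homog n e q"
  unfolding xgens_def using homog_X homog_psum by blast

lemma xgens_Suc: "xgens n B (Suc r) = insert (psum n (Suc r)) (xgens n B r)"
proof -
  have "{1..Suc r} = insert (Suc r) {1..r}" by auto
  then show ?thesis unfolding xgens_def by simp
qed

lemma xgens_remove: "l \<in> B \<Longrightarrow> xgens n (B - {l}) r = insert (X l) (xgens n B r)"
proof -
  assume "l \<in> B"
  then have "- (B - {l}) = insert l (- B)" by auto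
  then show ?thesis unfolding xgens_def by simp
qed

text \<open>Put \<open>z = y\<close> with \<open>y i\<close> the square of \<open>X i\<close> in
  \<open>power_sum_reduce0\<close>: every summand contains a zero factor, so the product of the
  \<open>y c\<close> is, up to a unit, a combination of power sums.\<close>

lemma prod_squares_mem:
  assumes "B \<subseteq> {1..n}" "B \<noteq> {}"
  shows "(\<Prod>c\<in>B. (X c)\<^sup>2) \<in> ideal.span (xgens n B (card B))"
proof -
  let ?T = "ideal.span (xgens n B (card B))"
  have fin: "finite B" using assms(1) finite_subset by blast
  define p where "p = (\<lambda>r. \<Sum>i\<in>B. (X i)\<^sup>2 ^ r)"
  \<comment> \<open>The power sums over \<open>B\<close> and over \<open>{1..n}\<close> differ by
    multiples of the variables outside \<open>B\<close>, which are generators.\<close>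
  have p: "p r \<in> ?T" if r: "r \<in> {1..card B}" for r
  proof -
    have X: "X i ^ (2 * r) \<in> ?T" if i: "i \<in> {1..n} - B" for i
    proof -
      have "X i \<in> ?T" using i by (intro ideal.span_base) (auto simp: xgens_def)
      moreover have "X i ^ (2 * r) = X i ^ (2 * r - 1) * X i"
        using r power_minus_mult[of "2 * r" "X i"] by simp
      ultimately show ?thesis by (simp add: ideal.span_scale)
    qed
    have "psum n r = p r + (\<Sum>i\<in>{1..n} - B. X i ^ (2 * r))"
      unfolding psum_def p_def power_mult[symmetric]
      by (subst sum.subset_diff[OF assms(1)]) (simp_all only: finite_atLeastAtMost add.commute)
    then have "p r = psum n r - (\<Sum>i\<in>{1..n} - B. X i ^ (2 * r))" by simp
    moreover have "psum n r \<in> ?T" using r by (intro ideal.span_base) (auto simp: xgens_def)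
    moreover have "(\<Sum>i\<in>{1..n} - B. X i ^ (2 * r)) \<in> ?T" by (rule ideal.span_sum[OF X])
    ultimately show ?thesis by (simp only: ideal.span_diff)
  qed
  have sub: "ideal.span (p ` {1..card B}) \<subseteq> ?T"
    using p by (intro ideal.span_minimal) auto
  let ?E = "of_nat (card B) * ((- 1) ^ card B * (\<Prod>c\<in>B. (X c)\<^sup>2))"
  have "(\<Sum>i\<in>B. \<Prod>c\<in>B. (X i)\<^sup>2 - (X c)\<^sup>2) - ?E \<in> ideal.span (p ` {1..card B})"
    unfolding p_def by (rule power_sum_reduce0[OF fin])
  moreover have "(\<Sum>i\<in>B. \<Prod>c\<in>B. (X i)\<^sup>2 - (X c)\<^sup>2) = 0"
    using fin by (intro sum.neutral ballI prod_zero) auto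
  ultimately have "- ?E \<in> ?T" using sub by auto
  then have "?E \<in> ?T" using ideal.span_neg by fastforce
  then have "(- 1) ^ card B * (\<Prod>c\<in>B. (X c)\<^sup>2) \<in> ?T"
    by (rule span_of_nat_cancel) (use fin assms(2) in \<open>simp add: card_gt_0_iff\<close>)
  then have "(- 1) ^ card B * ((- 1) ^ card B * (\<Prod>c\<in>B. (X c)\<^sup>2)) \<in> ?T" by (rule ideal.span_scale)
  then show ?thesis by (simp flip: mult.assoc power_mult_distrib)
qed

text \<open>Induction on \<open>card B\<close>. Setting one \<open>X l\<close> to zero reduces to
  \<open>B - {l}\<close>, where the next power sum is a nonzerodivisor; \<open>nzd_swap\<close>
  transfers this back to \<open>B\<close>. Only the last power sum, of index \<open>card B\<close>,
  needs another argument.\<close>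

lemma xgens_regular:
  assumes "B \<subseteq> {1..n}" "r < card B"
  shows "nzd (psum n (Suc r)) (xgens n B r)"
  using assms
proof (induction "card B" arbitrary: B r)
  case 0
  then show ?case by simp
next
  case (Suc m)
  have fin: "finite B" using Suc.prems(1) finite_subset by blast
  \<comment> \<open>The variables have to stay nonzerodivisors along the inner induction, since
    \<open>nzd_swap\<close> takes this as input at each stage.\<close>
  have step: "(\<forall>l\<in>B. nzd (X l) (xgens n B r)) \<and> (\<forall>r'<r. nzd (psum n (Suc r')) (xgens n B r'))"
    if "r \<le> m" for r
    using that
  proof (induction r)
    case 0
    then show ?case by (auto simp: xgens_def intro: nzd_X)
  next
    case (Suc r)
    have IH: "nzd (X l) (xgens n B r)" if "l \<in> B" for l using Suc that by simp
    have *: "nzd (psum n (Suc r)) (insert (X l) (xgens n B r))" if l: "l \<in> B" for l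
    proof -
      have "nzd (psum n (Suc r)) (xgens n (B - {l}) r)"
      proof (rule Suc.hyps(1))
        show "m = card (B - {l})" using \<open>Suc m = card B\<close> l fin by simp
        show "B - {l} \<subseteq> {1..n}" using \<open>B \<subseteq> {1..n}\<close> by auto
        show "r < card (B - {l})" using \<open>Suc m = card B\<close> l fin \<open>Suc r \<le> m\<close> by simp
      qed
      then show ?thesis by (simp add: xgens_remove[OF l])
    qed
    have "nzd (psum n (Suc r)) (xgens n B r)" "nzd (X l) (xgens n B (Suc r))" if l: "l \<in> B" for l
      using nzd_swap[OF homog_xgens homog_X1 _ homog_psum IH[OF l] *[OF l]] l \<open>B \<subseteq> {1..n}\<close>
      by (auto simp: xgens_Suc)
    moreover have "B \<noteq> {}" using \<open>Suc m = card B\<close> by auto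
    ultimately show ?case using Suc less_Suc_eq by auto
  qed
  show ?case
  proof (cases "r < m")
    case True
    then show ?thesis using step[of m] by simp
  next
    case False
    then have r: "r = m" "Suc r = card B" using Suc by auto
    \<comment> \<open>Modulo the smaller ideal the last power sum divides the product of the
      squares, which is a nonzerodivisor because all its factors are.\<close>
    have "nzd (\<Prod>c\<in>B. (X c)\<^sup>2) (xgens n B r)"
      using step[of m] r by (intro nzd_prod) (auto simp: power2_eq_square intro: nzd_mult)
    moreover have "(\<Prod>c\<in>B. (X c)\<^sup>2) \<in> ideal.span (insert (psum n (Suc r)) (xgens n B r))"
      using prod_squares_mem[of B n] Suc.prems(1) r fin xgens_Suc by (metis card.empty nat.distinct(1))
    ultimately show ?thesis using nzd_of_mem_insert by blast
  qed
qed

text \<open>By induction a power of \<open>X i\<close> lies in the ideal once some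
  \<open>X l\<close> with \<open>l\<close> in \<open>B\<close> is set to zero. Multiplying over
  \<open>l\<close> makes a power of \<open>X i\<close> a multiple of the product of the
  \<open>X l\<close>, whose square lies in the ideal.\<close>

lemma X_power_mem:
  assumes "B \<subseteq> {1..n}"
  shows "\<exists>N. X i ^ N \<in> ideal.span (xgens n B (card B))"
  using assms
proof (induction "card B" arbitrary: B)
  case 0
  then have "B = {}" using finite_subset by fastforce
  then have "X i ^ 1 \<in> ideal.span (xgens n B (card B))"
    by (intro ideal.span_base) (simp add: xgens_def)
  then show ?case by blast
next
  case (Suc m)
  have fin: "finite B" using Suc.prems(1) finite_subset by blast
  have ne: "B \<noteq> {}" using Suc by auto
  let ?G = "xgens n B (card B)"
  have "\<exists>N. X i ^ N \<in> ideal.span (insert (X l) ?G)" if l: "l \<in> B" for l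
  proof -
    have "\<exists>N. X i ^ N \<in> ideal.span (xgens n (B - {l}) (card (B - {l})))"
      using Suc l fin by (intro Suc.hyps(1)) auto
    moreover have "xgens n (B - {l}) (card (B - {l})) \<subseteq> insert (X l) ?G"
      unfolding xgens_remove[OF l] using card_mono[OF fin, of "B - {l}"] by (auto simp: xgens_def)
    ultimately show ?thesis using ideal.span_mono by blast
  qed
  then obtain N where N: "\<And>l. l \<in> B \<Longrightarrow> X i ^ N l \<in> ideal.span (insert (X l) ?G)" by metis
  define M where "M = sum N B"
  have "X i ^ M \<in> ideal.span (insert (X l) ?G)" if l: "l \<in> B" for l
  proof -
    have "N l \<le> M" unfolding M_def by (rule member_le_sum) (use l fin in auto)
    then have "X i ^ M = X i ^ (M - N l) * X i ^ N l" by (simp flip: power_add)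
    then show ?thesis using N[OF l] by (simp only: ideal.span_scale)
  qed
  then have "(X i ^ M) ^ card B \<in> ideal.span (insert (\<Prod>l\<in>B. X l) ?G)"
    by (rule prod_mod_prod[OF fin])
  then obtain k where k: "(X i ^ M) ^ card B - k * (\<Prod>l\<in>B. X l) \<in> ideal.span ?G"
    by (rule span_insertE)
  define z where "z = (X i ^ M) ^ card B"
  define P where "P = (\<Prod>l\<in>B. X l)"
  have "P * P \<in> ideal.span ?G"
    using prod_squares_mem[OF Suc.prems ne] by (simp add: P_def power2_eq_square prod.distrib)
  \<comment> \<open>Both \<open>z - k * P\<close> and \<open>P * P\<close> lie in the ideal, and
    \<open>z * z\<close> equals \<open>(z + k * P) * (z - k * P) + k * k * (P * P)\<close>.\<close>
  then have "z * z \<in> ideal.span ?G"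
  proof -
    assume PP: "P * P \<in> ideal.span ?G"
    have "(z + k * P) * (z - k * P) + (k * k) * (P * P) \<in> ideal.span ?G"
      by (rule ideal.span_add[OF ideal.span_scale[OF k[folded z_def P_def]] ideal.span_scale[OF PP]])
    then show ?thesis by (simp add: algebra_simps)
  qed
  then show ?case unfolding z_def by (simp flip: power_mult power_add) blast
qed

subsection \<open>Colon ideals of the coinvariant ideal\<close>

definition pfac :: "nat set \<Rightarrow> nat \<Rightarrow> mpol" where
  "pfac J j = X j * (\<Prod>c\<in>{1..<j} - J. (X j)\<^sup>2 - (X c)\<^sup>2)"

definition phi :: "nat \<Rightarrow> nat \<Rightarrow> mpol" where
  "phi n j = X j * (\<Prod>i\<in>{j<..n}. (X j)\<^sup>2 - (X i)\<^sup>2)"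

text \<open>For \<open>r = n - card J\<close> these generate the colon ideal of the coinvariant
  ideal by the product of the \<open>phi n j\<close> with \<open>j\<close> in \<open>J\<close>;
  smaller \<open>r\<close> serve the regularity arguments.\<close>

definition jgens :: "nat \<Rightarrow> nat set \<Rightarrow> nat \<Rightarrow> mpol set" where
  "jgens n J r = X ` (- {1..n}) \<union> pfac J ` J \<union> psum n ` {1..r}"

lemma jgens_empty: "jgens n {} r = xgens n {1..n} r"
  by (simp add: jgens_def xgens_def)

lemma jgens_mono: "r \<le> s \<Longrightarrow> jgens n J r \<subseteq> jgens n J s"
  by (auto simp: jgens_def)

lemma jgens_Suc: "jgens n J (Suc r) = insert (psum n (Suc r)) (jgens n J r)"
proof -
  have "{1..Suc r} = insert (Suc r) {1..r}" by auto
  then show ?thesis unfolding jgens_def by simp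
qed

lemma homog_pfac: "j \<in> {1..n} \<Longrightarrow> \<exists>e>0. homog n e (pfac J j)"
proof -
  assume j: "j \<in> {1..n}"
  have "homog n (1 * 2) ((X j)\<^sup>2 - (X c)\<^sup>2)" if "c \<in> {1..<j} - J" for c
    using j that by (intro homog_diff homog_power homog_X1) auto
  then have "homog n (1 + 1 * 2 * card ({1..<j} - J)) (pfac J j)"
    unfolding pfac_def using j by (intro homog_mult homog_X1 homog_prod) auto
  then show ?thesis by (metis add_gr_0 zero_less_one)
qed

lemma homog_jgens: "J \<subseteq> {1..n} \<Longrightarrow> \<forall>q\<in>jgens n J r. \<exists>e. homog n e q"
  unfolding jgens_def using homog_X homog_psum homog_pfac by blast

text \<open>For \<open>i\<close> in \<open>A\<close> the product in \<open>pfac\<close> runs over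
  indices below \<open>i\<close>, hence below \<open>b\<close>, so adding \<open>b\<close> leaves it
  unchanged.\<close>

lemma jgens_insert:
  assumes "\<forall>i\<in>A. i < b"
  shows "jgens n (insert b A) r = insert (pfac (insert b A) b) (jgens n A r)"
proof -
  have "pfac (insert b A) i = pfac A i" if "i \<in> A" for i
    unfolding pfac_def using that assms by (intro arg_cong2[of _ _ _ _ "(*)"] prod.cong) auto
  then have "pfac (insert b A) ` A = pfac A ` A" by (intro image_cong) simp_all
  then show ?thesis unfolding jgens_def by simp
qed

section \<open>Passing from \<open>A\<close> to \<open>insert b A\<close> with \<open>b\<close> a
  new maximum\<close>

context
  fixes n b :: nat and A :: "nat set" and m :: nat
  assumes A: "A \<subseteq> {1..n}" and b: "b \<in> {1..n}" and max: "\<forall>i\<in>A. i < b"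
    and m: "m = n - card (insert b A)"
begin

lemma Suc_m: "Suc m = n - card A"
proof -
  have fin: "finite (insert b A)" using A finite_subset by auto
  have "card (insert b A) \<le> card {1..n}" using A b by (intro card_mono) auto
  moreover have "card (insert b A) = Suc (card A)" using fin max by (intro card_insert_disjoint) auto
  ultimately show ?thesis using m by simp
qed

text \<open>Sum \<open>y_i \<Prod>_C (y_i - y_c)\<close>, \<open>C\<close> the complement of \<open>insert b A\<close>, over all \<open>i\<close>: the summands
  with \<open>i \<in> C\<close> vanish and those with \<open>i \<in> A\<close> are multiples of \<open>pfac A i\<close>.\<close>
lemma psum_pfac_phi:
  "psum n (Suc m) - pfac (insert b A) b * phi n b \<in> ideal.span (jgens n A m)"
proof -
  let ?T = "ideal.span (jgens n A m)"
  define C where "C = {1..n} - insert b A"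
  have cardC: "card C = m" unfolding C_def m using A b by (subst card_Diff_subset) (auto intro: finite_subset)
  define f where "f = (\<lambda>i. (X i)\<^sup>2 ^ 1 * (\<Prod>c\<in>C. (X i)\<^sup>2 - (X c)\<^sup>2))"
  have S: "(\<Sum>i\<in>{1..n}. f i) - (\<Sum>i\<in>{1..n}. (X i)\<^sup>2 ^ (1 + card C))
      \<in> ideal.span ((\<lambda>r. \<Sum>i\<in>{1..n}. (X i)\<^sup>2 ^ r) ` {1..<1 + card C})"
    unfolding f_def by (rule power_sum_reduce) (simp add: C_def)
  have p1: "(\<lambda>r. \<Sum>i\<in>{1..n}. (X i)\<^sup>2 ^ r) = psum n"
    by (rule ext) (simp only: psum_def power_mult)
  have p2: "(\<Sum>i\<in>{1..n}. (X i)\<^sup>2 ^ (1 + card C)) = psum n (Suc m)"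
    by (simp only: psum_def power_mult cardC plus_1_eq_Suc)
  have "ideal.span (psum n ` {1..<1 + card C}) \<subseteq> ?T"
    unfolding cardC jgens_def by (intro ideal.span_mono) auto
  with S[unfolded p1 p2] have 1: "(\<Sum>i\<in>{1..n}. f i) - psum n (Suc m) \<in> ?T" by (rule rev_subsetD)
  have fA: "f i \<in> ?T" if i: "i \<in> A" for i
  proof -
    have "pfac A i \<in> ?T" using i by (intro ideal.span_base) (simp add: jgens_def)
    moreover have "pfac A i dvd f i"
    proof -
      have sub: "{1..<i} - A \<subseteq> C" using i A max by (auto simp: C_def)
      have fin: "finite C" by (simp add: C_def)
      have "(\<Prod>c\<in>{1..<i} - A. (X i)\<^sup>2 - (X c)\<^sup>2) dvd (\<Prod>c\<in>C. (X i)\<^sup>2 - (X c)\<^sup>2)"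
        by (rule prod_dvd_prod_subset[OF fin sub])
      then show ?thesis unfolding pfac_def f_def power_one_right
        by (intro mult_dvd_mono) (simp_all add: power2_eq_square)
    qed
    ultimately show ?thesis by (auto simp: dvd_def intro: span_multR)
  qed
  have fC: "f i = 0" if i: "i \<in> C" for i
  proof -
    have "finite C" by (simp add: C_def)
    then have "(\<Prod>c\<in>C. (X i)\<^sup>2 - (X c)\<^sup>2) = 0" by (rule prod_zero) (use i in auto)
    then show ?thesis by (simp add: f_def)
  qed
  \<comment> \<open>The indices of \<open>C\<close> below \<open>b\<close> give \<open>pfac\<close>,
    those above \<open>b\<close> give \<open>phi\<close>, and each takes one of the two factors
    \<open>X b\<close>.\<close>
  have fb: "f b = pfac (insert b A) b * phi n b"
  proof -
    have "C = ({1..<b} - insert b A) \<union> {b<..n}" using b max by (auto simp: C_def)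
    then have "(\<Prod>c\<in>C. (X b)\<^sup>2 - (X c)\<^sup>2)
        = (\<Prod>c\<in>{1..<b} - insert b A. (X b)\<^sup>2 - (X c)\<^sup>2) * (\<Prod>c\<in>{b<..n}. (X b)\<^sup>2 - (X c)\<^sup>2)"
      by (simp only:) (intro prod.union_disjoint, auto)
    then show ?thesis by (simp add: f_def pfac_def phi_def power2_eq_square mult_ac)
  qed
  have split: "{1..n} = insert b (A \<union> C)" and disj: "A \<inter> C = {}" and fins: "finite A" "finite C" and bn: "b \<notin> A \<union> C"
    using A b max finite_subset by (auto simp: C_def)
  have "(\<Sum>i\<in>{1..n}. f i) = f b + ((\<Sum>i\<in>A. f i) + (\<Sum>i\<in>C. f i))"
    by (subst split) (use fins disj bn in \<open>simp add: sum.union_disjoint\<close>)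
  also have "(\<Sum>i\<in>C. f i) = 0" using fC by simp
  finally have 2: "(\<Sum>i\<in>{1..n}. f i) = f b + (\<Sum>i\<in>A. f i)" by simp
  have "(\<Sum>i\<in>A. f i) \<in> ?T" by (rule ideal.span_sum[OF fA])
  then have "(\<Sum>i\<in>A. f i) - ((\<Sum>i\<in>{1..n}. f i) - psum n (Suc m)) \<in> ?T"
    using 1 by (rule ideal.span_diff)
  then show ?thesis unfolding 2 fb by (simp add: algebra_simps)
qed

lemma pfac_phi_mem: "pfac (insert b A) b * phi n b \<in> ideal.span (jgens n A (Suc m))"
proof -
  have "psum n (Suc m) - (psum n (Suc m) - pfac (insert b A) b * phi n b) \<in> ideal.span (jgens n A (Suc m))"
    by (rule ideal.span_diff, rule ideal.span_base)
      (use psum_pfac_phi ideal.span_mono[OF jgens_mono[of m "Suc m" n A]] in \<open>auto simp: jgens_Suc\<close>)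
  then show ?thesis by simp
qed

text \<open>The easy half of the colon computation: the only new generator is
  \<open>pfac (insert b A) b\<close>, and \<open>phi n b\<close> times it is
  \<open>psum n (Suc m)\<close> modulo the generators kept.\<close>

lemma phi_mult_mem:
  assumes "g \<in> ideal.span (jgens n (insert b A) m)"
  shows "phi n b * g \<in> ideal.span (jgens n A (Suc m))"
proof -
  have "g \<in> ideal.span (insert (pfac (insert b A) b) (jgens n A m))"
    using assms by (simp add: jgens_insert[OF max])
  then obtain k where k: "g - k * pfac (insert b A) b \<in> ideal.span (jgens n A m)"
    by (rule span_insertE)
  then have "g - k * pfac (insert b A) b \<in> ideal.span (jgens n A (Suc m))"
    using ideal.span_mono[OF jgens_mono[of m "Suc m" n A]] by auto
  from ideal.span_add[OF ideal.span_scale[OF this, of "phi n b"] ideal.span_scale[OF pfac_phi_mem, of k]]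
  show ?thesis by (simp add: algebra_simps)
qed

context
  assumes reg: "\<forall>r<n - card A. nzd (psum n (Suc r)) (jgens n A r)"
begin

lemma nzd_pfac_phi: "nzd (pfac (insert b A) b * phi n b) (jgens n A m)"
  by (rule nzd_cong_mod[OF psum_pfac_phi], rule reg[rule_format]) (simp flip: Suc_m)

text \<open>Descending induction from \<open>r = m\<close>, where \<open>pfac\<close> is a factor of
  the nonzerodivisor \<open>pfac * phi\<close>; \<open>nzd_swap\<close> removes one power sum per
  step.\<close>

lemma nzd_pfac: "r \<le> m \<Longrightarrow> nzd (pfac (insert b A) b) (jgens n A r)"
proof (induction r rule: inc_induct)
  case base
  show ?case using nzd_pfac_phi by (subst (asm) mult.commute) (rule nzd_factor)
next
  case (step r)
  have 1: "nzd (psum n (Suc r)) (jgens n A r)" using reg step Suc_m by auto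
  obtain e where 2: "homog n e (pfac (insert b A) b)" using homog_pfac[OF b] by blast
  show ?case
    by (rule nzd_swap(1)[OF homog_jgens[OF A] homog_psum _ 2 1]) (use step in \<open>simp_all add: jgens_Suc\<close>)
qed

lemma regular_insert: "\<forall>r<n - card (insert b A). nzd (psum n (Suc r)) (jgens n (insert b A) r)"
proof (intro allI impI)
  fix r assume r: "r < n - card (insert b A)"
  then have 1: "nzd (psum n (Suc r)) (jgens n A r)" using reg Suc_m m by auto
  obtain e where 2: "homog n e (pfac (insert b A) b)" using homog_pfac[OF b] by blast
  have 3: "nzd (pfac (insert b A) b) (insert (psum n (Suc r)) (jgens n A r))"
    using nzd_pfac[of "Suc r"] r m by (simp add: jgens_Suc)
  show "nzd (psum n (Suc r)) (jgens n (insert b A) r)"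
    unfolding jgens_insert[OF max] by (rule nzd_swap(2)[OF homog_jgens[OF A] homog_psum _ 2 1 3]) simp
qed

text \<open>If \<open>phi n b * g\<close> is \<open>k * psum n (Suc m)\<close> modulo the smaller
  ideal, replace the power sum by \<open>pfac * phi\<close> and cancel \<open>phi\<close>, a factor
  of a nonzerodivisor.\<close>

lemma phi_cancel:
  assumes "phi n b * g \<in> ideal.span (jgens n A (Suc m))"
  shows "g \<in> ideal.span (jgens n (insert b A) m)"
proof -
  obtain k where k: "phi n b * g - k * psum n (Suc m) \<in> ideal.span (jgens n A m)"
    using assms unfolding jgens_Suc by (rule span_insertE)
  from ideal.span_add[OF k ideal.span_scale[OF psum_pfac_phi, of k]]
  have "phi n b * (g - k * pfac (insert b A) b) \<in> ideal.span (jgens n A m)"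
    by (simp add: algebra_simps)
  then have "g - k * pfac (insert b A) b \<in> ideal.span (jgens n A m)"
    using nzdD[OF nzd_factor[OF nzd_pfac_phi]] by blast
  then show ?thesis unfolding jgens_insert[OF max] by (rule span_insertI)
qed

text \<open>As \<open>X b\<close> divides \<open>pfac\<close>, the element \<open>pfac * g\<close>
  lies in the ideal, so modulo \<open>jgens n A m\<close> it is \<open>k * pfac * phi\<close>.
  Cancelling \<open>pfac\<close> shows that \<open>g\<close> is \<open>phi n b * k\<close>, and
  \<open>phi_cancel\<close> passes the socle condition on to \<open>k\<close>.\<close>

lemma socle_step:
  assumes g: "\<And>i. X i * g \<in> ideal.span (jgens n A (Suc m))"
  obtains h where "g - phi n b * h \<in> ideal.span (jgens n A (Suc m))"
    "\<And>i. X i * h \<in> ideal.span (jgens n (insert b A) m)"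
proof -
  let ?p = "pfac (insert b A) b" and ?T = "ideal.span (jgens n A (Suc m))"
  have sub: "ideal.span (jgens n A m) \<subseteq> ?T"
    by (intro ideal.span_mono jgens_mono) simp
  have "?p * g \<in> ?T"
    using span_multR[OF g[of b], of "\<Prod>c\<in>{1..<b} - insert b A. (X b)\<^sup>2 - (X c)\<^sup>2"]
    by (simp only: pfac_def mult_ac)
  then obtain k where k: "?p * g - k * psum n (Suc m) \<in> ideal.span (jgens n A m)"
    unfolding jgens_Suc by (rule span_insertE)
  from ideal.span_add[OF k ideal.span_scale[OF psum_pfac_phi, of k]]
  have "?p * (g - phi n b * k) \<in> ideal.span (jgens n A m)"
    by (simp add: algebra_simps)
  then have "g - phi n b * k \<in> ideal.span (jgens n A m)" by (rule nzdD[OF nzd_pfac[OF order_refl]])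
  then have 1: "g - phi n b * k \<in> ?T" using sub by blast
  have "X i * k \<in> ideal.span (jgens n (insert b A) m)" for i
  proof (rule phi_cancel)
    have "X i * g - X i * (g - phi n b * k) \<in> ?T"
      by (rule ideal.span_diff[OF g ideal.span_scale[OF 1]])
    then show "phi n b * (X i * k) \<in> ?T" by (simp add: algebra_simps)
  qed
  with 1 show thesis by (rule that)
qed

end
end

section \<open>Colon ideals and socle of the coinvariant ideal\<close>

abbreviation coinv :: "nat \<Rightarrow> mpol set" where
  "coinv n \<equiv> ideal.span (xgens n {1..n} n)"

text \<open>Adding the elements of \<open>J\<close> in increasing order carries along regularity,
  both inclusions for the colon ideal, and the divisibility of socle elements by the product of the
  \<open>phi n j\<close>. Regularity is what permits the cancellations in the next step.\<close>

lemma jgens_chain: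
  assumes "finite J" "J \<subseteq> {1..n}"
  shows "(\<forall>r<n - card J. nzd (psum n (Suc r)) (jgens n J r)) \<and>
    (\<forall>g. prod (phi n) J * g \<in> coinv n \<longrightarrow> g \<in> ideal.span (jgens n J (n - card J))) \<and>
    (\<forall>g\<in>ideal.span (jgens n J (n - card J)). prod (phi n) J * g \<in> coinv n) \<and>
    (\<forall>g. (\<forall>i. X i * g \<in> coinv n) \<longrightarrow>
      (\<exists>h. g - prod (phi n) J * h \<in> coinv n \<and> (\<forall>i. X i * h \<in> ideal.span (jgens n J (n - card J)))))"
  using assms
proof (induction J rule: finite_linorder_max_induct)
  case empty
  have "\<forall>r<n - card {}. nzd (psum n (Suc r)) (jgens n {} r)"
    by (auto simp: jgens_empty intro: xgens_regular)
  moreover have "\<exists>h. g - 1 * h \<in> coinv n \<and> (\<forall>i. X i * h \<in> coinv n)" if "\<forall>i. X i * g \<in> coinv n" for g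
    using that by (intro exI[of _ g]) (simp add: ideal.span_zero)
  ultimately show ?case by (simp add: jgens_empty)
next
  case (insert b A)
  define m where "m = n - card (insert b A)"
  have A: "A \<subseteq> {1..n}" "b \<in> {1..n}" using insert.prems by auto
  note step = A insert.hyps(2) m_def
  have m: "n - card A = Suc m" by (rule Suc_m[OF step, symmetric])
  have IH: "\<forall>r<n - card A. nzd (psum n (Suc r)) (jgens n A r)"
    "\<And>g. prod (phi n) A * g \<in> coinv n \<Longrightarrow> g \<in> ideal.span (jgens n A (Suc m))"
    "\<And>g. g\<in>ideal.span (jgens n A (Suc m)) \<Longrightarrow> prod (phi n) A * g \<in> coinv n"
    "\<And>g. (\<forall>i. X i * g \<in> coinv n) \<Longrightarrow>
      (\<exists>h. g - prod (phi n) A * h \<in> coinv n \<and> (\<forall>i. X i * h \<in> ideal.span (jgens n A (Suc m))))"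
    using insert.IH[OF A(1)] unfolding m by blast+
  have P: "prod (phi n) (insert b A) = prod (phi n) A * phi n b"
    using insert.hyps by (subst prod.insert) (auto simp: mult.commute)
  show ?case unfolding P m_def[symmetric]
  proof (intro conjI allI impI ballI)
    show "nzd (psum n (Suc r)) (jgens n (insert b A) r)" if "r < m" for r
      using regular_insert[OF step IH(1)] that by (simp add: m_def)
    show "g \<in> ideal.span (jgens n (insert b A) m)" if "prod (phi n) A * phi n b * g \<in> coinv n" for g
      using that by (intro phi_cancel[OF step IH(1)] IH(2)) (simp add: mult.assoc)
    show "prod (phi n) A * phi n b * g \<in> coinv n" if "g \<in> ideal.span (jgens n (insert b A) m)" for g
      using IH(3)[OF phi_mult_mem[OF step that]] by (simp add: mult.assoc)
    fix g assume "\<forall>i. X i * g \<in> coinv n"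
    then obtain h where h: "g - prod (phi n) A * h \<in> coinv n" "\<And>i. X i * h \<in> ideal.span (jgens n A (Suc m))"
      using IH(4) by blast
    obtain k where k: "h - phi n b * k \<in> ideal.span (jgens n A (Suc m))"
      "\<And>i. X i * k \<in> ideal.span (jgens n (insert b A) m)"
      using socle_step[OF step IH(1) h(2)] by blast
    from ideal.span_add[OF h(1) IH(3)[OF k(1)]]
    have "g - prod (phi n) A * phi n b * k \<in> coinv n" by (simp add: algebra_simps)
    with k(2) show "\<exists>h. g - prod (phi n) A * phi n b * h \<in> coinv n \<and> (\<forall>i. X i * h \<in> ideal.span (jgens n (insert b A) m))"
      by blast
  qed
qed

lemma coinv_colon:
  assumes "J \<subseteq> {1..n}" "prod (phi n) J * g \<in> coinv n"
  shows "g \<in> ideal.span (jgens n J (n - card J))"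
  using jgens_chain[of J n] assms finite_subset by blast

text \<open>For \<open>J = {1..n}\<close> the products in \<open>pfac\<close> are empty, so the last
  ideal of the chain is generated by all variables and only the constant term of the cofactor
  \<open>h\<close> matters.\<close>

lemma coinv_socle:
  assumes "\<And>i. X i * g \<in> coinv n"
  shows "\<exists>c. g - single 0 c * prod (phi n) {1..n} \<in> coinv n"
proof -
  obtain h where h: "g - prod (phi n) {1..n} * h \<in> coinv n"
    using jgens_chain[of "{1..n}" n] assms by blast
  have "jgens n {1..n} 0 = X ` UNIV"
  proof -
    have "{1..<j} - {1..n} = {}" if "j \<in> {1..n}" for j :: nat using that by auto
    then have "pfac {1..n} ` {1..n} = X ` {1..n}"
      unfolding pfac_def by (intro image_cong) (simp_all only: prod.empty mult_1_right)
    then show ?thesis unfolding jgens_def by (auto simp flip: image_Un)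
  qed
  moreover have "h - single 0 (lookup h 0) \<in> ideal.span (X ` UNIV)"
    unfolding span_X_iff
  proof
    fix m assume "m \<in> keys (h - single 0 (lookup h 0))"
    then have "m \<noteq> 0" by (auto simp: in_keys_iff lookup_minus lookup_single)
    then show "\<exists>a\<in>UNIV. 0 < m a" by (auto simp: fun_eq_iff)
  qed
  ultimately have "h - single 0 (lookup h 0) \<in> ideal.span (jgens n {1..n} (n - card {1..n}))" by simp
  then have "prod (phi n) {1..n} * (h - single 0 (lookup h 0)) \<in> coinv n"
    using jgens_chain[of "{1..n}" n] by blast
  from ideal.span_add[OF h this] show ?thesis by (intro exI[of _ "lookup h 0"]) (simp add: algebra_simps)
qed

text \<open>An ideal not inside \<open>coinv n\<close> would contain a socle element outside
  \<open>coinv n\<close>, found by multiplying with the highest powers of the variables that stay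
  outside. By \<open>coinv_socle\<close> it is a nonzero multiple of the product of the
  \<open>phi n j\<close> modulo \<open>coinv n\<close>.\<close>

lemma coinv_maximal:
  assumes sub: "ideal.subspace I" and gens: "xgens n {1..n} n \<subseteq> I"
    and delta: "prod (phi n) {1..n} \<notin> I"
  shows "I \<subseteq> coinv n"
proof (rule ccontr)
  assume "\<not> I \<subseteq> coinv n"
  then obtain g where g: "g \<in> I" "g \<notin> coinv n" by blast
  have IC: "coinv n \<subseteq> I" by (rule ideal.span_minimal[OF gens sub])
  have "\<exists>h\<in>I. h \<notin> coinv n \<and> (\<forall>i\<in>F. X i * h \<in> coinv n)" if "finite F" for F
    using that
  proof induction
    case empty
    then show ?case using g by blast
  next
    case (insert l F)
    then obtain h where h: "h \<in> I" "h \<notin> coinv n" "\<forall>i\<in>F. X i * h \<in> coinv n" by blast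
    obtain N where "X l ^ N \<in> coinv n" using X_power_mem[of "{1..n}" n l] by auto
    then have ex: "X l ^ N * h \<in> coinv n" by (rule span_multR)
    \<comment> \<open>The least exponent that moves \<open>h\<close> into the ideal is positive, so
      the preceding power keeps \<open>h\<close> outside and is killed by
      \<open>X l\<close>.\<close>
    define e where "e = (LEAST e. X l ^ e * h \<in> coinv n)"
    have e: "X l ^ e * h \<in> coinv n" unfolding e_def using ex by (rule LeastI)
    have "e \<noteq> 0" using e h(2) by (intro notI) simp
    then obtain d where d: "e = Suc d" using not0_implies_Suc by blast
    have "X l ^ d * h \<notin> coinv n" using not_less_Least[of d "\<lambda>e. X l ^ e * h \<in> coinv n"] d e_def by auto
    moreover have "X l ^ d * h \<in> I" using sub h(1) by (rule ideal.subspace_scale)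
    moreover have "X i * (X l ^ d * h) \<in> coinv n" if "i \<in> insert l F" for i
    proof (cases "i = l")
      case True
      then show ?thesis using e d by (simp add: mult.assoc)
    next
      case False
      then have "X l ^ d * (X i * h) \<in> coinv n" using h(3) that by (intro ideal.span_scale[of "X i * h"]) auto
      then show ?thesis by (simp add: mult.left_commute)
    qed
    ultimately show ?case by blast
  qed
  from this[of "{1..n}"] obtain h where h: "h \<in> I" "h \<notin> coinv n" "\<forall>i\<in>{1..n}. X i * h \<in> coinv n"
    by auto
  have "X i * h \<in> coinv n" for i
  proof (cases "i \<in> {1..n}")
    case False
    then have "X i \<in> coinv n" by (intro ideal.span_base) (simp add: xgens_def)
    then show ?thesis by (rule span_multR)
  qed (use h in blast)
  then obtain c where c: "h - single 0 c * prod (phi n) {1..n} \<in> coinv n" using coinv_socle by blast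
  have "h - (h - single 0 c * prod (phi n) {1..n}) \<in> I"
    by (rule ideal.subspace_diff[OF sub h(1)]) (use c IC in blast)
  then have cI: "single 0 c * prod (phi n) {1..n} \<in> I" by (simp only: diff_diff_eq2 add_diff_cancel_left')
  show False
  proof (cases "c = 0")
    case True
    then show False using c h(2) by simp
  next
    case False
    have "single 0 (1 / c) * (single 0 c * prod (phi n) {1..n}) \<in> I"
      using sub cI by (rule ideal.subspace_scale)
    then show False using delta False by (simp add: mult_single flip: mult.assoc)
  qed
qed

subsection \<open>Operators on superspace\<close>

lemmas fun_op_apply = plus_fun_apply zero_fun_apply minus_apply uminus_apply

lemma sum_fun_apply: "(sum f A) k = (\<Sum>x\<in>A. f x k)"
  by (induction A rule: infinite_finite_induct) auto

declare fun_op_apply [simp del]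

lemma om_add_eq: "om_add f g = f + g"
  by (simp add: om_add_def plus_fun_def)

lemma om_diff_eq: "om_diff f g = f - g"
  by (simp add: om_diff_def fun_diff_def)

lemma om_zero_eq: "om_zero = 0"
  by (simp add: om_zero_def zero_fun_def)

interpretation om: vector_space om_smult
  by unfold_locales (auto simp: om_smult_def fun_eq_iff fun_op_apply algebra_simps)

declare om.scale_scale [simp del]

definition lin :: "(om \<Rightarrow> om) \<Rightarrow> bool" where
  "lin A \<longleftrightarrow> (\<forall>f g. A (f + g) = A f + A g) \<and> (\<forall>c f. A (om_smult c f) = om_smult c (A f))"

lemma linI: "(\<And>f g. A (f + g) = A f + A g) \<Longrightarrow> (\<And>c f. A (om_smult c f) = om_smult c (A f)) \<Longrightarrow> lin A"
  by (simp add: lin_def)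

lemma lin_add: "lin A \<Longrightarrow> A (f + g) = A f + A g"
  and lin_smult: "lin A \<Longrightarrow> A (om_smult c f) = om_smult c (A f)"
  by (simp_all add: lin_def)

lemma lin_0: "lin A \<Longrightarrow> A 0 = 0"
  using lin_smult[of A 0 0] by simp

lemma lin_minus: "lin A \<Longrightarrow> A (- f) = - A f"
  using lin_smult[of A "- 1" f] by simp

lemma lin_sum: "lin A \<Longrightarrow> A (sum f F) = (\<Sum>x\<in>F. A (f x))"
  by (induction F rule: infinite_finite_induct) (auto simp: lin_0 lin_add)

lemma lin_comp: "lin A \<Longrightarrow> lin B \<Longrightarrow> lin (\<lambda>f. A (B f))"
  by (simp add: lin_def)

lemma lin_scaled: "lin A \<Longrightarrow> lin (\<lambda>f. om_smult c (A f))"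
  by (auto simp: lin_def om.scale_right_distrib om.scale_scale mult.commute)

lemma lin_id: "lin (\<lambda>f. f)"
  by (simp add: lin_def)

lemma lin_funpow: "lin A \<Longrightarrow> lin (A ^^ k)"
  by (induction k) (simp_all add: lin_def)

definition sg :: "nat \<Rightarrow> nat set \<Rightarrow> complex" where
  "sg i U = (- 1) ^ card {t \<in> U. t < i}"

lemma sg_sq [simp]: "sg i U * sg i U = 1" "sg i U * (sg i U * z) = z"
  by (simp_all add: sg_def flip: power_add mult.assoc)

lemma sg_remove: "j \<in> U \<Longrightarrow> sg i (U - {j}) = (if j < i then - sg i U else sg i U)"
proof -
  assume j: "j \<in> U"
  show ?thesis
  proof (cases "j < i")
    case True
    have "{t \<in> U. t < i} = insert j {t \<in> U - {j}. t < i}" using j True by auto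
    then have "card {t \<in> U. t < i} = Suc (card {t \<in> U - {j}. t < i})" by simp
    then show ?thesis using True by (simp add: sg_def)
  next
    case False
    then have "{t \<in> U. t < i} = {t \<in> U - {j}. t < i}" by auto
    then show ?thesis using False by (simp add: sg_def)
  qed
qed

lemma sg_insert: "j \<notin> U \<Longrightarrow> sg i (insert j U) = (if j < i then - sg i U else sg i U)"
  using sg_remove[of j "insert j U" i] by (auto split: if_splits)

lemma sg_remove_self [simp]: "sg i (U - {i}) = sg i U"
  by (cases "i \<in> U") (simp_all add: sg_remove)

lemma sg_insert_self [simp]: "sg i (insert i U) = sg i U"
  by (cases "i \<in> U") (simp_all add: sg_insert insert_absorb)

lemma multh_apply: "multh i g (b, U) = (if i \<in> U then sg i U * g (b, U - {i}) else 0)"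
  by (simp add: multh_def sg_def)

lemma dth_apply: "dth i g (b, U) = (if i \<notin> U then sg i U * g (b, insert i U) else 0)"
  by (simp add: dth_def sg_def)

lemma mulx_apply: "mulx i g (b, U) = (if 0 < b i then g (b(i := b i - 1), U) else 0)"
  by (simp add: mulx_def)

lemma dx_apply: "dx i g (b, U) = of_nat (b i + 1) * g (b(i := b i + 1), U)"
  by (simp add: dx_def)

lemmas op_apply = multh_apply dth_apply mulx_apply dx_apply

lemma om_smult_apply: "om_smult c f k = c * f k"
  by (simp add: om_smult_def)

text \<open>The infinite sets are sent to 0 to make the parity anticommute with all \<open>multh i\<close>.\<close>
definition par :: "om \<Rightarrow> om" where
  "par g = (\<lambda>(b, U). if finite U then (- 1) ^ card U * g (b, U) else 0)"

lemma par_apply: "par g (b, U) = (if finite U then (- 1) ^ card U * g (b, U) else 0)"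
  by (simp add: par_def)

lemma om_eqI: "(\<And>b U. f (b, U) = g (b, U)) \<Longrightarrow> f = (g :: om)"
  by auto

lemma lin_ops [simp, intro]: "lin (mulx i)" "lin (multh i)" "lin (dx i)" "lin (dth i)" "lin par"
  by (intro linI om_eqI; simp add: op_apply par_apply om_smult_apply fun_op_apply algebra_simps)+

lemma mulx_mulx: "mulx i (mulx j f) = mulx j (mulx i f)"
  by (rule om_eqI) (auto simp: op_apply fun_upd_twist)

lemma dx_dx: "dx i (dx j f) = dx j (dx i f)"
  by (rule om_eqI) (auto simp: op_apply fun_upd_twist)

lemma mulx_multh: "mulx i (multh j f) = multh j (mulx i f)"
  and mulx_dth: "mulx i (dth j f) = dth j (mulx i f)"
  and dx_multh: "dx i (multh j f) = multh j (dx i f)"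
  and dx_dth: "dx i (dth j f) = dth j (dx i f)"
  and mulx_par: "mulx i (par f) = par (mulx i f)"
  and dx_par: "dx i (par f) = par (dx i f)"
  by (rule om_eqI, auto simp: op_apply par_apply)+

lemma multh_multh_same: "multh i (multh i f) = 0"
  and dth_dth_same: "dth i (dth i f) = 0"
  by (rule om_eqI, simp add: op_apply fun_op_apply)+

lemma multh_multh: "multh i (multh j f) = - multh j (multh i f)"
proof (cases "i = j")
  case False
  have "U - {i} - {j} = U - {j} - {i}" for U by auto
  then show ?thesis using False by (intro om_eqI) (auto simp: op_apply fun_op_apply sg_remove)
qed (simp add: multh_multh_same)

lemma dth_dth: "dth i (dth j f) = - dth j (dth i f)"
proof (cases "i = j")
  case False
  have "insert i (insert j U) = insert j (insert i U)" for U by auto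
  then show ?thesis using False by (intro om_eqI) (auto simp: op_apply fun_op_apply sg_insert)
qed (simp add: dth_dth_same)

lemma dth_multh: "dth i (multh j f) + multh j (dth i f) = (if i = j then f else 0)"
proof (cases "i = j")
  case True
  then show ?thesis by (intro om_eqI) (auto simp: op_apply fun_op_apply insert_absorb)
next
  case False
  then have "insert i U - {j} = insert i (U - {j})" for U by auto
  then show ?thesis using False by (intro om_eqI) (auto simp: op_apply fun_op_apply sg_remove sg_insert)
qed

lemma par_multh: "par (multh i f) = - multh i (par f)"
proof (rule om_eqI)
  fix b U
  show "par (multh i f) (b, U) = (- multh i (par f)) (b, U)"
  proof (cases "finite U \<and> i \<in> U")
    case True
    then have "card U = Suc (card (U - {i}))" using card.remove[of U i] by simp
    then have "(- 1 :: complex) ^ card U = - ((- 1) ^ card (U - {i}))" by (metis mult_minus1 power_Suc)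
    then show ?thesis using True by (simp add: op_apply par_apply fun_op_apply del: card_Diff_singleton card_Diff_insert)
  qed (auto simp: op_apply par_apply fun_op_apply)
qed

section \<open>Membership in \<open>Omega n\<close> and its induction principles\<close>

lemma Omega_iff:
  "f \<in> Omega n \<longleftrightarrow> finite (supp f) \<and> (\<forall>a S. f (a, S) \<noteq> 0 \<longrightarrow> (\<forall>i. i \<notin> {1..n} \<longrightarrow> a i = 0) \<and> S \<subseteq> {1..n})"
  by (simp add: Omega_def)

lemma OmegaD:
  assumes "f \<in> Omega n" "f (a, S) \<noteq> 0"
  shows "i \<notin> {1..n} \<Longrightarrow> a i = 0" "S \<subseteq> {1..n}" "finite S"
  using assms finite_subset[of S "{1..n}"] unfolding Omega_iff by blast+

lemma par_par: "f \<in> Omega n \<Longrightarrow> par (par f) = f"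
proof (rule om_eqI)
  fix b U assume "f \<in> Omega n"
  then show "par (par f) (b, U) = f (b, U)"
    using OmegaD(3)[of f n b U] by (cases "f (b, U) = 0") (auto simp: par_apply simp flip: mult.assoc power_mult_distrib)
qed

lemma OmegaI:
  assumes "finite M" "\<And>a S. f (a, S) \<noteq> 0 \<Longrightarrow> (a, S) \<in> M \<and> (\<forall>i. i \<notin> {1..n} \<longrightarrow> a i = 0) \<and> S \<subseteq> {1..n}"
  shows "f \<in> Omega n"
proof -
  have "supp f \<subseteq> M" using assms(2) by (auto simp: supp_def)
  then show ?thesis using assms finite_subset unfolding Omega_iff by blast
qed

lemma Omega_finite: "f \<in> Omega n \<Longrightarrow> finite (supp f)"
  by (simp add: Omega_iff)

lemma Omega_0 [simp]: "0 \<in> Omega n"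
  by (rule OmegaI[of "{}"]) (auto simp: fun_op_apply)

lemma Omega_add: "f \<in> Omega n \<Longrightarrow> g \<in> Omega n \<Longrightarrow> f + g \<in> Omega n"
proof (rule OmegaI[of "supp f \<union> supp g"])
  fix a S assume fg: "f \<in> Omega n" "g \<in> Omega n" and "(f + g) (a, S) \<noteq> 0"
  then have "f (a, S) \<noteq> 0 \<or> g (a, S) \<noteq> 0" by (auto simp: fun_op_apply)
  then show "(a, S) \<in> supp f \<union> supp g \<and> (\<forall>i. i \<notin> {1..n} \<longrightarrow> a i = 0) \<and> S \<subseteq> {1..n}"
    using fg OmegaD[of f n a S] OmegaD[of g n a S] by (auto simp: supp_def)
qed (auto simp: Omega_finite)

text \<open>The operators below move monomials by a map \<open>h\<close> and rescale them; it is
  enough that \<open>h\<close> keeps the indices inside \<open>{1..n}\<close>.\<close>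

lemma Omega_transform:
  assumes f: "f \<in> Omega n"
    and 1: "\<And>a S. g (a, S) \<noteq> 0 \<Longrightarrow> \<exists>a' S'. f (a', S') \<noteq> 0 \<and> (a, S) = h (a', S')"
    and 2: "\<And>a S. f (a, S) \<noteq> 0 \<Longrightarrow> (\<forall>i. i \<notin> {1..n} \<longrightarrow> a i = 0) \<Longrightarrow> S \<subseteq> {1..n} \<Longrightarrow>
      (\<forall>i. i \<notin> {1..n} \<longrightarrow> fst (h (a, S)) i = 0) \<and> snd (h (a, S)) \<subseteq> {1..n}"
  shows "g \<in> Omega n"
proof (rule OmegaI[of "h ` supp f"])
  show "finite (h ` supp f)" using f by (simp add: Omega_finite)
  fix a S assume "g (a, S) \<noteq> 0"
  then obtain a' S' where *: "f (a', S') \<noteq> 0" "(a, S) = h (a', S')" using 1 by blast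
  have "\<forall>i. i \<notin> {1..n} \<longrightarrow> a' i = 0" "S' \<subseteq> {1..n}" using OmegaD[OF f *(1)] by blast+
  from 2[OF *(1) this] show "(a, S) \<in> h ` supp f \<and> (\<forall>i. i \<notin> {1..n} \<longrightarrow> a i = 0) \<and> S \<subseteq> {1..n}"
    using * unfolding supp_def by (metis (mono_tags, lifting) fst_conv image_eqI mem_Collect_eq snd_conv)
qed

lemma Omega_smult: "f \<in> Omega n \<Longrightarrow> om_smult c f \<in> Omega n"
  by (erule Omega_transform[where h = "\<lambda>m. m"]) (auto simp: om_smult_apply)

lemma Omega_par: "f \<in> Omega n \<Longrightarrow> par f \<in> Omega n"
  by (erule Omega_transform[where h = "\<lambda>m. m"]) (auto simp: par_apply split: if_splits)

lemma Omega_mulx: "f \<in> Omega n \<Longrightarrow> i \<in> {1..n} \<Longrightarrow> mulx i f \<in> Omega n"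
proof (erule Omega_transform[where h = "\<lambda>(a, S). (a(i := a i + 1), S)"])
  fix a S assume "mulx i f (a, S) \<noteq> 0"
  then have "f (a(i := a i - 1), S) \<noteq> 0 \<and> 0 < a i" by (auto simp: mulx_apply split: if_splits)
  then show "\<exists>a' S'. f (a', S') \<noteq> 0 \<and> (a, S) = (case (a', S') of (a, S) \<Rightarrow> (a(i := a i + 1), S))"
    by (intro exI[of _ "a(i := a i - 1)"] exI[of _ S]) (auto simp: fun_eq_iff)
qed auto

lemma Omega_dx: "f \<in> Omega n \<Longrightarrow> dx i f \<in> Omega n"
proof (erule Omega_transform[where h = "\<lambda>(a, S). (a(i := a i - 1), S)"])
  fix a S assume "dx i f (a, S) \<noteq> 0"
  then have "f (a(i := a i + 1), S) \<noteq> 0" by (auto simp: dx_apply)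
  then show "\<exists>a' S'. f (a', S') \<noteq> 0 \<and> (a, S) = (case (a', S') of (a, S) \<Rightarrow> (a(i := a i - 1), S))"
    by (intro exI[of _ "a(i := a i + 1)"] exI[of _ S]) (auto simp: fun_eq_iff)
qed auto

lemma Omega_multh: "f \<in> Omega n \<Longrightarrow> i \<in> {1..n} \<Longrightarrow> multh i f \<in> Omega n"
proof (erule Omega_transform[where h = "\<lambda>(a, S). (a, insert i S)"])
  fix a S assume "multh i f (a, S) \<noteq> 0"
  then have "f (a, S - {i}) \<noteq> 0 \<and> i \<in> S" by (auto simp: multh_apply split: if_splits)
  then show "\<exists>a' S'. f (a', S') \<noteq> 0 \<and> (a, S) = (case (a', S') of (a, S) \<Rightarrow> (a, insert i S))"
    by (intro exI[of _ a] exI[of _ "S - {i}"]) auto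
qed auto

lemma Omega_dth: "f \<in> Omega n \<Longrightarrow> dth i f \<in> Omega n"
proof (erule Omega_transform[where h = "\<lambda>(a, S). (a, S - {i})"])
  fix a S assume "dth i f (a, S) \<noteq> 0"
  then have "f (a, insert i S) \<noteq> 0 \<and> i \<notin> S" by (auto simp: dth_apply split: if_splits)
  then show "\<exists>a' S'. f (a', S') \<noteq> 0 \<and> (a, S) = (case (a', S') of (a, S) \<Rightarrow> (a, S - {i}))"
    by (intro exI[of _ a] exI[of _ "insert i S"]) auto
qed auto

lemma Omega_sum: "(\<And>x. x \<in> F \<Longrightarrow> f x \<in> Omega n) \<Longrightarrow> sum f F \<in> Omega n"
  by (induction F rule: infinite_finite_induct) (auto simp: Omega_add)

lemma Omega_minus: "f \<in> Omega n \<Longrightarrow> - f \<in> Omega n"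
  using Omega_smult[of f n "- 1"] by simp

lemma Omega_funpow: "(\<And>g. g \<in> Omega n \<Longrightarrow> A g \<in> Omega n) \<Longrightarrow> f \<in> Omega n \<Longrightarrow> (A ^^ k) f \<in> Omega n"
  by (induction k) auto

lemma basis_Omega_iff: "basis (a, S) \<in> Omega n \<longleftrightarrow> (\<forall>i. i \<notin> {1..n} \<longrightarrow> a i = 0) \<and> S \<subseteq> {1..n}"
proof
  assume "basis (a, S) \<in> Omega n"
  from OmegaD[OF this, of a S] show "(\<forall>i. i \<notin> {1..n} \<longrightarrow> a i = 0) \<and> S \<subseteq> {1..n}"
    by (auto simp: basis_def)
next
  assume "(\<forall>i. i \<notin> {1..n} \<longrightarrow> a i = 0) \<and> S \<subseteq> {1..n}"
  then show "basis (a, S) \<in> Omega n"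
    by (intro OmegaI[of "{(a, S)}"]) (auto simp: basis_def split: if_splits)
qed

lemma om_one_Omega [simp]: "om_one \<in> Omega n"
  by (simp add: om_one_def basis_Omega_iff)

lemma om_expand: "finite M \<Longrightarrow> supp f \<subseteq> M \<Longrightarrow> f = (\<Sum>m\<in>M. om_smult (f m) (basis m))"
proof (rule ext)
  fix k assume "finite M" "supp f \<subseteq> M"
  then show "f k = (\<Sum>m\<in>M. om_smult (f m) (basis m)) k"
    by (cases "k \<in> M") (auto simp: sum_fun_apply om_smult_apply basis_def supp_def if_distrib cong: if_cong)
qed

lemma Omega_induct [consumes 1, case_names basis add]:
  assumes f: "f \<in> Omega n"
    and b: "\<And>a S c. basis (a, S) \<in> Omega n \<Longrightarrow> P (om_smult c (basis (a, S)))"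
    and add: "\<And>f g. f \<in> Omega n \<Longrightarrow> g \<in> Omega n \<Longrightarrow> P f \<Longrightarrow> P g \<Longrightarrow> P (f + g)"
  shows "P f"
proof -
  have P0: "P 0" using b[of "\<lambda>_. 0" "{}" 0] om_one_Omega by (simp add: om_one_def)
  have bas: "basis m \<in> Omega n" if "m \<in> supp f" for m
    using that OmegaD[OF f, of "fst m" "snd m"] basis_Omega_iff[of "fst m" "snd m" n]
    by (auto simp: supp_def)
  have "P (\<Sum>m\<in>F. om_smult (f m) (basis m)) \<and> (\<Sum>m\<in>F. om_smult (f m) (basis m)) \<in> Omega n"
    if "finite F" "F \<subseteq> supp f" for F
    using that
  proof induction
    case empty
    then show ?case using P0 by simp
  next
    case (insert m F)
    have "P (om_smult (f m) (basis m))" "om_smult (f m) (basis m) \<in> Omega n"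
      using insert.prems bas[of m] b[of "fst m" "snd m" "f m"] Omega_smult by auto
    then show ?case using insert by (simp add: add Omega_add)
  qed
  from this[of "supp f"] show ?thesis
    using om_expand[OF Omega_finite[OF f] order_refl] Omega_finite[OF f] by simp
qed

lemma mulx_basis: "mulx i (basis (a, S)) = basis (a(i := a i + 1), S)"
  by (rule om_eqI) (auto simp: mulx_apply basis_def fun_eq_iff)

lemma multh_basis: "multh i (basis (a, S)) = (if i \<in> S then 0 else om_smult (sg i S) (basis (a, insert i S)))"
proof (rule om_eqI)
  fix b U
  have "U - {i} = S \<longleftrightarrow> i \<notin> S \<and> U = insert i S" if "i \<in> U" using that by auto
  then show "multh i (basis (a, S)) (b, U) = (if i \<in> S then 0 else om_smult (sg i S) (basis (a, insert i S))) (b, U)"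
    by (auto simp: multh_apply basis_def om_smult_apply fun_op_apply)
qed

text \<open>Left multiplications produce every monomial from 1: the theta part is built first, then
  the exponents are raised one by one.\<close>

lemma Omega_gen_induct [consumes 1, case_names one add smult mulx multh]:
  assumes f: "f \<in> Omega n"
    and one: "P om_one"
    and add: "\<And>f g. f \<in> Omega n \<Longrightarrow> g \<in> Omega n \<Longrightarrow> P f \<Longrightarrow> P g \<Longrightarrow> P (f + g)"
    and smult: "\<And>c f. f \<in> Omega n \<Longrightarrow> P f \<Longrightarrow> P (om_smult c f)"
    and mulx: "\<And>i f. i \<in> {1..n} \<Longrightarrow> f \<in> Omega n \<Longrightarrow> P f \<Longrightarrow> P (mulx i f)"
    and multh: "\<And>i f. i \<in> {1..n} \<Longrightarrow> f \<in> Omega n \<Longrightarrow> P f \<Longrightarrow> P (multh i f)"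
  shows "P f"
  using f
proof (induction rule: Omega_induct)
  case (basis a S c)
  then have aS: "\<forall>i. i \<notin> {1..n} \<longrightarrow> a i = 0" "S \<subseteq> {1..n}" by (auto simp: basis_Omega_iff)
  have S: "P (basis (\<lambda>_. 0, S))"
  proof -
    have "finite S" using aS(2) finite_subset by blast
    from this aS(2) show ?thesis
    proof (induction S)
      case empty
      then show ?case using one by (simp add: om_one_def)
    next
      case (insert i S)
      \<comment> \<open>The scalar undoes the sign with which \<open>multh i\<close> creates
        \<open>insert i S\<close>.\<close>
      then have "P (om_smult (sg i S) (multh i (basis (\<lambda>_. 0, S))))"
        by (intro smult multh Omega_multh) (auto simp: basis_Omega_iff)
      then show ?case using insert by (simp add: multh_basis om.scale_scale)
    qed
  qed
  have "P (basis (a, S))"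
    using aS(1)
  proof (induction "sum a {1..n}" arbitrary: a)
    case 0
    then have "a = (\<lambda>_. 0)" by (auto simp: fun_eq_iff)
    then show ?case using S by simp
  next
    case (Suc k)
    then obtain i where i: "i \<in> {1..n}" "0 < a i" by (metis nat.simps(3) sum.neutral gr0I)
    have "sum a {1..n} = Suc (sum (a(i := a i - 1)) {1..n})"
      using i by (simp add: sum.remove)
    then have "k = sum (a(i := a i - 1)) {1..n}" using Suc(2) by simp
    moreover have "\<forall>j. j \<notin> {1..n} \<longrightarrow> (a(i := a i - 1)) j = 0" using Suc.prems by auto
    ultimately have "P (mulx i (basis (a(i := a i - 1), S)))"
      using i aS(2) by (intro mulx Suc.hyps(1)) (auto simp: basis_Omega_iff)
    then show ?case using i by (simp add: mulx_basis)
  qed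
  then show ?case using basis by (intro smult)
qed (rule add)

subsection \<open>Substitution of operators\<close>

text \<open>\<open>L f g\<close> substitutes \<open>X i\<close> and \<open>T i\<close> for the
  variables in \<open>f\<close> and applies the result to \<open>g\<close>. The products
  \<open>odot\<close> and \<open>om_mult\<close> and the action \<open>act\<close> are instances;
  the relations assumed are those of the \<open>x_i\<close> and \<open>theta_i\<close>.\<close>

locale superops =
  fixes n :: nat and X T :: "nat \<Rightarrow> om \<Rightarrow> om"
  assumes linX [intro]: "lin (X i)" and linT [intro]: "lin (T i)"
    and XX: "X i (X j g) = X j (X i g)" and XT: "X i (T j g) = T j (X i g)"
    and TT: "T i (T j g) = - T j (T i g)" and T0: "T i (T i g) = 0"
begin

abbreviation L where "L \<equiv> lin_ext (monop n X T)"

lemma lin_foldr: "lin (foldr T xs)"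
  by (induction xs) (auto simp: o_def intro: lin_comp lin_id[unfolded id_def[symmetric]] simp: lin_id id_def)

lemma lin_fold: "lin (fold (\<lambda>i h. (X i ^^ a i) h) xs)"
  by (induction xs) (auto simp: o_def id_def intro: lin_comp lin_id lin_funpow)

lemma lin_monop: "lin (monop n X T m)"
  unfolding monop_def by (intro lin_comp[OF lin_fold lin_foldr])

lemma L_superset:
  assumes "finite M" "supp f \<subseteq> M"
  shows "L f g = (\<Sum>m\<in>M. om_smult (f m) (monop n X T m g))"
  unfolding lin_ext_def
  by (rule ext, simp add: sum_fun_apply om_smult_apply, rule sum.mono_neutral_left)
    (use assms in \<open>auto simp: supp_def\<close>)

lemma L_add:
  assumes "finite (supp f)" "finite (supp h)" shows "L (f + h) g = L f g + L h g"
proof -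
  have "supp (f + h) \<subseteq> supp f \<union> supp h" by (auto simp: supp_def fun_op_apply)
  then show ?thesis
    using assms
    by (simp add: L_superset[of "supp f \<union> supp h"] om.scale_left_distrib sum.distrib plus_fun_apply[of f h])
qed

lemma L_smult:
  assumes "finite (supp f)" shows "L (om_smult c f) g = om_smult c (L f g)"
proof -
  have "supp (om_smult c f) \<subseteq> supp f" by (auto simp: supp_def om_smult_apply)
  then show ?thesis
    using assms by (simp add: L_superset[of "supp f"] om.scale_sum_right om.scale_scale om_smult_apply)
qed

lemma L_0 [simp]: "L 0 g = 0"
  by (simp add: lin_ext_def supp_def zero_fun_def)

lemma L_add_Omega: "f \<in> Omega n \<Longrightarrow> h \<in> Omega n \<Longrightarrow> L (f + h) g = L f g + L h g"
  and L_smult_Omega: "f \<in> Omega n \<Longrightarrow> L (om_smult c f) g = om_smult c (L f g)"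
  by (simp_all add: L_add L_smult Omega_finite)

lemma L_minus_Omega: "f \<in> Omega n \<Longrightarrow> L (- f) g = - L f g"
  using L_smult_Omega[of f "- 1" g] by simp

lemma L_diff_Omega: "f \<in> Omega n \<Longrightarrow> h \<in> Omega n \<Longrightarrow> L (f - h) g = L f g - L h g"
  using L_add_Omega[of f "- h"] L_minus_Omega[of h] Omega_minus[of h n] by simp

lemma L_basis: "L (basis m) g = monop n X T m g"
  by (subst L_superset[of "{m}"]) (auto simp: supp_def basis_def)

lemma lin_L: "lin (L f)"
  by (rule linI; rule ext; simp add: lin_ext_def fun_op_apply lin_add[OF lin_monop] lin_smult[OF lin_monop] om_smult_apply
      distrib_left sum.distrib sum_distrib_left mult.left_commute)

lemma funpow_comm: "(\<And>g. A (B g) = B (A g)) \<Longrightarrow> A ((B ^^ k) g) = (B ^^ k) (A g)"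
  by (induction k) auto

lemma fold_comm:
  assumes "\<And>i g. A (X i g) = X i (A g)"
  shows "A (fold (\<lambda>i h. (X i ^^ a i) h) xs g) = fold (\<lambda>i h. (X i ^^ a i) h) xs (A g)"
  by (induction xs arbitrary: g) (simp_all add: funpow_comm[of A "X _", OF assms])

lemma fold_Suc:
  assumes "distinct xs" "i \<in> set xs"
  shows "fold (\<lambda>j h. (X j ^^ (a(i := a i + 1)) j) h) xs g = X i (fold (\<lambda>j h. (X j ^^ a j) h) xs g)"
  using assms
proof (induction xs arbitrary: g)
  case (Cons x xs)
  show ?case
  proof (cases "x = i")
    case True
    have "fold (\<lambda>j h. (X j ^^ (a(i := a i + 1)) j) h) xs g' = fold (\<lambda>j h. (X j ^^ a j) h) xs g'" for g'
      by (rule fold_cong) (use Cons.prems True in auto)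
    then have "fold (\<lambda>j h. (X j ^^ (a(i := a i + 1)) j) h) (x # xs) g
        = fold (\<lambda>j h. (X j ^^ a j) h) xs (X i ((X i ^^ a i) g))"
      using True by simp
    also have "\<dots> = X i (fold (\<lambda>j h. (X j ^^ a j) h) xs ((X i ^^ a i) g))"
      by (rule fold_comm[of "X i", OF XX, symmetric])
    finally show ?thesis using True by simp
  next
    case False
    then show ?thesis using Cons by simp
  qed
qed simp

lemma T_foldr_mem: "i \<in> set xs \<Longrightarrow> T i (foldr T xs g) = 0"
proof (induction xs)
  case (Cons x xs)
  then show ?case
  proof (cases "x = i")
    case False
    then have "T i (foldr T (x # xs) g) = - T x (T i (foldr T xs g))" using TT[of i x] by simp
    then show ?thesis using Cons False by (simp add: lin_0[OF linT])
  qed (simp add: T0)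
qed simp

text \<open>\<open>insort\<close> moves \<open>i\<close> past the smaller entries, and each exchange
  of two operators \<open>T\<close> costs a sign.\<close>

lemma foldr_insort:
  assumes "sorted xs" "i \<notin> set xs"
  shows "foldr T (insort i xs) g = om_smult ((- 1) ^ length (filter (\<lambda>t. t < i) xs)) (T i (foldr T xs g))"
  using assms
proof (induction xs)
  case (Cons x xs)
  show ?case
  proof (cases "i \<le> x")
    case True
    then have "filter (\<lambda>t. t < i) (x # xs) = []" using Cons.prems by (auto simp: filter_empty_conv)
    then show ?thesis using True by simp
  next
    case False
    then show ?thesis using Cons TT[of x i] by (simp add: lin_smult[OF linT] om.scale_scale)
  qed
qed simp

lemma foldr_insert:
  assumes "finite S" "i \<notin> S"
  shows "foldr T (sorted_list_of_set (insert i S)) g = om_smult (sg i S) (T i (foldr T (sorted_list_of_set S) g))"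
proof -
  have "length (filter (\<lambda>t. t < i) (sorted_list_of_set S)) = card (set (filter (\<lambda>t. t < i) (sorted_list_of_set S)))"
    by (rule distinct_card[symmetric]) simp
  also have "set (filter (\<lambda>t. t < i) (sorted_list_of_set S)) = {t \<in> S. t < i}"
    using assms(1) by auto
  finally have len: "length (filter (\<lambda>t. t < i) (sorted_list_of_set S)) = card {t \<in> S. t < i}" .
  have "sorted_list_of_set (insert i S) = insort i (sorted_list_of_set S)"
    using assms by simp
  moreover have "foldr T (insort i (sorted_list_of_set S)) g
      = om_smult ((- 1) ^ card {t \<in> S. t < i}) (T i (foldr T (sorted_list_of_set S) g))"
    unfolding len[symmetric] by (rule foldr_insort) (use assms in auto)
  ultimately show ?thesis by (simp only: sg_def)
qed

text \<open>With \<open>L_multh\<close>, \<open>L_one\<close> and linearity this determines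
  \<open>L\<close> on \<open>Omega n\<close>, so most later facts follow by
  \<open>Omega_gen_induct\<close> without unfolding \<open>monop\<close>.\<close>

lemma L_mulx: "f \<in> Omega n \<Longrightarrow> i \<in> {1..n} \<Longrightarrow> L (mulx i f) g = X i (L f g)"
proof (induction rule: Omega_induct)
  case (basis a S c)
  have "monop n X T (a(i := a i + 1), S) g = X i (monop n X T (a, S) g)"
    unfolding monop_def fst_conv snd_conv using basis by (intro fold_Suc) auto
  then show ?case
    using basis Omega_mulx[OF basis(1,2)]
    by (simp add: lin_smult[OF lin_ops(1)] L_smult_Omega L_basis mulx_basis lin_smult[OF linX])
next
  case (add f h)
  then show ?case
    by (simp add: lin_add[OF lin_ops(1)] L_add_Omega Omega_mulx lin_add[OF linX])
qed

lemma L_multh: "f \<in> Omega n \<Longrightarrow> i \<in> {1..n} \<Longrightarrow> L (multh i f) g = T i (L f g)"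
proof (induction rule: Omega_induct)
  case (basis a S c)
  have fin: "finite S" using basis(1) finite_subset by (auto simp: basis_Omega_iff)
  have T: "T i (monop n X T (a, S) g) = fold (\<lambda>i h. (X i ^^ a i) h) [1..<Suc n] (T i (foldr T (sorted_list_of_set S) g))"
    unfolding monop_def fst_conv snd_conv by (rule fold_comm) (rule XT[symmetric])
  have "L (multh i (Defs.basis (a, S))) g = T i (monop n X T (a, S) g)"
  proof (cases "i \<in> S")
    case True
    then show ?thesis unfolding T using T_foldr_mem[of i "sorted_list_of_set S"] fin lin_0[OF lin_fold]
      by (simp add: multh_basis)
  next
    case False
    have "monop n X T (a, insert i S) g = om_smult (sg i S) (T i (monop n X T (a, S) g))"
      unfolding T unfolding monop_def fst_conv snd_conv foldr_insert[OF fin False] by (rule lin_smult[OF lin_fold])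
    moreover have "finite (supp (Defs.basis (a, insert i S)))" by (simp add: supp_def basis_def)
    ultimately show ?thesis using False by (simp add: multh_basis L_smult L_basis om.scale_scale)
  qed
  then show ?case
    using basis Omega_multh[OF basis(1,2)]
    by (simp add: lin_smult[OF lin_ops(2)] L_smult_Omega L_basis lin_smult[OF linT])
next
  case (add f h)
  then show ?case
    by (simp add: lin_add[OF lin_ops(2)] L_add_Omega Omega_multh lin_add[OF linT])
qed

lemma L_one: "L om_one g = g"
proof -
  have "fold (\<lambda>i h. (X i ^^ 0) h) xs g = g" for xs g by (induction xs) auto
  then show ?thesis by (simp add: om_one_def L_basis monop_def)
qed

lemma L_Omega:
  assumes "f \<in> Omega n" "g \<in> Omega n"
    and "\<And>i h. i \<in> {1..n} \<Longrightarrow> h \<in> Omega n \<Longrightarrow> X i h \<in> Omega n"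
    and "\<And>i h. i \<in> {1..n} \<Longrightarrow> h \<in> Omega n \<Longrightarrow> T i h \<in> Omega n"
  shows "L f g \<in> Omega n"
  using assms(1)
  by (induction rule: Omega_gen_induct)
    (use assms in \<open>auto simp: L_one L_add_Omega L_smult_Omega L_mulx L_multh intro: Omega_add Omega_smult\<close>)

lemma L_comm:
  assumes f: "f \<in> Omega n" and A: "lin A"
    and AX: "\<And>i g. A (X i g) = X i (A g)" and AT: "\<And>i g. A (T i g) = T i (A g)"
  shows "A (L f g) = L f (A g)"
  using f
  by (induction rule: Omega_gen_induct)
    (simp_all add: L_one L_add_Omega L_smult_Omega L_mulx L_multh lin_add[OF A] lin_smult[OF A] AX AT)

text \<open>A graded Leibniz rule: moving \<open>B\<close> past each \<open>T s\<close> gives a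
  sign, collected in \<open>par f\<close>, and a scalar \<open>c s\<close>, collected with
  \<open>dth s f\<close>. It yields commutation rules both for \<open>odot\<close> and for
  \<open>act\<close>.\<close>

lemma L_derivation:
  assumes f: "f \<in> Omega n" and B: "lin B"
    and BX: "\<And>i g. B (X i g) = X i (B g)"
    and BT: "\<And>i g. i \<in> {1..n} \<Longrightarrow> B (T i g) + T i (B g) = om_smult (c i) g"
  shows "B (L f g) = L (par f) (B g) + (\<Sum>s=1..n. om_smult (c s) (L (dth s f) g))"
  using f
proof (induction rule: Omega_gen_induct)
  case one
  have "par om_one = om_one" by (rule om_eqI) (auto simp: par_apply om_one_def basis_def)
  moreover have "dth s om_one = 0" for s by (rule om_eqI) (auto simp: dth_apply om_one_def basis_def fun_op_apply)
  ultimately show ?case by (simp add: L_one)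
next
  case (add f h)
  then show ?case
    by (simp add: L_add_Omega lin_add[OF B] lin_add[OF lin_ops(5)] lin_add[OF lin_ops(4)] Omega_par Omega_dth
        om.scale_right_distrib sum.distrib)
next
  case (smult k f)
  then show ?case
    by (simp add: L_smult_Omega lin_smult[OF B] lin_smult[OF lin_ops(5)] lin_smult[OF lin_ops(4)] Omega_par Omega_dth
        om.scale_right_distrib om.scale_sum_right om.scale_scale mult.commute)
next
  case (mulx i f)
  then show ?case
    by (simp add: L_mulx BX Omega_par Omega_dth lin_add[OF linX] lin_sum[OF linX] lin_smult[OF linX]
        mulx_par[symmetric] mulx_dth[symmetric])
next
  case (multh i f)
  have d: "L (dth s (multh i f)) g = (if s = i then L f g else 0) - T i (L (dth s f) g)" for s
  proof -
    have "dth s (multh i f) = (if s = i then f else 0) - multh i (dth s f)"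
      using dth_multh[of s i f] by (simp add: eq_diff_eq)
    then show ?thesis
      using multh by (simp add: L_diff_Omega L_minus_Omega L_multh Omega_minus Omega_multh Omega_dth)
  qed
  have "B (T i (L f g)) = om_smult (c i) (L f g) - T i (B (L f g))"
    using BT[OF multh(1), of "L f g"] by (simp add: eq_diff_eq)
  moreover have "L (par (multh i f)) (B g) = - T i (L (par f) (B g))"
    using multh by (simp add: par_multh L_minus_Omega L_multh Omega_multh Omega_par)
  moreover have "(\<Sum>s=1..n. om_smult (c s) (L (dth s (multh i f)) g))
      = om_smult (c i) (L f g) - T i (\<Sum>s=1..n. om_smult (c s) (L (dth s f) g))"
  proof -
    have "om_smult (c s) (L (dth s (multh i f)) g)
        = (if s = i then om_smult (c i) (L f g) else 0) - T i (om_smult (c s) (L (dth s f) g))" for s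
      by (simp add: d om.scale_right_diff_distrib lin_smult[OF linT])
    then show ?thesis using multh(1) by (simp add: sum_subtractf lin_sum[OF linT])
  qed
  ultimately show ?case
    using multh by (simp add: L_multh lin_add[OF linT])
qed

end

interpretation od: superops n dx dth for n
proof unfold_locales
  show "dth i (dth j g) = - dth j (dth i g)" for i j g by (rule dth_dth)
  show "dx i (dx j g) = dx j (dx i g)" for i j g by (rule dx_dx)
qed (auto simp: dx_dth dth_dth_same)

interpretation mu: superops n mulx multh for n
proof unfold_locales
  show "multh i (multh j g) = - multh j (multh i g)" for i j g by (rule multh_multh)
  show "mulx i (mulx j g) = mulx j (mulx i g)" for i j g by (rule mulx_mulx)
qed (auto simp: mulx_multh multh_multh_same)

abbreviation pidx :: "(int \<Rightarrow> int) \<Rightarrow> nat \<Rightarrow> nat" where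
  "pidx \<pi> i \<equiv> nat \<bar>\<pi> (int i)\<bar>"

interpretation ac: superops n
  "\<lambda>i h. om_smult (sgnc (\<pi> (int i))) (mulx (pidx \<pi> i) h)"
  "\<lambda>i h. om_smult (sgnc (\<pi> (int i))) (multh (pidx \<pi> i) h)" for n \<pi>
proof unfold_locales
  fix i j :: nat and g :: om
  show "om_smult (sgnc (\<pi> (int i))) (multh (pidx \<pi> i) (om_smult (sgnc (\<pi> (int j))) (multh (pidx \<pi> j) g)))
      = - om_smult (sgnc (\<pi> (int j))) (multh (pidx \<pi> j) (om_smult (sgnc (\<pi> (int i))) (multh (pidx \<pi> i) g)))"
    by (subst multh_multh[of "pidx \<pi> i" "pidx \<pi> j" g] | simp add: lin_smult[OF lin_ops(2)] om.scale_scale mult.commute)+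
qed (simp_all add: lin_scaled lin_smult[OF lin_ops(1)] lin_smult[OF lin_ops(2)] om.scale_scale mult.commute
      mulx_mulx mulx_multh multh_multh_same)

lemma act_eq: "act n \<pi> f = lin_ext (monop n (\<lambda>i h. om_smult (sgnc (\<pi> (int i))) (mulx (pidx \<pi> i) h))
    (\<lambda>i h. om_smult (sgnc (\<pi> (int i))) (multh (pidx \<pi> i) h))) f om_one"
  by (simp add: act_def lin_ext_def)

lemmas odot_simps = od.L_one[folded odot_def] od.L_add_Omega[folded odot_def] od.L_smult_Omega[folded odot_def]
  od.L_mulx[folded odot_def] od.L_multh[folded odot_def]

lemmas om_mult_simps = mu.L_one[folded om_mult_def] mu.L_add_Omega[folded om_mult_def]
  mu.L_smult_Omega[folded om_mult_def] mu.L_mulx[folded om_mult_def] mu.L_multh[folded om_mult_def]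

lemmas act_simps = ac.L_one[where g = om_one, folded act_eq] ac.L_add_Omega[where g = om_one, folded act_eq]
  ac.L_smult_Omega[where g = om_one, folded act_eq] ac.L_mulx[where g = om_one, folded act_eq]
  ac.L_multh[where g = om_one, folded act_eq]

lemma odot_0 [simp]: "odot n 0 g = 0"
  by (simp add: odot_def)

lemma lin_odot [simp]: "lin (odot n f)"
  using od.lin_L[of n f] by (simp add: lin_def odot_def)

lemma odot_sum: "(\<And>x. x \<in> F \<Longrightarrow> f x \<in> Omega n) \<Longrightarrow> odot n (sum f F) g = (\<Sum>x\<in>F. odot n (f x) g)"
  by (induction F rule: infinite_finite_induct) (simp_all add: odot_simps Omega_sum)

lemma act_sum: "(\<And>x. x \<in> F \<Longrightarrow> f x \<in> Omega n) \<Longrightarrow> act n \<pi> (sum f F) = (\<Sum>x\<in>F. act n \<pi> (f x))"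
proof (induction F rule: infinite_finite_induct)
  case (insert x F)
  then show ?case by (simp add: act_simps Omega_sum)
qed (simp_all add: act_eq)

lemma odot_Omega: "f \<in> Omega n \<Longrightarrow> g \<in> Omega n \<Longrightarrow> odot n f g \<in> Omega n"
  unfolding odot_def by (rule od.L_Omega) (auto intro: Omega_dx Omega_dth)

lemma om_mult_Omega: "f \<in> Omega n \<Longrightarrow> g \<in> Omega n \<Longrightarrow> om_mult n f g \<in> Omega n"
  unfolding om_mult_def by (rule mu.L_Omega) (auto intro: Omega_mulx Omega_multh)

lemma odot_om_mult:
  "h \<in> Omega n \<Longrightarrow> f \<in> Omega n \<Longrightarrow> odot n (om_mult n h f) v = odot n h (odot n f v)"
  by (induction rule: Omega_gen_induct)
    (simp_all add: odot_simps om_mult_simps om_mult_Omega)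

lemma odot_dx: "f \<in> Omega n \<Longrightarrow> odot n f (dx i g) = dx i (odot n f g)"
  unfolding odot_def by (rule od.L_comm[symmetric]) (auto simp: dx_dx dx_dth)

lemma odot_dth:
  assumes "f \<in> Omega n" shows "odot n f (dth i g) = dth i (odot n (par f) g)"
  using od.L_derivation[of "par f" n "dth i" "\<lambda>_. 0" g] assms
  by (simp add: odot_def dx_dth dth_dth[of i] par_par Omega_par)

lemma odot_multh:
  assumes "f \<in> Omega n" "i \<in> {1..n}"
  shows "odot n f (multh i g) = multh i (odot n (par f) g) - odot n (dth i (par f)) g"
proof -
  have "multh i (odot n (par f) g)
      = odot n (par (par f)) (multh i g) + (\<Sum>s=1..n. om_smult (if s = i then 1 else 0) (odot n (dth s (par f)) g))"
    unfolding odot_def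
  proof (rule od.L_derivation)
    fix s g
    show "multh i (dth s g) + dth s (multh i g) = om_smult (if s = i then 1 else 0) g"
      using dth_multh[of s i g] by (simp add: add.commute)
  qed (use assms in \<open>auto simp: Omega_par dx_multh\<close>)
  also have "(\<Sum>s=1..n. om_smult (if s = i then 1 else 0) (odot n (dth s (par f)) g)) = odot n (dth i (par f)) g"
    using assms(2) by (subst sum.remove[of _ i]) simp_all
  finally show ?thesis using assms(1) by (simp add: par_par)
qed

subsection \<open>Invariants and the superharmonic space\<close>

lemma signed_perm_pidx:
  assumes "signed_perm n \<pi>"
  shows "i \<in> {1..n} \<Longrightarrow> pidx \<pi> i \<in> {1..n}" "i \<in> {1..n} \<Longrightarrow> sgnc (\<pi> (int i)) * sgnc (\<pi> (int i)) = 1"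
    "i \<notin> {1..n} \<Longrightarrow> pidx \<pi> i = i" "bij (pidx \<pi>)" "bij_betw (pidx \<pi>) {1..n} {1..n}"
proof -
  have perm: "\<pi> permutes ({- int n .. int n} - {0})" and neg: "\<And>i. \<pi> (- i) = - \<pi> i"
    using assms by (auto simp: signed_perm_def)
  have *: "\<pi> (int i) \<in> {- int n .. int n} - {0}" if "i \<in> {1..n}" for i
    using that permutes_in_image[OF perm, of "int i"] by auto
  show 1: "i \<in> {1..n} \<Longrightarrow> pidx \<pi> i \<in> {1..n}" for i using *[of i] by auto
  show "i \<in> {1..n} \<Longrightarrow> sgnc (\<pi> (int i)) * sgnc (\<pi> (int i)) = 1"
    using *[of i] by (auto simp: sgnc_def sgn_if)
  show 2: "i \<notin> {1..n} \<Longrightarrow> pidx \<pi> i = i" for i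
    using permutes_not_in[OF perm, of "int i"] by auto
  have inj: "inj (pidx \<pi>)"
  proof (rule injI)
    fix i j assume "pidx \<pi> i = pidx \<pi> j"
    then have "\<bar>\<pi> (int i)\<bar> = \<bar>\<pi> (int j)\<bar>" by (simp add: eq_nat_nat_iff)
    then have "\<pi> (int i) = \<pi> (int j) \<or> \<pi> (int i) = \<pi> (- int j)" unfolding neg by linarith
    then have "int i = int j \<or> int i = - int j" using injD[OF permutes_inj[OF perm]] by blast
    then show "i = j" by linarith
  qed
  have im: "pidx \<pi> ` {1..n} = {1..n}"
    by (rule endo_inj_surj) (use 1 inj_on_subset[OF inj subset_UNIV] in auto)
  show "bij_betw (pidx \<pi>) {1..n} {1..n}"
    unfolding bij_betw_def using im inj_on_subset[OF inj subset_UNIV] by blast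
  have "surj (pidx \<pi>)"
  proof (rule surj_def[THEN iffD2, rule_format])
    fix k show "\<exists>i. k = pidx \<pi> i"
    proof (cases "k \<in> {1..n}")
      case True
      then have "k \<in> pidx \<pi> ` {1..n}" using im by blast
      then show ?thesis by blast
    next
      case False
      then show ?thesis using 2[OF False, symmetric] by blast
    qed
  qed
  then show "bij (pidx \<pi>)" using inj by (simp add: bij_def)
qed

lemma act_par: "f \<in> Omega n \<Longrightarrow> signed_perm n \<pi> \<Longrightarrow> act n \<pi> (par f) = par (act n \<pi> f)"
proof (induction rule: Omega_gen_induct)
  case one
  have "par om_one = om_one" by (rule om_eqI) (auto simp: par_apply om_one_def basis_def)
  then show ?case by (simp add: act_simps)
next
  case (multh i f)
  have "act n \<pi> (par (multh i f)) = - act n \<pi> (multh i (par f))"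
    using multh act_simps(3)[of "multh i (par f)" n \<pi> "- 1"] by (simp add: par_multh Omega_multh Omega_par)
  then show ?case
    using multh by (simp add: act_simps Omega_par lin_smult[OF lin_ops(5)] par_multh)
qed (simp_all add: act_simps lin_add[OF lin_ops(5)] lin_smult[OF lin_ops(5)] Omega_par mulx_par[symmetric])

lemma act_dth:
  assumes "f \<in> Omega n" "signed_perm n \<pi>" "i \<in> {1..n}"
  shows "act n \<pi> (dth i f) = om_smult (sgnc (\<pi> (int i))) (dth (pidx \<pi> i) (act n \<pi> f))"
proof -
  let ?k = "pidx \<pi> i"
  let ?c = "\<lambda>s. if s = i then sgnc (\<pi> (int i)) else 0"
  have d0: "dth ?k om_one = 0" by (rule om_eqI) (auto simp: dth_apply om_one_def basis_def fun_op_apply)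
  have inj: "pidx \<pi> s = ?k \<longleftrightarrow> s = i" for s
    using signed_perm_pidx(4)[OF assms(2)] by (meson bij_is_inj inj_eq)
  have "dth ?k (act n \<pi> f) = ac.L n \<pi> (par f) (dth ?k om_one) + (\<Sum>s=1..n. om_smult (?c s) (act n \<pi> (dth s f)))"
    unfolding act_eq
  proof (rule ac.L_derivation)
    fix s g
    let ?s = "sgnc (\<pi> (int s))"
    have "dth ?k (om_smult ?s (multh (pidx \<pi> s) g)) + om_smult ?s (multh (pidx \<pi> s) (dth ?k g))
        = om_smult ?s (dth ?k (multh (pidx \<pi> s) g) + multh (pidx \<pi> s) (dth ?k g))"
      by (simp add: lin_smult[OF lin_ops(4)] om.scale_right_distrib)
    also have "\<dots> = om_smult (?c s) g"
      unfolding dth_multh using inj[of s] by auto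
    finally show "dth ?k (om_smult ?s (multh (pidx \<pi> s) g)) + om_smult ?s (multh (pidx \<pi> s) (dth ?k g))
        = om_smult (?c s) g" .
  qed (use assms in \<open>auto simp: lin_smult[OF lin_ops(4)] mulx_dth\<close>)
  also have "ac.L n \<pi> (par f) (dth ?k om_one) = 0" unfolding d0 by (rule lin_0[OF ac.lin_L])
  also have "(\<Sum>s=1..n. om_smult (?c s) (act n \<pi> (dth s f))) = om_smult (sgnc (\<pi> (int i))) (act n \<pi> (dth i f))"
    using assms(3) by (subst sum.remove[of _ i]) simp_all
  finally show ?thesis
    using signed_perm_pidx(2)[OF assms(2,3)] by (simp add: om.scale_scale)
qed

section \<open>Invariant vector fields and the elements killed by invariants\<close>

definition contr :: "nat \<Rightarrow> nat \<Rightarrow> om \<Rightarrow> om" where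
  "contr n j f = (\<Sum>i=1..n. (mulx i ^^ j) (dth i f))"

lemma Omega_mulx_pow: "f \<in> Omega n \<Longrightarrow> i \<in> {1..n} \<Longrightarrow> (mulx i ^^ j) f \<in> Omega n"
  by (rule Omega_funpow) (auto intro: Omega_mulx)

lemma act_mulx_pow:
  "g \<in> Omega n \<Longrightarrow> i \<in> {1..n} \<Longrightarrow>
    act n \<pi> ((mulx i ^^ k) g) = om_smult (sgnc (\<pi> (int i)) ^ k) ((mulx (pidx \<pi> i) ^^ k) (act n \<pi> g))"
  by (induction k) (simp_all add: act_simps Omega_mulx_pow lin_smult[OF lin_ops(1)] om.scale_scale)

text \<open>A signed permutation permutes the summands, and the sign of index \<open>i\<close>
  enters with the even exponent \<open>j + 1\<close>. Oddness also gives \<open>0 < j\<close>, which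
  kills the constant term.\<close>

lemma invariants0_contr:
  assumes f: "f \<in> invariants0 n" and j: "odd j" shows "contr n j f \<in> invariants0 n"
proof -
  have fO: "f \<in> Omega n" and inv: "\<And>\<pi>. signed_perm n \<pi> \<Longrightarrow> act n \<pi> f = f"
    using f by (auto simp: invariants0_def)
  have O: "(mulx i ^^ j) (dth i f) \<in> Omega n" if "i \<in> {1..n}" for i
    using that fO by (intro Omega_mulx_pow Omega_dth)
  have "act n \<pi> (contr n j f) = contr n j f" if \<pi>: "signed_perm n \<pi>" for \<pi>
  proof -
    have *: "act n \<pi> ((mulx i ^^ j) (dth i f)) = (mulx (pidx \<pi> i) ^^ j) (dth (pidx \<pi> i) f)" if i: "i \<in> {1..n}" for i
    proof -
      let ?s = "sgnc (\<pi> (int i))"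
      have "act n \<pi> ((mulx i ^^ j) (dth i f)) = om_smult (?s ^ j * ?s) ((mulx (pidx \<pi> i) ^^ j) (dth (pidx \<pi> i) f))"
        using fO i by (simp add: act_mulx_pow Omega_dth act_dth[OF fO \<pi> i] inv[OF \<pi>] lin_smult[OF lin_funpow[OF lin_ops(1)]] om.scale_scale)
      also have "?s ^ j * ?s = 1"
      proof -
        obtain k where "Suc j = 2 * k" using j by (metis even_Suc evenE)
        then have "?s ^ j * ?s = (?s * ?s) ^ k" by (metis power_Suc2 power_mult power2_eq_square)
        then show ?thesis using signed_perm_pidx(2)[OF \<pi> i] by simp
      qed
      finally show ?thesis by simp
    qed
    have "act n \<pi> (contr n j f) = (\<Sum>i=1..n. (mulx (pidx \<pi> i) ^^ j) (dth (pidx \<pi> i) f))"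
      unfolding contr_def by (subst act_sum) (use O * in auto)
    also have "\<dots> = contr n j f"
      unfolding contr_def by (rule sum.reindex_bij_betw[OF signed_perm_pidx(5)[OF \<pi>]])
    finally show ?thesis .
  qed
  moreover have "contr n j f (\<lambda>_. 0, {}) = 0"
  proof -
    obtain k where "j = Suc k" using j by (metis even_zero not0_implies_Suc)
    then show ?thesis by (simp add: contr_def sum_fun_apply mulx_apply)
  qed
  ultimately show ?thesis
    unfolding invariants0_def using O by (auto simp: contr_def intro: Omega_sum)
qed

lemma invariants0_par: "f \<in> invariants0 n \<Longrightarrow> par f \<in> invariants0 n"
  by (auto simp: invariants0_def Omega_par act_par par_apply)

text \<open>Only the generators of \<open>SI n\<close> are tested here. Stability under
  \<open>dx\<close> and \<open>dth\<close> extends the vanishing to the whole ideal.\<close>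

definition invharm :: "nat \<Rightarrow> om set" where
  "invharm n = {v \<in> Omega n. \<forall>f \<in> invariants0 n. odot n f v = 0}"

lemma invharmD: "v \<in> invharm n \<Longrightarrow> v \<in> Omega n" "v \<in> invharm n \<Longrightarrow> f \<in> invariants0 n \<Longrightarrow> odot n f v = 0"
  by (auto simp: invharm_def)

lemma invariants0_Omega: "f \<in> invariants0 n \<Longrightarrow> f \<in> Omega n"
  by (auto simp: invariants0_def)

lemma invharm_add: "v \<in> invharm n \<Longrightarrow> w \<in> invharm n \<Longrightarrow> v + w \<in> invharm n"
  by (auto simp: invharm_def Omega_add lin_add[OF lin_odot])

lemma invharm_smult: "v \<in> invharm n \<Longrightarrow> om_smult c v \<in> invharm n"
  by (auto simp: invharm_def Omega_smult lin_smult[OF lin_odot])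

lemma invharm_0: "0 \<in> invharm n"
  by (auto simp: invharm_def lin_0[OF lin_odot])

lemma invharm_sum: "(\<And>x. x \<in> F \<Longrightarrow> f x \<in> invharm n) \<Longrightarrow> sum f F \<in> invharm n"
  by (induction F rule: infinite_finite_induct) (auto simp: invharm_0 invharm_add)

lemma invharm_dx: "v \<in> invharm n \<Longrightarrow> dx i v \<in> invharm n"
  by (auto simp: invharm_def Omega_dx odot_dx invariants0_Omega lin_0[OF lin_ops(3)])

lemma invharm_dth: "v \<in> invharm n \<Longrightarrow> dth i v \<in> invharm n"
  by (auto simp: invharm_def Omega_dth odot_dth invariants0_Omega invariants0_par lin_0[OF lin_ops(4)])

lemma invharm_odot: "h \<in> Omega n \<Longrightarrow> v \<in> invharm n \<Longrightarrow> odot n h v \<in> invharm n"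
  by (induction rule: Omega_gen_induct)
    (simp_all add: odot_simps invharm_add invharm_smult invharm_dx invharm_dth)

text \<open>A left multiple acts as \<open>odot n h\<close> on zero; a right multiple acts as
  \<open>odot n a\<close> on \<open>odot n h v\<close>, which stays in
  \<open>invharm n\<close>.\<close>

lemma SI_annihilates_invharm: "f \<in> SI n \<Longrightarrow> f \<in> Omega n \<and> (\<forall>v\<in>invharm n. odot n f v = 0)"
  unfolding SI_def
proof (induction rule: gen_ideal.induct)
  case (gen g)
  then show ?case by (auto simp: invariants0_Omega invharmD)
qed (simp_all add: om_zero_eq om_add_eq Omega_add odot_simps om_mult_Omega odot_om_mult invharm_odot lin_0[OF lin_odot])

lemma invharm_subset_SH: "invharm n \<subseteq> SH n"
  using SI_annihilates_invharm by (auto simp: SH_def invharmD om_zero_eq)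

text \<open>The operator \<open>d_j\<close> with \<open>theta_i\<close> multiplied from the left,
  which keeps the parity out of the adjoint; \<open>dj_eq\<close> relates it to
  \<open>dj\<close>.\<close>

definition dpr :: "nat \<Rightarrow> nat \<Rightarrow> om \<Rightarrow> om" where
  "dpr n j v = (\<Sum>i=1..n. multh i ((dx i ^^ j) v))"

lemma Omega_dx_pow: "f \<in> Omega n \<Longrightarrow> (dx i ^^ j) f \<in> Omega n"
  by (rule Omega_funpow) (auto intro: Omega_dx)

lemma Omega_dpr: "v \<in> Omega n \<Longrightarrow> dpr n j v \<in> Omega n"
  unfolding dpr_def by (intro Omega_sum Omega_multh Omega_dx_pow)

lemma odot_dx_pow: "f \<in> Omega n \<Longrightarrow> odot n f ((dx i ^^ j) g) = (dx i ^^ j) (odot n f g)"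
  by (induction j) (simp_all add: odot_dx)

lemma odot_mulx_pow: "f \<in> Omega n \<Longrightarrow> i \<in> {1..n} \<Longrightarrow> odot n ((mulx i ^^ j) f) g = (dx i ^^ j) (odot n f g)"
  by (induction j) (simp_all add: odot_simps Omega_mulx_pow)

text \<open>Moving an invariant \<open>f\<close> past \<open>multh i\<close> leaves a term in
  \<open>par f\<close>, which vanishes, and a contraction; over all \<open>i\<close> the
  contractions add up to the invariant \<open>contr n j (par f)\<close>.\<close>

lemma invharm_dpr:
  assumes v: "v \<in> invharm n" and j: "odd j" shows "dpr n j v \<in> invharm n"
proof -
  have "odot n f (dpr n j v) = 0" if f: "f \<in> invariants0 n" for f
  proof -
    have pO: "par f \<in> Omega n" using f by (simp add: invariants0_Omega Omega_par)
    have "odot n f (multh i ((dx i ^^ j) v)) = - odot n ((mulx i ^^ j) (dth i (par f))) v" if i: "i \<in> {1..n}" for i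
    proof -
      have "odot n (par f) v = 0" using v f by (simp add: invharmD invariants0_par)
      then show ?thesis
        using odot_multh[OF invariants0_Omega[OF f] i, of "(dx i ^^ j) v"] pO i
        by (simp add: odot_dx_pow odot_mulx_pow Omega_dth lin_0[OF lin_funpow[OF lin_ops(3)]] lin_0[OF lin_ops(2)])
    qed
    then have "odot n f (dpr n j v) = - (\<Sum>i=1..n. odot n ((mulx i ^^ j) (dth i (par f))) v)"
      unfolding dpr_def by (simp add: lin_sum[OF lin_odot] sum_negf)
    also have "(\<Sum>i=1..n. odot n ((mulx i ^^ j) (dth i (par f))) v) = odot n (contr n j (par f)) v"
      unfolding contr_def using pO by (subst odot_sum) (auto intro: Omega_mulx_pow Omega_dth)
    also have "\<dots> = 0" using v f j by (simp add: invharmD invariants0_contr invariants0_par)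
    finally show ?thesis by simp
  qed
  then show ?thesis using v by (simp add: invharm_def Omega_dpr)
qed

lemma om_mult_thv: "f \<in> Omega n \<Longrightarrow> i \<in> {1..n} \<Longrightarrow> om_mult n f (thv i) = multh i (par f)"
proof (induction rule: Omega_gen_induct)
  case one
  have "par om_one = om_one" by (rule om_eqI) (auto simp: par_apply om_one_def basis_def)
  moreover have "multh i om_one = thv i"
    by (simp add: om_one_def thv_def multh_basis sg_def)
  ultimately show ?case by (simp add: om_mult_simps)
next
  case (multh s f)
  then show ?case by (simp add: om_mult_simps par_multh lin_minus[OF lin_ops(2)] multh_multh[of i s])
qed (simp_all add: om_mult_simps lin_add[OF lin_ops(2)] lin_add[OF lin_ops(5)] lin_smult[OF lin_ops(2)]
    lin_smult[OF lin_ops(5)] mulx_par[symmetric] mulx_multh[symmetric])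

lemma lin_dpr: "lin (dpr n j)"
  unfolding dpr_def
  by (rule linI) (simp_all add: lin_add[OF lin_funpow[OF lin_ops(3)]] lin_smult[OF lin_funpow[OF lin_ops(3)]]
      lin_add[OF lin_ops(2)] lin_smult[OF lin_ops(2)] sum.distrib om.scale_sum_right)

lemma par_dx_pow: "par ((dx i ^^ j) f) = (dx i ^^ j) (par f)"
  by (induction j) (simp_all add: dx_par[symmetric])

lemma par_dpr: "par (dpr n j f) = - dpr n j (par f)"
  by (simp add: dpr_def lin_sum[OF lin_ops(5)] par_multh par_dx_pow sum_negf)

lemma dj_eq: "f \<in> Omega n \<Longrightarrow> dj n j f = dpr n j (par f)"
proof -
  assume f: "f \<in> Omega n"
  have fold: "foldr om_add (map g xs) om_zero = sum_list (map g xs)" for g and xs :: "nat list"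
    by (induction xs) (simp_all add: om_add_eq om_zero_eq)
  have "dj n j f = (\<Sum>i\<in>{1..<Suc n}. om_mult n ((dx i ^^ j) f) (thv i))"
    unfolding dj_def fold by (simp add: sum_list_distinct_conv_sum_set del: upt_Suc)
  also have "\<dots> = dpr n j (par f)"
    unfolding dpr_def
    by (rule sum.cong) (use f in \<open>auto simp: om_mult_thv Omega_dx_pow par_dx_pow\<close>)
  finally show ?thesis .
qed

text \<open>The right multiplications by \<open>\<theta>\<^sub>i\<close> in \<open>dj\<close> differ from the left multiplications
  in \<open>dpr\<close> only by a global sign.\<close>
lemma dI_eq:
  assumes v: "v \<in> Omega n" "par v = v"
  shows "\<exists>c. c \<noteq> 0 \<and> dI n I v = om_smult c (foldr (\<lambda>i. dpr n (2 * i - 1)) (sorted_list_of_set I) v)"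
proof -
  \<comment> \<open>For the induction the result must also stay in \<open>Omega n\<close> and be an
    eigenvector of \<open>par\<close>.\<close>
  have "\<exists>c. c \<noteq> 0 \<and> foldr (\<lambda>i h. dj n (2 * i - 1) h) xs v = om_smult c (foldr (\<lambda>i. dpr n (2 * i - 1)) xs v)
      \<and> foldr (\<lambda>i. dpr n (2 * i - 1)) xs v \<in> Omega n
      \<and> (\<exists>d. d \<noteq> 0 \<and> par (foldr (\<lambda>i. dpr n (2 * i - 1)) xs v) = om_smult d (foldr (\<lambda>i. dpr n (2 * i - 1)) xs v))" for xs
  proof (induction xs)
    case Nil
    then show ?case using v by (auto intro!: exI[of _ 1])
  next
    case (Cons i xs)
    let ?w = "foldr (\<lambda>i. dpr n (2 * i - 1)) xs v"
    obtain c d where c: "c \<noteq> 0" "foldr (\<lambda>i h. dj n (2 * i - 1) h) xs v = om_smult c ?w"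
      and w: "?w \<in> Omega n" and d: "d \<noteq> 0" "par ?w = om_smult d ?w" using Cons by blast
    have "foldr (\<lambda>i h. dj n (2 * i - 1) h) (i # xs) v = om_smult (c * d) (dpr n (2 * i - 1) ?w)"
      using w by (simp add: c d dj_eq Omega_smult lin_smult[OF lin_ops(5)] lin_smult[OF lin_dpr] om.scale_scale del: One_nat_def)
    moreover have "par (dpr n (2 * i - 1) ?w) = om_smult (- d) (dpr n (2 * i - 1) ?w)"
      by (simp add: par_dpr d lin_smult[OF lin_dpr] del: One_nat_def)
    ultimately show ?case
      using c(1) d(1) w by (simp only: foldr_Cons o_apply)
        (intro exI[of _ "c * d"] conjI exI[of _ "- d"], simp_all add: Omega_dpr del: One_nat_def)
  qed
  then show ?thesis unfolding dI_def by blast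
qed

subsection \<open>The polynomial \<open>\<delta>\<^sup>B\<^sub>n\<close>\<close>

definition emb :: "mpol \<Rightarrow> om" where
  "emb p = (\<lambda>(a, S). if S = {} then lookup p a else 0)"

lemma emb_apply: "emb p (a, S) = (if S = {} then lookup p a else 0)"
  by (simp add: emb_def)

text \<open>The factors of delta grouped by the smaller index, the form in which the chain of colon
  ideals produces it; see \<open>deltaB_emb\<close>.\<close>

definition vdm :: "nat \<Rightarrow> mpol" where
  "vdm n = prod (phi n) {1..n}"

lemma emb_one: "emb 1 = om_one"
  by (rule om_eqI) (auto simp: emb_apply om_one_def basis_def lookup_one when_def zero_fun_def)

lemma emb_X_mult: "emb (X i * p) = mulx i (emb p)"
  by (rule om_eqI) (simp add: emb_apply mulx_apply lookup_X_mult)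

lemma emb_diff: "emb (p - q) = emb p - emb q"
  by (rule om_eqI) (simp add: emb_apply lookup_minus fun_op_apply)

lemma om_mult_assoc:
  "h \<in> Omega n \<Longrightarrow> f \<in> Omega n \<Longrightarrow> om_mult n (om_mult n h f) v = om_mult n h (om_mult n f v)"
  by (induction rule: Omega_gen_induct) (simp_all add: om_mult_simps om_mult_Omega)

text \<open>Holds for the variables in range and passes to products and differences, which covers
  all factors of delta.\<close>

definition emb_ok :: "nat \<Rightarrow> mpol \<Rightarrow> bool" where
  "emb_ok n p \<longleftrightarrow> emb p \<in> Omega n \<and> (\<forall>q. om_mult n (emb p) (emb q) = emb (p * q))"

lemma emb_ok_one: "emb_ok n 1"
  by (simp add: emb_ok_def emb_one om_mult_simps)

lemma emb_ok_mult: "emb_ok n p \<Longrightarrow> emb_ok n q \<Longrightarrow> emb_ok n (p * q)"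
  unfolding emb_ok_def by (metis om_mult_Omega om_mult_assoc mult.assoc)

lemma emb_ok_diff: "emb_ok n p \<Longrightarrow> emb_ok n q \<Longrightarrow> emb_ok n (p - q)"
  using Omega_add[OF _ Omega_minus, of "emb p" n "emb q"]
  by (simp add: emb_ok_def emb_diff left_diff_distrib mu.L_diff_Omega[folded om_mult_def])

lemma emb_X: "emb (X i) = mulx i om_one"
  using emb_X_mult[of i 1] by (simp add: emb_one)

lemma emb_ok_X: "i \<in> {1..n} \<Longrightarrow> emb_ok n (X i)"
  by (simp add: emb_ok_def emb_X om_mult_simps emb_X_mult Omega_mulx)

lemma xv_eq: "xv i = emb (X i)"
  by (simp add: emb_X xv_def om_one_def mulx_basis)

lemma foldr_om_mult_emb:
  "(\<And>p. p \<in> set ps \<Longrightarrow> emb_ok n p) \<Longrightarrow>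
    foldr (om_mult n) (map emb ps) om_one = emb (prod_list ps) \<and> emb_ok n (prod_list ps)"
proof (induction ps)
  case (Cons p ps)
  then have ok: "emb_ok n p" "emb_ok n (prod_list ps)"
    and eq: "foldr (om_mult n) (map emb ps) om_one = emb (prod_list ps)" by auto
  have "om_mult n (emb p) (emb (prod_list ps)) = emb (p * prod_list ps)" using ok(1) by (simp add: emb_ok_def)
  then show ?case using emb_ok_mult[OF ok] by (simp add: eq)
qed (simp add: emb_one emb_ok_one)

lemma vdm_factor: "vdm n = (\<Prod>i=1..n. X i) * (\<Prod>i=1..n. \<Prod>j\<in>{i<..n}. (X i)\<^sup>2 - (X j)\<^sup>2)"
  by (simp add: vdm_def phi_def prod.distrib)

lemma prod_list_concat_map: "prod_list (concat (map f xs)) = prod_list (map (\<lambda>x. prod_list (f x)) xs)"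
  for f :: "'b \<Rightarrow> 'a::comm_monoid_mult list"
  by (induction xs) auto

lemma deltaB_emb: "deltaB n = emb (vdm n)" "deltaB n \<in> Omega n"
proof -
  define ps where "ps = map X [1..<Suc n]"
  define qs where "qs = concat (map (\<lambda>i. map (\<lambda>j. X i * X i - X j * X j) [Suc i..<Suc n]) [1..<Suc n])"
  have ok: "emb_ok n (X i * X i - X j * X j)" if "i \<in> {1..n}" "j \<in> {1..n}" for i j
    using that by (intro emb_ok_diff emb_ok_mult emb_ok_X)
  have 1: "map xv [1..<Suc n] = map emb ps"
    by (simp add: ps_def xv_eq del: upt_Suc)
  have "om_diff (om_mult n (xv i) (xv i)) (om_mult n (xv j) (xv j)) = emb (X i * X i - X j * X j)"
    if "i \<in> {1..n}" "j \<in> {1..n}" for i j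
    using that emb_ok_X unfolding om_diff_eq xv_eq emb_diff by (simp add: emb_ok_def)
  then have 2: "concat (map (\<lambda>i. map (\<lambda>j. om_diff (om_mult n (xv i) (xv i)) (om_mult n (xv j) (xv j))) [Suc i..<Suc n]) [1..<Suc n]) = map emb qs"
    unfolding qs_def map_concat map_map o_def
    by (intro arg_cong[of _ _ concat] map_cong refl) auto
  have p: "foldr (om_mult n) (map emb ps) om_one = emb (prod_list ps)" "emb_ok n (prod_list ps)"
  proof -
    have "\<And>p. p \<in> set ps \<Longrightarrow> emb_ok n p" by (auto simp: ps_def intro!: emb_ok_X)
    then show "foldr (om_mult n) (map emb ps) om_one = emb (prod_list ps)" "emb_ok n (prod_list ps)"
      using foldr_om_mult_emb by blast+
  qed
  have q: "foldr (om_mult n) (map emb qs) om_one = emb (prod_list qs)" "emb_ok n (prod_list qs)"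
  proof -
    have "\<And>p. p \<in> set qs \<Longrightarrow> emb_ok n p" by (auto simp: qs_def intro!: ok)
    then show "foldr (om_mult n) (map emb qs) om_one = emb (prod_list qs)" "emb_ok n (prod_list qs)"
      using foldr_om_mult_emb by blast+
  qed
  have "deltaB n = om_mult n (emb (prod_list ps)) (emb (prod_list qs))"
    unfolding deltaB_def 1 2 p q ..
  also have "\<dots> = emb (prod_list ps * prod_list qs)" using p by (simp add: emb_ok_def)
  also have "prod_list ps = (\<Prod>i=1..n. X i)"
    unfolding ps_def by (subst prod.distinct_set_conv_list[symmetric]) (auto intro: prod.cong)
  also have "prod_list qs = (\<Prod>i=1..n. \<Prod>j\<in>{i<..n}. (X i)\<^sup>2 - (X j)\<^sup>2)"
  proof -
    have "prod_list (map (\<lambda>j. X i * X i - X j * X j) [Suc i..<Suc n]) = (\<Prod>j\<in>{i<..n}. (X i)\<^sup>2 - (X j)\<^sup>2)" for i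
    proof -
      have "{i<..n} = set [Suc i..<Suc n]" by auto
      then show ?thesis by (simp add: prod.distinct_set_conv_list power2_eq_square del: upt_Suc set_upt)
    qed
    then have "prod_list qs = prod_list (map (\<lambda>i. \<Prod>j\<in>{i<..n}. (X i)\<^sup>2 - (X j)\<^sup>2) [1..<Suc n])"
      unfolding qs_def prod_list_concat_map by simp
    also have "\<dots> = (\<Prod>i\<in>set [1..<Suc n]. \<Prod>j\<in>{i<..n}. (X i)\<^sup>2 - (X j)\<^sup>2)"
      by (rule prod.distinct_set_conv_list[symmetric]) simp
    also have "set [1..<Suc n] = {1..n}" by auto
    finally show ?thesis .
  qed
  finally show "deltaB n = emb (vdm n)" unfolding vdm_factor .
  have "deltaB n = om_mult n (emb (prod_list ps)) (emb (prod_list qs))"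
    unfolding deltaB_def 1 2 p q ..
  moreover have "emb (prod_list ps) \<in> Omega n" "emb (prod_list qs) \<in> Omega n"
    using p(2) q(2) by (simp_all only: emb_ok_def)
  ultimately show "deltaB n \<in> Omega n" by (simp only: om_mult_Omega)
qed

text \<open>For additive \<open>f\<close> and multiplicative \<open>\<chi>\<close> this is the
  algebra endomorphism taking \<open>x^a\<close> to \<open>\<chi> a\<close> times
  \<open>x^(f a)\<close>. It is used for the sign change of one variable and for the exchange of
  two.\<close>

definition twist :: "((nat \<Rightarrow> nat) \<Rightarrow> (nat \<Rightarrow> nat)) \<Rightarrow> ((nat \<Rightarrow> nat) \<Rightarrow> complex) \<Rightarrow> mpol \<Rightarrow> mpol" where
  "twist f \<chi> p = (\<Sum>a\<in>keys p. single (f a) (\<chi> a * lookup p a))"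

lemma twist_superset:
  assumes "finite M" "keys p \<subseteq> M"
  shows "twist f \<chi> p = (\<Sum>a\<in>M. single (f a) (\<chi> a * lookup p a))"
  unfolding twist_def by (rule sum.mono_neutral_left) (use assms in \<open>auto simp: in_keys_iff\<close>)

lemma twist_add: "twist f \<chi> (p + q) = twist f \<chi> p + twist f \<chi> q"
  using keys_add[of p q]
  by (simp add: twist_superset[of "keys p \<union> keys q"] lookup_add distrib_left single_add sum.distrib)

lemma twist_single: "twist f \<chi> (single a c) = single (f a) (\<chi> a * c)"
  by (subst twist_superset[of "{a}"]) auto

lemma twist_diff: "twist f \<chi> (p - q) = twist f \<chi> p - twist f \<chi> q"
  using twist_add[of f \<chi> "p - q" q] by simp

lemma twist_mult:
  assumes f: "\<And>a b. f (a + b) = f a + f b" and \<chi>: "\<And>a b. \<chi> (a + b) = \<chi> a * \<chi> b"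
  shows "twist f \<chi> (p * q) = twist f \<chi> p * twist f \<chi> q"
proof (induction p rule: mpol_induct)
  case (single a c)
  show ?case
    by (induction q rule: mpol_induct)
      (simp_all only: twist_single mult_single f \<chi> distrib_left distrib_right twist_add mult_ac)
qed (simp only: distrib_right twist_add)

lemma twist_prod:
  assumes f: "\<And>a b. f (a + b) = f a + f b" "f 0 = 0" and \<chi>: "\<And>a b. \<chi> (a + b) = \<chi> a * \<chi> b" "\<chi> 0 = 1"
  shows "twist f \<chi> (\<Prod>i\<in>F. g i) = (\<Prod>i\<in>F. twist f \<chi> (g i))"
proof (induction F rule: infinite_finite_induct)
  case (insert x F)
  then show ?case by (simp add: twist_mult[of f \<chi>, OF f(1) \<chi>(1)])
qed (use twist_single[of f \<chi> 0 1] f(2) \<chi>(2) in simp_all)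

text \<open>Changing the sign of \<open>x_i\<close> negates delta.\<close>

lemma vdm_odd:
  assumes "lookup (vdm n) a \<noteq> 0" "i \<in> {1..n}" shows "odd (a i)"
proof -
  define \<chi> where "\<chi> = (\<lambda>a::nat\<Rightarrow>nat. (- 1 :: complex) ^ a i)"
  have \<chi>: "\<chi> (a + b) = \<chi> a * \<chi> b" "\<chi> 0 = 1" for a b by (simp_all add: \<chi>_def power_add fun_op_apply)
  let ?t = "twist (\<lambda>a. a) \<chi>"
  note tm = twist_mult[of "\<lambda>a. a" \<chi>, OF refl \<chi>(1)]
  note tp = twist_prod[of "\<lambda>a. a" \<chi>, OF refl refl \<chi>(1) \<chi>(2)]
  have tX: "?t (X k) = (if k = i then - X k else X k)" for k
    by (simp add: X_def twist_single \<chi>_def single_uminus)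
  then have tX2: "?t ((X k)\<^sup>2) = (X k)\<^sup>2" for k
    by (simp add: power2_eq_square tm)
  have "(\<Prod>k=1..n. if k = i then - X k else X k) = - (\<Prod>k=1..n. X k)"
    using assms(2) by (simp add: prod.remove)
  then have "?t (vdm n) = - vdm n"
    unfolding vdm_factor tm tp twist_diff tX2 tX by simp
  moreover have "lookup (?t (vdm n)) a = \<chi> a * lookup (vdm n) a"
    by (simp add: twist_def lookup_sum lookup_single when_def in_keys_iff)
  ultimately have "\<chi> a * lookup (vdm n) a = - lookup (vdm n) a" by simp
  then have "\<chi> a = - 1" using assms(1) by (metis mult_cancel_right mult_minus1)
  then show ?thesis by (cases "even (a i)") (simp_all add: \<chi>_def)
qed

text \<open>An adjacent transposition maps pairs \<open>i < j\<close> to such pairs, except for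
  \<open>(k, Suc k)\<close>, whose factor changes sign.\<close>

lemma vdm_adjacent:
  assumes "1 \<le> k" "Suc k \<le> n"
  shows "lookup (vdm n) (a \<circ> transpose k (Suc k)) = - lookup (vdm n) a"
proof -
  let ?\<tau> = "transpose k (Suc k)"
  let ?f = "\<lambda>a::nat\<Rightarrow>nat. a \<circ> ?\<tau>" and ?\<chi> = "\<lambda>a::nat\<Rightarrow>nat. 1::complex"
  let ?t = "twist ?f ?\<chi>"
  have f: "?f (a + b) = ?f a + ?f b" "?f 0 = 0" for a b by (auto simp: fun_eq_iff fun_op_apply)
  have one: "1 = 1 * (1 :: complex)" by simp
  note tm = twist_mult[of ?f ?\<chi>, OF f(1) one]
  note tp = twist_prod[of ?f ?\<chi>, OF f(1) f(2) one refl]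
  have tX: "?t (X i) = X (?\<tau> i)" for i
  proof -
    have "((\<lambda>_. 0)(i := 1)) \<circ> ?\<tau> = (\<lambda>_. 0)(?\<tau> i := 1::nat)"
      by (auto simp: fun_eq_iff transpose_def)
    then show ?thesis unfolding X_def twist_single by simp
  qed
  have tX2: "?t ((X i)\<^sup>2) = (X (?\<tau> i))\<^sup>2" for i
    by (simp add: power2_eq_square tm tX)
  have per: "bij_betw ?\<tau> {1..n} {1..n}"
    using assms by (intro permutes_imp_bij permutes_swap_id) auto
  define P where "P = (SIGMA i:{1..n}. {i<..n})"
  define Q where "Q = P - {(k, Suc k)}"
  define g where "g = (\<lambda>p. (X (fst p))\<^sup>2 - (X (snd p))\<^sup>2)"
  have fin: "finite P" by (simp add: P_def)
  have kP: "(k, Suc k) \<in> P" using assms by (auto simp: P_def)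
  have PP: "(\<Prod>i=1..n. \<Prod>j\<in>{i<..n}. h (i, j)) = prod h P" for h :: "nat \<times> nat \<Rightarrow> mpol"
    unfolding P_def by (subst prod.Sigma) auto
  have bij: "bij_betw (map_prod ?\<tau> ?\<tau>) Q Q"
  proof (rule bij_betw_byWitness[where f' = "map_prod ?\<tau> ?\<tau>"])
    show "map_prod ?\<tau> ?\<tau> ` Q \<subseteq> Q"
      using assms by (auto simp: Q_def P_def transpose_def split: if_splits)
    then show "map_prod ?\<tau> ?\<tau> ` Q \<subseteq> Q" .
  qed auto
  have "prod (g \<circ> map_prod ?\<tau> ?\<tau>) P = (g \<circ> map_prod ?\<tau> ?\<tau>) (k, Suc k) * prod (g \<circ> map_prod ?\<tau> ?\<tau>) Q"
    unfolding Q_def by (rule prod.remove[OF fin kP])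
  also have "prod (g \<circ> map_prod ?\<tau> ?\<tau>) Q = prod g Q"
    using prod.reindex_bij_betw[OF bij, of g] by (simp add: o_def)
  also have "(g \<circ> map_prod ?\<tau> ?\<tau>) (k, Suc k) = - g (k, Suc k)" by (simp add: g_def)
  also have "- g (k, Suc k) * prod g Q = - prod g P"
    unfolding Q_def prod.remove[OF fin kP, of g] by simp
  finally have pairs: "prod (g \<circ> map_prod ?\<tau> ?\<tau>) P = - prod g P" .
  have v: "vdm n = (\<Prod>i=1..n. X i) * prod g P"
    unfolding vdm_factor PP[of g, symmetric] by (simp add: g_def)
  have "(\<Prod>i=1..n. X (?\<tau> i)) = (\<Prod>i=1..n. X i)"
    by (rule prod.reindex_bij_betw[OF per])
  moreover have "(\<Prod>p\<in>P. ?t (g p)) = prod (g \<circ> map_prod ?\<tau> ?\<tau>) P"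
    by (rule prod.cong) (simp_all add: g_def twist_diff tX2)
  ultimately have tv: "?t (vdm n) = - vdm n"
    unfolding v tm tp tX by (simp only: pairs mult_minus_right)
  have "lookup (?t p) a = lookup p (a \<circ> ?\<tau>)" for p
  proof -
    have "b \<circ> ?\<tau> = a \<longleftrightarrow> b = a \<circ> ?\<tau>" for b by (auto simp: fun_eq_iff) (metis transpose_involutory)+
    then show ?thesis by (simp add: twist_def lookup_sum lookup_single when_def in_keys_iff)
  qed
  from this[of "vdm n"] show ?thesis unfolding tv by simp
qed

text \<open>A transposition is a shorter one conjugated by an adjacent one, so the induction step
  contributes three sign changes.\<close>

lemma vdm_transpose:
  assumes "i \<in> {1..n}" "j \<in> {1..n}" "i \<noteq> j"
  shows "lookup (vdm n) (a \<circ> transpose i j) = - lookup (vdm n) a"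
proof -
  have main: "lookup (vdm n) (a \<circ> transpose i (i + Suc d)) = - lookup (vdm n) a"
    if "1 \<le> i" "i + Suc d \<le> n" for i d a
    using that(2)
  proof (induction d arbitrary: a)
    case 0
    then show ?case using vdm_adjacent[of i n a] that(1) by (simp only: add_Suc_right add_0_right)
  next
    case (Suc d)
    let ?m = "i + Suc d"
    let ?s = "transpose ?m (Suc ?m)"
    have "transpose i (Suc ?m) = ?s \<circ> transpose i ?m \<circ> ?s"
      by (rule ext) (simp add: transpose_def)
    then have eq: "a \<circ> transpose i (i + Suc (Suc d)) = ((a \<circ> ?s) \<circ> transpose i ?m) \<circ> ?s"
      by (simp add: o_assoc)
    have adj: "lookup (vdm n) (b \<circ> ?s) = - lookup (vdm n) b" for b
      using Suc.prems by (intro vdm_adjacent) auto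
    have ih: "lookup (vdm n) (b \<circ> transpose i ?m) = - lookup (vdm n) b" for b
      using Suc.prems by (intro Suc.IH) auto
    show ?case unfolding eq by (simp only: adj ih minus_minus)
  qed
  show ?thesis
  proof (cases "i < j")
    case True
    then have "transpose i j = transpose i (i + Suc (j - i - 1))" by simp
    then show ?thesis using main[of i "j - i - 1" a] assms True by simp
  next
    case False
    then have "transpose j i = transpose j (j + Suc (i - j - 1))" using assms by simp
    then show ?thesis using main[of j "i - j - 1" a] assms False by (simp add: transpose_commute[of i j])
  qed
qed

lemma homog_prod_sum: "(\<And>i. i \<in> F \<Longrightarrow> homog n (d i) (f i)) \<Longrightarrow> homog n (sum d F) (prod f F)"
  by (induction F rule: infinite_finite_induct) (auto simp: homog_one homog_mult)

text \<open>\<open>phi n j\<close> has degree \<open>1 + 2 * (n - j)\<close>, and the first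
  \<open>n\<close> odd numbers add up to \<open>n^2\<close>.\<close>

lemma homog_vdm: "homog n (n\<^sup>2) (vdm n)"
proof -
  have "homog n (1 + 1 * 2 * card {j<..n}) (phi n j)" if j: "j \<in> {1..n}" for j
  proof -
    have "homog n (1 * 2) ((X j)\<^sup>2 - (X c)\<^sup>2)" if "c \<in> {j<..n}" for c
      using j that by (intro homog_diff homog_power homog_X1) auto
    then show ?thesis unfolding phi_def using j by (intro homog_mult homog_X1 homog_prod) auto
  qed
  then have "homog n (\<Sum>j=1..n. 1 + 1 * 2 * card {j<..n}) (vdm n)"
    unfolding vdm_def by (intro homog_prod_sum)
  moreover have "(\<Sum>j=1..m. 1 + 2 * (m - j)) = m\<^sup>2" for m :: nat
  proof (induction m)
    case (Suc m)
    have "(\<Sum>j=1..m. 1 + 2 * (Suc m - j)) = (\<Sum>j=1..m. (1 + 2 * (m - j)) + 2)"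
      by (rule sum.cong) auto
    also have "\<dots> = (\<Sum>j=1..m. 1 + 2 * (m - j)) + 2 * m"
      by (simp only: sum.distrib) simp
    finally show ?case by (simp add: Suc[simplified] power2_eq_square)
  qed simp
  ultimately show ?thesis by simp
qed

lemma vdm_degree: "lookup (vdm n) a \<noteq> 0 \<Longrightarrow> sum a {1..n} = n\<^sup>2"
  using homog_vdm[of n] by (auto simp: homog_def in_keys_iff mdeg_def)

text \<open>Otherwise \<open>coinv_colon\<close> with \<open>J = {1..n}\<close> would put 1 into an
  ideal whose generators have no constant term.\<close>

lemma vdm_not_coinv: "vdm n \<notin> coinv n"
proof
  assume "vdm n \<in> coinv n"
  then have "prod (phi n) {1..n} * 1 \<in> coinv n" by (simp add: vdm_def)
  then have "1 \<in> ideal.span (jgens n {1..n} (n - card {1..n}))" by (rule coinv_colon[rotated]) simp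
  moreover have "jgens n {1..n} (n - card {1..n}) \<subseteq> ideal.span (X ` UNIV)"
  proof -
    have "pfac J j \<in> ideal.span (X ` UNIV)" for J j
      unfolding pfac_def by (rule span_multR) (rule ideal.span_base, simp)
    moreover have "X ` (- {1..n}) \<subseteq> ideal.span (X ` UNIV)"
      using ideal.span_superset[of "X ` UNIV"] by blast
    ultimately show ?thesis unfolding jgens_def by auto
  qed
  ultimately have "1 \<in> ideal.span (X ` UNIV)"
    using ideal.span_minimal[OF _ ideal.subspace_span] by blast
  then show False by (auto simp: span_X_iff fun_op_apply)
qed

text \<open>For \<open>vdm_not_annd\<close>: the pairing there is bilinear, and the squares of the
  coefficients of delta are nonnegative because these are real.\<close>

definition real_poly :: "mpol \<Rightarrow> bool" where
  "real_poly p \<longleftrightarrow> (\<forall>a. lookup p a \<in> \<real>)"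

lemma real_poly_mult:
  assumes "real_poly p" "real_poly q" shows "real_poly (p * q)"
proof -
  have sum: "real_poly (sum f F)" if "\<And>x. x \<in> F \<Longrightarrow> real_poly (f x)" for f and F :: "(nat \<Rightarrow> nat) set"
    using that by (auto simp: real_poly_def lookup_sum intro: sum_in_Reals)
  have "p * q = (\<Sum>a\<in>keys p. \<Sum>b\<in>keys q. single (a + b) (lookup p a * lookup q b))"
    by (subst sum_single[of p, symmetric], subst sum_single[of q, symmetric])
      (simp only: sum_product mult_single)
  also have "real_poly \<dots>"
    by (intro sum) (use assms in \<open>auto simp: real_poly_def lookup_single when_def\<close>)
  finally show ?thesis .
qed

lemma real_poly_prod: "(\<And>i. i \<in> F \<Longrightarrow> real_poly (f i)) \<Longrightarrow> real_poly (prod f F)"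
  by (induction F rule: infinite_finite_induct) (auto simp: real_poly_mult, auto simp: real_poly_def lookup_one when_def)

lemma vdm_real: "lookup (vdm n) a \<in> \<real>"
proof -
  have X: "real_poly (X i)" for i by (auto simp: real_poly_def X_def lookup_single when_def)
  then have "real_poly ((X i)\<^sup>2 - (X j)\<^sup>2)" for i j
    using real_poly_mult[OF X X] by (simp add: real_poly_def power2_eq_square lookup_minus)
  then have "real_poly (vdm n)"
    unfolding vdm_def phi_def by (intro real_poly_prod real_poly_mult X)
  then show ?thesis by (simp add: real_poly_def)
qed

section \<open>Coefficients of invariants\<close>

lemma act_coeff:
  assumes "f \<in> Omega n" and \<pi>: "signed_perm n \<pi>"
  shows "act n \<pi> f (b, {}) = (\<Prod>i=1..n. sgnc (\<pi> (int i)) ^ b (pidx \<pi> i)) * f (b \<circ> pidx \<pi>, {})"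
  using assms(1)
proof (induction arbitrary: b rule: Omega_gen_induct)
  case one
  have iff: "b \<circ> pidx \<pi> = (\<lambda>_. 0) \<longleftrightarrow> b = (\<lambda>_. 0)"
  proof
    assume *: "b \<circ> pidx \<pi> = (\<lambda>_. 0)"
    show "b = (\<lambda>_. 0)"
    proof
      fix k
      obtain i where "k = pidx \<pi> i" using bij_is_surj[OF signed_perm_pidx(4)[OF \<pi>]] by (rule surjE)
      then show "b k = 0" using fun_cong[OF *, of i] by simp
    qed
  qed (auto simp: o_def)
  have om: "om_one (b \<circ> pidx \<pi>, {}) = om_one (b, {})"
    unfolding om_one_def basis_def by (simp only: prod.inject iff)
  show ?case unfolding act_simps(1) om
    by (cases "b = (\<lambda>_. 0)") (simp_all add: om_one_def basis_def)
next
  case (mulx i f)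
  let ?k = "pidx \<pi> i" and ?s = "\<lambda>i. sgnc (\<pi> (int i))"
  have inj: "pidx \<pi> j = ?k \<longleftrightarrow> j = i" for j
    using signed_perm_pidx(4)[OF \<pi>] by (meson bij_is_inj inj_eq)
  define b' where "b' = b(?k := b ?k - 1)"
  have b': "b' \<circ> pidx \<pi> = (b \<circ> pidx \<pi>)(i := (b \<circ> pidx \<pi>) i - 1)"
    by (rule ext) (auto simp: b'_def inj)
  show ?case
  proof (cases "0 < b ?k")
    case True
    have "(\<Prod>j=1..n. ?s j ^ b (pidx \<pi> j)) = ?s i ^ b ?k * (\<Prod>j\<in>{1..n} - {i}. ?s j ^ b (pidx \<pi> j))"
      by (rule prod.remove) (use mulx(1) in auto)
    also have "(\<Prod>j\<in>{1..n} - {i}. ?s j ^ b (pidx \<pi> j)) = (\<Prod>j\<in>{1..n} - {i}. ?s j ^ b' (pidx \<pi> j))"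
      by (rule prod.cong) (auto simp: b'_def inj)
    also have "?s i ^ b ?k = ?s i * ?s i ^ b' ?k" using True by (simp add: b'_def power_eq_if)
    also have "?s i * ?s i ^ b' ?k * (\<Prod>j\<in>{1..n} - {i}. ?s j ^ b' (pidx \<pi> j))
        = ?s i * (\<Prod>j=1..n. ?s j ^ b' (pidx \<pi> j))"
      by (subst prod.remove[of "{1..n}" i]) (use mulx(1) in auto)
    finally have P: "(\<Prod>j=1..n. ?s j ^ b (pidx \<pi> j)) = ?s i * (\<Prod>j=1..n. ?s j ^ b' (pidx \<pi> j))" .
    have "act n \<pi> (mulx i f) (b, {}) = ?s i * act n \<pi> f (b', {})"
      unfolding act_simps(4)[OF mulx(2) mulx(1)] using True by (simp only: om_smult_apply mulx_apply b'_def if_True)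
    also have "\<dots> = ?s i * ((\<Prod>j=1..n. ?s j ^ b' (pidx \<pi> j)) * f (b' \<circ> pidx \<pi>, {}))"
      unfolding mulx.IH ..
    also have "f (b' \<circ> pidx \<pi>, {}) = mulx i f (b \<circ> pidx \<pi>, {})"
      unfolding b' mulx_apply using True by simp
    finally show ?thesis unfolding P by (simp only: mult.assoc)
  next
    case False
    then have "act n \<pi> (mulx i f) (b, {}) = 0"
      unfolding act_simps(4)[OF mulx(2) mulx(1)] by (simp only: om_smult_apply mulx_apply if_False mult_zero_right)
    moreover have "mulx i f (b \<circ> pidx \<pi>, {}) = 0" using False by (simp add: mulx_apply)
    ultimately show ?thesis by (simp only: mult_zero_right)
  qed
next
  case (multh i f)
  then show ?case by (simp add: act_simps om_smult_apply multh_apply)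
qed (simp_all add: act_simps om_smult_apply fun_op_apply distrib_left)

lemma permutes_involution:
  assumes "\<And>x. x \<notin> D \<Longrightarrow> f x = x" "\<And>x. f (f x) = x" shows "f permutes D"
  unfolding permutes_def using assms by metis

text \<open>Under the signed permutation that negates only \<open>i\<close>, the coefficient is
  multiplied by \<open>(-1)^(a i)\<close>.\<close>

lemma invariants0_even:
  assumes f: "f \<in> invariants0 n" and a: "f (a, {}) \<noteq> 0" and i: "i \<in> {1..n}"
  shows "even (a i)"
proof -
  define \<pi> where "\<pi> = (\<lambda>k. if \<bar>k\<bar> = int i then - k else k)"
  have "\<pi> permutes ({- int n .. int n} - {0})"
    by (rule permutes_involution) (use i in \<open>auto simp: \<pi>_def\<close>)
  then have \<pi>: "signed_perm n \<pi>" by (auto simp: signed_perm_def \<pi>_def)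
  have p: "pidx \<pi> k = k" for k by (auto simp: \<pi>_def)
  have s: "sgnc (\<pi> (int k)) = (if k = i then - 1 else 1)" if "k \<in> {1..n}" for k
    using that i by (auto simp: sgnc_def \<pi>_def)
  have ac: "act n \<pi> f = f" using f \<pi> by (simp add: invariants0_def)
  have "f (a, {}) = (\<Prod>k=1..n. sgnc (\<pi> (int k)) ^ a k) * f (a, {})"
    by (rule act_coeff[OF invariants0_Omega[OF f] \<pi>, of a, unfolded ac o_def p])
  also have "(\<Prod>k=1..n. sgnc (\<pi> (int k)) ^ a k) = (\<Prod>k=1..n. if k = i then (- 1) ^ a i else 1)"
    by (rule prod.cong) (auto simp: s)
  also have "\<dots> = (- 1) ^ a i" using i by simp
  finally have "(- 1 :: complex) ^ a i = 1" using a by simp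
  then show ?thesis by (cases "even (a i)") auto
qed

lemma invariants0_transpose:
  assumes f: "f \<in> invariants0 n" and ij: "i \<in> {1..n}" "j \<in> {1..n}"
  shows "f (a \<circ> transpose i j, {}) = f (a, {})"
proof -
  let ?\<tau> = "transpose i j"
  \<comment> \<open>The transposition is extended to negative integers as an odd function, so that
    all signs \<open>sgnc\<close> are 1.\<close>
  define \<pi> where "\<pi> = (\<lambda>k. sgn k * int (?\<tau> (nat \<bar>k\<bar>)))"
  have \<tau>0: "?\<tau> m \<noteq> 0" if "m \<noteq> 0" for m using that ij by (auto simp: transpose_def)
  have "\<pi> permutes ({- int n .. int n} - {0})"
  proof (rule permutes_involution)
    fix x assume "x \<notin> {- int n..int n} - {0}"
    then have "x = 0 \<or> nat \<bar>x\<bar> \<notin> {1..n}" by auto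
    then show "\<pi> x = x"
    proof
      assume "nat \<bar>x\<bar> \<notin> {1..n}"
      then have "?\<tau> (nat \<bar>x\<bar>) = nat \<bar>x\<bar>" using ij by (metis transpose_apply_other)
      then show ?thesis by (simp add: \<pi>_def sgn_mult_abs)
    qed (simp add: \<pi>_def)
  next
    fix x show "\<pi> (\<pi> x) = x"
    proof (cases "x = 0")
      case False
      then have "nat \<bar>\<pi> x\<bar> = ?\<tau> (nat \<bar>x\<bar>)" by (simp add: \<pi>_def abs_mult)
      moreover have "sgn (\<pi> x) = sgn x" using \<tau>0[of "nat \<bar>x\<bar>"] False by (simp add: \<pi>_def sgn_mult)
      ultimately have "\<pi> (\<pi> x) = sgn x * int (?\<tau> (?\<tau> (nat \<bar>x\<bar>)))" by (simp only: \<pi>_def)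
      then show ?thesis by (simp add: sgn_mult_abs)
    qed (simp add: \<pi>_def)
  qed
  then have \<pi>: "signed_perm n \<pi>" by (auto simp: signed_perm_def \<pi>_def)
  have p: "pidx \<pi> k = ?\<tau> k" for k
    using ij by (cases "k = 0") (auto simp: \<pi>_def abs_mult)
  have s: "sgnc (\<pi> (int k)) = 1" if "k \<in> {1..n}" for k
    using that \<tau>0[of k] by (simp add: sgnc_def \<pi>_def)
  have ac: "act n \<pi> f = f" using f \<pi> by (simp add: invariants0_def)
  have "f (a, {}) = (\<Prod>k=1..n. sgnc (\<pi> (int k)) ^ a (?\<tau> k)) * f (\<lambda>k. a (?\<tau> k), {})"
    by (rule act_coeff[OF invariants0_Omega[OF f] \<pi>, of a, unfolded ac o_def p])
  then show ?thesis by (simp add: s o_def)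
qed

section \<open>Invariants annihilate delta\<close>

lemma dx_pow_apply: "(dx i ^^ k) g (b, U) = pochhammer (of_nat (b i + 1)) k * g (b(i := b i + k), U)"
proof (induction k arbitrary: b)
  case (Suc k)
  have "(dx i ^^ Suc k) g (b, U) = of_nat (b i + 1) * (dx i ^^ k) g (b(i := b i + 1), U)"
    by (simp add: dx_apply)
  also have "\<dots> = of_nat (b i + 1) * pochhammer (of_nat (b i + 1) + 1) k * g (b(i := b i + Suc k), U)"
    unfolding Suc by (simp add: algebra_simps)
  also have "of_nat (b i + 1) * pochhammer (of_nat (b i + 1) + 1) k = (pochhammer (of_nat (b i + 1)) (Suc k) :: complex)"
    by (rule pochhammer_rec[symmetric])
  finally show ?case .
qed simp

lemma fold_dx_apply:
  "distinct xs \<Longrightarrow> fold (\<lambda>i h. (dx i ^^ a i) h) xs g (b, U)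
    = (\<Prod>i\<in>set xs. pochhammer (of_nat (b i + 1)) (a i)) * g (\<lambda>i. if i \<in> set xs then b i + a i else b i, U)"
proof (induction xs arbitrary: g)
  case (Cons x xs)
  let ?b = "\<lambda>i. if i \<in> set xs then b i + a i else b i"
  have "?b x = b x" using Cons.prems by simp
  moreover have "?b(x := b x + a x) = (\<lambda>i. if i \<in> set (x # xs) then b i + a i else b i)"
    using Cons.prems by (auto simp: fun_eq_iff)
  ultimately show ?case using Cons by (simp add: dx_pow_apply mult_ac)
qed simp

lemma monop_dx_apply:
  assumes "\<And>i. i \<notin> {1..n} \<Longrightarrow> a i = 0"
  shows "monop n dx dth (a, {}) g (b, U) = (\<Prod>i=1..n. pochhammer (of_nat (b i + 1)) (a i)) * g (a + b, U)"
proof -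
  have "set [1..<Suc n] = {1..n}" by auto
  moreover have "(\<lambda>i. if i \<in> {1..n} then b i + a i else b i) = a + b"
    using assms by (auto simp: fun_eq_iff fun_op_apply)
  ultimately show ?thesis
    unfolding monop_def fst_conv snd_conv
    by (simp only: fold_dx_apply[OF distinct_upt] sorted_list_of_set_empty foldr.simps id_apply)
qed

lemma monop_dth_emb:
  assumes "finite S" "S \<noteq> {}" shows "monop n dx dth (a, S) (emb p) = 0"
proof -
  have "dth i (emb p) = 0" for i by (rule om_eqI) (auto simp: dth_apply emb_apply fun_op_apply)
  moreover have "sorted_list_of_set S \<noteq> []" using assms by simp
  moreover have "foldr dth xs (emb p) = 0" if "xs \<noteq> []" "\<And>i. dth i (emb p) = 0" for xs
    using that(1) by (induction xs) (metis foldr_Cons foldr_Nil id_apply lin_0 lin_ops(4) o_apply that(2))+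
  ultimately show ?thesis unfolding monop_def by (simp add: lin_0[OF od.lin_fold])
qed

text \<open>The halves of the elements of \<open>A\<close> are distinct and below
  \<open>b div 2\<close>, so the new maximum \<open>b\<close> is at least
  \<open>2 * card A + 1\<close>, the gap between consecutive squares.\<close>

lemma sum_distinct_odd:
  assumes "finite A" "\<And>x. x \<in> A \<Longrightarrow> odd x"
  shows "(card A)\<^sup>2 \<le> \<Sum>(A :: nat set)"
  using assms
proof (induction A rule: finite_linorder_max_induct)
  case (insert b A)
  have "inj_on (\<lambda>x. x div 2) A"
    by (rule inj_onI) (use insert.prems in \<open>metis insert_iff odd_two_times_div_two_succ\<close>)
  moreover have "(\<lambda>x. x div 2) ` A \<subseteq> {..<b div 2}"
  proof
    fix y assume "y \<in> (\<lambda>x. x div 2) ` A"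
    then obtain x where x: "x \<in> A" "y = x div 2" by auto
    then have "x < b" "odd x" "odd b" using insert by auto
    then show "y \<in> {..<b div 2}" using x by (auto elim!: oddE)
  qed
  ultimately have "card A \<le> b div 2" using card_inj_on_le[of "\<lambda>x. x div 2" A "{..<b div 2}"] by simp
  moreover have "odd b" using insert.prems by simp
  ultimately have "2 * card A + 1 \<le> b" by (auto elim!: oddE)
  moreover have b: "b \<notin> A" using insert.hyps by auto
  moreover have "(card A)\<^sup>2 \<le> \<Sum>A" using insert by simp
  moreover have "(card (insert b A))\<^sup>2 = (card A)\<^sup>2 + (2 * card A + 1)"
    unfolding card_insert_disjoint[OF insert.hyps(1) b] by (simp add: power2_eq_square)
  moreover have "\<Sum>(insert b A) = b + \<Sum>A" using insert.hyps(1) b by simp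
  ultimately show ?case by linarith
qed simp

text \<open>Consider the coefficient of \<open>x^b\<close>. If \<open>b\<close> takes a value twice
  on \<open>{1..n}\<close>, the sum is its own negative by antisymmetry of delta. Otherwise a
  nonzero term forces the \<open>b i\<close> to be distinct and odd, so they already add up to the
  degree of delta, leaving only the excluded constant term of \<open>f\<close>.\<close>

lemma odot_delta:
  assumes f: "f \<in> invariants0 n" shows "odot n f (deltaB n) = 0"
proof (rule om_eqI)
  fix b U
  define \<delta> where "\<delta> = lookup (vdm n)"
  \<comment> \<open>The factor that arises when the derivative of exponent \<open>a\<close> is
    applied to \<open>x^(a + b)\<close>.\<close>
  define P where "P = (\<lambda>a::nat\<Rightarrow>nat. \<Prod>i=1..n. pochhammer (of_nat (b i + 1) :: complex) (a i))"
  define A where "A = {a. f (a, {}) \<noteq> 0}"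
  have fO: "f \<in> Omega n" using f by (rule invariants0_Omega)
  have finA: "finite A"
  proof -
    have "A \<subseteq> fst ` supp f" unfolding A_def supp_def by force
    then show ?thesis using Omega_finite[OF fO] finite_subset by blast
  qed
  have coeff: "monop n dx dth (a, S) (deltaB n) (b, U) = (if S = {} \<and> U = {} then P a * \<delta> (a + b) else 0)"
    if "(a, S) \<in> supp f" for a S
  proof -
    have *: "f (a, S) \<noteq> 0" using that by (simp add: supp_def)
    show ?thesis
    proof (cases "S = {}")
      case True
      then show ?thesis
        using monop_dx_apply[of n a "deltaB n" b U] OmegaD(1)[OF fO *]
        by (simp add: deltaB_emb(1) emb_apply P_def \<delta>_def)
    next
      case False
      then show ?thesis
        using monop_dth_emb[of S n a "vdm n"] OmegaD(3)[OF fO *] by (simp add: deltaB_emb(1) fun_op_apply)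
    qed
  qed
  have "odot n f (deltaB n) (b, U) = (\<Sum>m\<in>supp f. f m * (if snd m = {} \<and> U = {} then P (fst m) * \<delta> (fst m + b) else 0))"
    unfolding odot_def lin_ext_def
  proof (rule sum.cong[OF refl])
    fix m assume "m \<in> supp f"
    then show "f m * monop n dx dth m (deltaB n) (b, U)
        = f m * (if snd m = {} \<and> U = {} then P (fst m) * \<delta> (fst m + b) else 0)"
      using coeff[of "fst m" "snd m"] by simp
  qed
  also have "\<dots> = (if U = {} then \<Sum>a\<in>A. f (a, {}) * (P a * \<delta> (a + b)) else 0)"
  proof (cases "U = {}")
    case True
    have "(\<Sum>m\<in>supp f. f m * (if snd m = {} then P (fst m) * \<delta> (fst m + b) else 0))
        = (\<Sum>m\<in>(\<lambda>a. (a, {})) ` A. f m * (if snd m = {} then P (fst m) * \<delta> (fst m + b) else 0))"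
      by (rule sum.mono_neutral_right) (use Omega_finite[OF fO] in \<open>auto simp: A_def supp_def image_iff\<close>)
    also have "\<dots> = (\<Sum>a\<in>A. f (a, {}) * (P a * \<delta> (a + b)))"
      by (subst sum.reindex) (auto simp: inj_on_def)
    finally show ?thesis using True by simp
  qed simp
  also have "(\<Sum>a\<in>A. f (a, {}) * (P a * \<delta> (a + b))) = 0"
  proof (cases "inj_on b {1..n}")
    case False
    then obtain i j where ij: "i \<in> {1..n}" "j \<in> {1..n}" "i \<noteq> j" "b i = b j" by (auto simp: inj_on_def)
    let ?\<tau> = "transpose i j"
    let ?g = "\<lambda>a. f (a, {}) * (P a * \<delta> (a + b))"
    have b\<tau>: "b \<circ> ?\<tau> = b" using ij(4) by (auto simp: fun_eq_iff transpose_def)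
    have inv: "f (a \<circ> ?\<tau>, {}) = f (a, {})" for a by (rule invariants0_transpose[OF f ij(1,2)])
    have invo: "a \<circ> ?\<tau> \<circ> ?\<tau> = a" for a :: "nat \<Rightarrow> nat" by (simp add: o_assoc[symmetric])
    have bij: "bij_betw (\<lambda>a. a \<circ> ?\<tau>) A A"
      by (rule bij_betw_byWitness[where f' = "\<lambda>a. a \<circ> ?\<tau>"]) (auto simp: A_def inv invo)
    have "?g (a \<circ> ?\<tau>) = - ?g a" for a
    proof -
      have "(a \<circ> ?\<tau>) + b = (a + b) \<circ> ?\<tau>" using b\<tau> by (auto simp: fun_eq_iff fun_op_apply)
      then have d: "\<delta> ((a \<circ> ?\<tau>) + b) = - \<delta> (a + b)" unfolding \<delta>_def by (simp only: vdm_transpose[OF ij(1-3)])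
      have per: "bij_betw ?\<tau> {1..n} {1..n}"
        by (intro permutes_imp_bij permutes_swap_id ij)
      have "P a = (\<Prod>k=1..n. pochhammer (of_nat (b (?\<tau> k) + 1)) (a (?\<tau> k)))"
        unfolding P_def by (rule prod.reindex_bij_betw[OF per, symmetric])
      also have "\<dots> = P (a \<circ> ?\<tau>)"
        unfolding P_def using fun_cong[OF b\<tau>] by (simp add: o_def)
      finally show ?thesis by (simp add: inv d)
    qed
    then have "sum ?g A = - sum ?g A"
      using sum.reindex_bij_betw[OF bij, of ?g] by (simp add: sum_negf)
    then show ?thesis by simp
  next
    case True
    have "\<delta> (a + b) = 0" if "a \<in> A" for a
    proof (rule ccontr)
      assume d: "\<delta> (a + b) \<noteq> 0"
      have fa: "f (a, {}) \<noteq> 0" using that by (simp add: A_def)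
      have odd: "odd (b i)" if "i \<in> {1..n}" for i
      proof -
        have "odd ((a + b) i)" using d that unfolding \<delta>_def by (rule vdm_odd)
        moreover have "even (a i)" using f fa that by (rule invariants0_even)
        ultimately show ?thesis by (simp add: fun_op_apply)
      qed
      have "(card (b ` {1..n}))\<^sup>2 \<le> \<Sum>(b ` {1..n})" by (rule sum_distinct_odd) (use odd in auto)
      then have "n\<^sup>2 \<le> sum b {1..n}" using True by (simp add: card_image sum.reindex)
      moreover have "sum (a + b) {1..n} = n\<^sup>2" using d unfolding \<delta>_def by (rule vdm_degree)
      moreover have "sum (a + b) {1..n} = sum a {1..n} + sum b {1..n}"
        unfolding plus_fun_def by (rule sum.distrib)
      ultimately have "sum a {1..n} = 0" by linarith
      then have "a i = 0" for i using OmegaD(1)[OF fO fa, of i] by (cases "i \<in> {1..n}") auto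
      then have "a = (\<lambda>_. 0)" by auto
      then show False using f fa by (simp add: invariants0_def)
    qed
    then show ?thesis by simp
  qed
  finally show "odot n f (deltaB n) (b, U) = 0 (b, U)" by (simp add: fun_op_apply)
qed

lemma deltaB_invharm: "deltaB n \<in> invharm n"
  by (simp add: invharm_def deltaB_emb(2) odot_delta)

lemma par_deltaB: "par (deltaB n) = deltaB n"
  by (rule om_eqI) (simp add: par_apply deltaB_emb(1) emb_apply)

lemma dpr_list_invharm: "foldr (\<lambda>i. dpr n (2 * i - 1)) xs (deltaB n) \<in> invharm n"
  if "\<And>i. i \<in> set xs \<Longrightarrow> 1 \<le> i"
  using that
proof (induction xs)
  case (Cons i xs)
  then have "1 \<le> i" by simp
  then have "odd (2 * i - 1)" by simp
  then show ?case using Cons by (simp add: invharm_dpr del: One_nat_def)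
qed (simp add: deltaB_invharm)

lemma dI_invharm:
  assumes "I \<subseteq> {1..n}" shows "dI n I (deltaB n) \<in> invharm n"
proof -
  have "finite I" using assms finite_subset by blast
  then have "foldr (\<lambda>i. dpr n (2 * i - 1)) (sorted_list_of_set I) (deltaB n) \<in> invharm n"
    using assms by (intro dpr_list_invharm) auto
  then show ?thesis using dI_eq[OF deltaB_emb(2) par_deltaB, of n I] invharm_smult by fastforce
qed

subsection \<open>The pairing with superspace elements\<close>

text \<open>An element \<open>\<Sum> U T \<theta>\<^sub>T\<close> is represented by its polynomial coefficients
  \<open>U :: nat set \<Rightarrow> mpol\<close>; under the pairing below, multiplication by \<open>x\<^sub>i\<close> and by \<open>\<theta>\<^sub>i\<close>
  are adjoint to the corresponding derivations, without signs.\<close>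
type_synonym coefs = "nat set \<Rightarrow> mpol"

text \<open>The factorials turn the shift of exponents by \<open>X i\<close> into the factor that
  differentiation produces, see \<open>pair_X\<close>.\<close>

definition wt :: "nat \<Rightarrow> (nat \<Rightarrow> nat) \<Rightarrow> real" where
  "wt n a = (\<Prod>i=1..n. fact (a i))"

lemma wt_pos: "0 < wt n a"
  unfolding wt_def by (intro prod_pos) auto

text \<open>Bilinear, without complex conjugation; for \<open>g\<close> in \<open>Omega n\<close>
  the sum is finite whatever \<open>U\<close> is.\<close>

definition pair :: "nat \<Rightarrow> coefs \<Rightarrow> om \<Rightarrow> complex" where
  "pair n U g = (\<Sum>m\<in>supp g. lookup (U (snd m)) (fst m) * of_real (wt n (fst m)) * g m)"

lemma pair_superset:
  assumes "finite M" "supp g \<subseteq> M"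
  shows "pair n U g = (\<Sum>m\<in>M. lookup (U (snd m)) (fst m) * of_real (wt n (fst m)) * g m)"
  unfolding pair_def by (rule sum.mono_neutral_left) (use assms in \<open>auto simp: supp_def\<close>)

lemma pair_add_right:
  assumes "g \<in> Omega n" "h \<in> Omega n" shows "pair n U (g + h) = pair n U g + pair n U h"
proof -
  have "supp (g + h) \<subseteq> supp g \<union> supp h" by (auto simp: supp_def fun_op_apply)
  then show ?thesis
    using assms by (simp add: pair_superset[of "supp g \<union> supp h"] Omega_finite fun_op_apply distrib_left sum.distrib)
qed

lemma pair_smult_right: "g \<in> Omega n \<Longrightarrow> pair n U (om_smult c g) = c * pair n U g"
proof -
  assume "g \<in> Omega n"
  moreover have "supp (om_smult c g) \<subseteq> supp g" by (auto simp: supp_def om_smult_apply)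
  ultimately show ?thesis
    by (simp add: pair_superset[of "supp g"] Omega_finite om_smult_apply sum_distrib_left mult_ac)
qed

lemma pair_zero_right [simp]: "pair n U 0 = 0"
  by (simp add: pair_def supp_def fun_op_apply)

lemma pair_sum_right: "(\<And>x. x \<in> F \<Longrightarrow> g x \<in> Omega n) \<Longrightarrow> pair n U (sum g F) = (\<Sum>x\<in>F. pair n U (g x))"
  by (induction F rule: infinite_finite_induct) (auto simp: pair_add_right Omega_sum)

lemma pair_basis: "pair n U (basis (a, S)) = lookup (U S) a * of_real (wt n a)"
  by (subst pair_superset[of "{(a, S)}"]) (auto simp: supp_def basis_def)

lemma pair_zero_left [simp]: "pair n (\<lambda>T. 0) g = 0"
  by (simp add: pair_def)

lemma pair_add_left: "pair n (\<lambda>T. U T + V T) g = pair n U g + pair n V g"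
  by (simp add: pair_def lookup_add distrib_right sum.distrib)

lemma pair_diff_left: "pair n (\<lambda>T. U T - V T) g = pair n U g - pair n V g"
  by (simp add: pair_def lookup_minus left_diff_distrib sum_subtractf)

lemma pair_sum_left: "pair n (\<lambda>T. \<Sum>x\<in>F. U x T) g = (\<Sum>x\<in>F. pair n (U x) g)"
  by (induction F rule: infinite_finite_induct) (auto simp: pair_add_left)

definition sgp :: "nat \<Rightarrow> nat set \<Rightarrow> mpol" where
  "sgp i T = (- 1) ^ card {t \<in> T. t < i}"

lemma lookup_sgp: "lookup (sgp i T * p) a = sg i T * lookup p a"
  by (cases "even (card {t \<in> T. t < i})") (simp_all add: sgp_def sg_def)

lemma sgp_sq [simp]: "sgp i U * sgp i U = 1" "sgp i U * (sgp i U * z) = z"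
  by (simp_all add: sgp_def flip: power_add mult.assoc)

lemma sgp_insert: "j \<notin> U \<Longrightarrow> sgp i (insert j U) = (if j < i then - sgp i U else sgp i U)"
proof -
  assume j: "j \<notin> U"
  show ?thesis
  proof (cases "j < i")
    case True
    have "{t \<in> insert j U. t < i} = insert j {t \<in> U. t < i}" using True by auto
    then have "card {t \<in> insert j U. t < i} = Suc (card {t \<in> U. t < i})" using j by simp
    then show ?thesis using True by (simp add: sgp_def)
  next
    case False
    then have "{t \<in> insert j U. t < i} = {t \<in> U. t < i}" by auto
    then show ?thesis using False by (simp add: sgp_def)
  qed
qed

text \<open>Left multiplication by \<open>theta_i\<close> on coefficient families;
  \<open>econ i\<close> is the corresponding derivation.\<close>

definition emul :: "nat \<Rightarrow> coefs \<Rightarrow> coefs" where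
  "emul i U = (\<lambda>T. if i \<in> T then sgp i T * U (T - {i}) else 0)"

definition econ :: "nat \<Rightarrow> coefs \<Rightarrow> coefs" where
  "econ i U = (\<lambda>T. if i \<notin> T then sgp i T * U (insert i T) else 0)"

lemma pair_X:
  assumes g: "g \<in> Omega n" and i: "i \<in> {1..n}"
  shows "pair n (\<lambda>T. X i * U T) g = pair n U (dx i g)"
  using g
proof (induction rule: Omega_induct)
  case (basis a S c)
  have "dx i (Defs.basis (a, S)) = om_smult (of_nat (a i)) (Defs.basis (a(i := a i - 1), S))"
  proof (rule om_eqI)
    fix b U
    have "b(i := b i + 1) = a \<longleftrightarrow> 0 < a i \<and> b = a(i := a i - 1)" by auto
    then show "dx i (Defs.basis (a, S)) (b, U)
        = om_smult (of_nat (a i)) (Defs.basis (a(i := a i - 1), S)) (b, U)"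
      unfolding dx_apply basis_def om_smult_apply prod.inject
      by (cases "0 < a i"; cases "b = a(i := a i - 1)") (simp_all only: simp_thms if_False if_True mult_zero_right fun_upd_same, simp_all)
  qed
  moreover have "wt n a = of_nat (a i) * wt n (a(i := a i - 1))" if "0 < a i"
  proof -
    have "wt n a = fact (a i) * (\<Prod>j\<in>{1..n} - {i}. fact (a j))"
      unfolding wt_def using i by (subst prod.remove[of _ i]) auto
    moreover have "wt n (a(i := a i - 1)) = fact (a i - 1) * (\<Prod>j\<in>{1..n} - {i}. fact (a j))"
      unfolding wt_def using i by (subst prod.remove[of _ i]) auto
    ultimately show ?thesis using that by (simp add: fact_reduce)
  qed
  moreover have "Defs.basis (a(i := a i - 1), S) \<in> Omega n"
    using basis by (auto simp: basis_Omega_iff)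
  ultimately show ?case
    using basis
    by (cases "0 < a i") (simp_all add: pair_smult_right pair_basis lookup_X_mult lin_smult[OF lin_ops(3)] Omega_smult mult_ac)
next
  case (add f g)
  then show ?case by (simp add: pair_add_right lin_add[OF lin_ops(3)] Omega_dx)
qed

lemma pair_X_outside:
  assumes "g \<in> Omega n" "i \<notin> {1..n}" shows "pair n (\<lambda>T. X i * U T) g = 0"
  unfolding pair_def
proof (rule sum.neutral, rule)
  fix m assume "m \<in> supp g"
  then have "g (fst m, snd m) \<noteq> 0" by (simp add: supp_def)
  then have "fst m i = 0" using OmegaD(1)[OF assms(1)] assms(2) by blast
  then show "lookup (X i * U (snd m)) (fst m) * of_real (wt n (fst m)) * g m = 0"
    by (simp add: lookup_X_mult)
qed

lemma pair_emul: "g \<in> Omega n \<Longrightarrow> pair n (emul i U) g = pair n U (dth i g)"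
proof (induction rule: Omega_induct)
  case (basis a S c)
  have "dth i (Defs.basis (a, S)) = (if i \<in> S then om_smult (sg i S) (Defs.basis (a, S - {i})) else 0)"
    by (rule om_eqI) (auto simp: dth_apply basis_def om_smult_apply fun_op_apply)
  moreover have "Defs.basis (a, S - {i}) \<in> Omega n" using basis by (auto simp: basis_Omega_iff)
  ultimately show ?case
    using basis by (simp add: pair_smult_right pair_basis emul_def lookup_sgp lin_smult[OF lin_ops(4)] Omega_smult mult_ac)
next
  case (add f g)
  then show ?case by (simp add: pair_add_right lin_add[OF lin_ops(4)] Omega_dth)
qed

lemma pair_econ: "g \<in> Omega n \<Longrightarrow> i \<in> {1..n} \<Longrightarrow> pair n (econ i U) g = pair n U (multh i g)"
proof (induction rule: Omega_induct)
  case (basis a S c)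
  have "Defs.basis (a, insert i S) \<in> Omega n" using basis by (auto simp: basis_Omega_iff)
  then show ?case
    using basis by (simp add: pair_smult_right pair_basis econ_def lookup_sgp lin_smult[OF lin_ops(2)] multh_basis Omega_smult mult_ac)
next
  case (add f g)
  then show ?case by (simp add: pair_add_right lin_add[OF lin_ops(2)] Omega_multh)
qed

lemma pair_X_pow: "g \<in> Omega n \<Longrightarrow> i \<in> {1..n} \<Longrightarrow> pair n (\<lambda>T. X i ^ k * U T) g = pair n U ((dx i ^^ k) g)"
proof (induction k arbitrary: U)
  case (Suc k)
  have "pair n (\<lambda>T. X i ^ Suc k * U T) g = pair n (\<lambda>T. X i ^ k * (X i * U T)) g"
    by (simp add: mult_ac)
  also have "\<dots> = pair n (\<lambda>T. X i * U T) ((dx i ^^ k) g)" by (rule Suc.IH[OF Suc.prems])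
  also have "\<dots> = pair n U (dx i ((dx i ^^ k) g))" using Suc by (intro pair_X Omega_dx_pow)
  finally show ?case by simp
qed simp

lemma pair_single:
  "g \<in> Omega n \<Longrightarrow> \<forall>i. i \<notin> {1..n} \<longrightarrow> a i = 0 \<Longrightarrow>
    pair n (\<lambda>T. single a 1 * U T) g = pair n U (odot n (basis (a, {})) g)"
proof (induction "sum a {1..n}" arbitrary: a U)
  case 0
  then have "a = (\<lambda>_. 0)" by (auto simp: fun_eq_iff)
  then have "(single a 1 :: mpol) = 1" "basis (a, {}) = om_one"
    unfolding om_one_def by (simp_all add: zero_fun_def[symmetric])
  then show ?case by (simp add: odot_simps)
next
  case (Suc k)
  then obtain i where i: "i \<in> {1..n}" "0 < a i" by (metis nat.simps(3) sum.neutral gr0I)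
  define b where "b = a(i := a i - 1)"
  have bO: "basis (b, {}) \<in> Omega n" using Suc.prems by (auto simp: basis_Omega_iff b_def)
  have ab: "basis (a, {}) = mulx i (basis (b, {}))" using i by (simp add: mulx_basis b_def)
  have "(\<lambda>_. 0)(i := 1) + b = a" using i by (auto simp: fun_eq_iff fun_op_apply b_def)
  then have s: "single a 1 = single b 1 * X i" by (simp add: X_def mult_single add.commute)
  have "sum a {1..n} = Suc (sum b {1..n})" using i by (simp add: sum.remove b_def)
  then have "k = sum b {1..n}" using Suc(2) by simp
  then have "pair n (\<lambda>T. single b 1 * (X i * U T)) g = pair n (\<lambda>T. X i * U T) (odot n (basis (b, {})) g)"
    using Suc.prems by (intro Suc.hyps(1)) (auto simp: b_def)
  also have "\<dots> = pair n U (dx i (odot n (basis (b, {})) g))"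
    using Suc.prems i bO by (intro pair_X odot_Omega)
  also have "dx i (odot n (basis (b, {})) g) = odot n (basis (a, {})) g"
    unfolding ab using bO i(1) by (simp add: odot_simps)
  finally show ?case by (simp add: s mult.assoc)
qed

subsection \<open>Contractions and exterior multiplications\<close>

text \<open>Contraction with the vector field with components \<open>v i\<close>; \<open>wed\<close>
  multiplies by the one-form with the same components.\<close>

definition con :: "nat \<Rightarrow> (nat \<Rightarrow> mpol) \<Rightarrow> coefs \<Rightarrow> coefs" where
  "con n v U = (\<lambda>T. \<Sum>i=1..n. v i * econ i U T)"

definition wed :: "nat \<Rightarrow> (nat \<Rightarrow> mpol) \<Rightarrow> coefs \<Rightarrow> coefs" where
  "wed n v U = (\<lambda>T. \<Sum>i=1..n. v i * emul i U T)"

text \<open>The components both of the vector field \<open>v\<^sub>r\<close> and of the invariant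
  one-form \<open>\<omega>\<^sub>r\<close>.\<close>

definition pv :: "nat \<Rightarrow> nat \<Rightarrow> mpol" where
  "pv r = (\<lambda>i. X i ^ (2 * r - 1))"

lemma pair_con:
  assumes "g \<in> Omega n"
  shows "pair n (con n (pv r) U) g = pair n U (dpr n (2 * r - 1) g)"
  unfolding con_def dpr_def pair_sum_left pv_def
  using assms
  by (subst pair_sum_right) (auto simp: pair_X_pow pair_econ Omega_dx_pow intro: Omega_multh)

lemma pair_wed:
  assumes "g \<in> Omega n"
  shows "pair n (wed n (pv r) U) g = pair n U (\<Sum>i=1..n. dth i ((dx i ^^ (2 * r - 1)) g))"
  unfolding wed_def pair_sum_left pv_def
  using assms
  by (subst pair_sum_right) (auto simp: pair_X_pow pair_emul Omega_dx_pow intro: Omega_dth)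

lemma pair_psum:
  assumes "g \<in> Omega n"
  shows "pair n (\<lambda>T. psum n r * U T) g = pair n U (\<Sum>i=1..n. (dx i ^^ (2 * r)) g)"
  unfolding psum_def sum_distrib_right pair_sum_left
  using assms
  by (subst pair_sum_right) (auto simp: pair_X_pow Omega_dx_pow)

lemma con_add_v: "con n (\<lambda>i. v i + w i) U = (\<lambda>T. con n v U T + con n w U T)"
  by (simp add: con_def distrib_right sum.distrib)

lemma con_scale_v: "con n (\<lambda>i. c * v i) U = (\<lambda>T. c * con n v U T)"
  by (simp add: con_def sum_distrib_left mult.assoc)

lemma con_add: "con n v (\<lambda>T. U T + W T) = (\<lambda>T. con n v U T + con n v W T)"
  by (rule ext) (auto simp: con_def econ_def distrib_left sum.distrib[symmetric] intro!: sum.cong)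

lemma con_scale: "con n v (\<lambda>T. c * U T) = (\<lambda>T. c * con n v U T)"
  by (rule ext) (auto simp: con_def econ_def sum_distrib_left mult_ac intro!: sum.cong)

lemma con_zero: "con n v (\<lambda>T. 0) = (\<lambda>T. 0)"
  using con_scale[of n v 0 "\<lambda>T. 0"] by simp

lemma wed_add_v: "wed n (\<lambda>i. v i + w i) U = (\<lambda>T. wed n v U T + wed n w U T)"
  by (simp add: wed_def distrib_right sum.distrib)

lemma wed_scale_v: "wed n (\<lambda>i. c * v i) U = (\<lambda>T. wed n v (\<lambda>T. c * U T) T)"
  by (rule ext) (auto simp: wed_def emul_def mult_ac intro!: sum.cong)

lemma econ_econ: "econ i (econ j U) T = - econ j (econ i U) T"
proof (cases "i = j")
  case False
  have "insert i (insert j T) = insert j (insert i T)" by auto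
  then show ?thesis using False by (auto simp: econ_def sgp_insert mult_ac)
qed (simp add: econ_def)

lemma con_con: "con n v (con n w U) = (\<lambda>T. - con n w (con n v U) T)"
proof
  fix T
  have 1: "con n v (con n w U) T = (\<Sum>i=1..n. \<Sum>j=1..n. v i * (w j * econ i (econ j U) T))" for v w
    unfolding con_def econ_def by (auto simp: sum_distrib_left mult_ac intro!: sum.cong)
  have "con n v (con n w U) T = (\<Sum>i=1..n. \<Sum>j=1..n. - (w j * (v i * econ j (econ i U) T)))"
    unfolding 1 by (intro sum.cong refl, subst econ_econ) (simp add: mult_ac)
  also have "\<dots> = - (\<Sum>j=1..n. \<Sum>i=1..n. w j * (v i * econ j (econ i U) T))"
    by (subst sum.swap) (simp add: sum_negf)
  finally show "con n v (con n w U) T = - con n w (con n v U) T" unfolding 1 .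
qed

lemma double_zero: "x + x = 0 \<Longrightarrow> x = (0 :: mpol)"
proof -
  assume "x + x = 0"
  then have "of_nat 2 * x \<in> ideal.span {}"
    by (simp only: of_nat_numeral mult_2 ideal.span_zero)
  then have "x \<in> ideal.span {}" by (rule span_of_nat_cancel) simp
  then show "x = 0" by (simp only: ideal.span_empty singleton_iff)
qed

lemma con_same: "con n v (con n v U) = (\<lambda>T. 0)"
proof
  fix T
  have "con n v (con n v U) T = - con n v (con n v U) T" by (rule fun_cong[OF con_con])
  then have "con n v (con n v U) T + con n v (con n v U) T = 0" by (simp only: eq_neg_iff_add_eq_0)
  then show "con n v (con n v U) T = 0" by (rule double_zero)
qed

section \<open>Iterated contractions\<close>

abbreviation cons where "cons n ws U \<equiv> foldr (con n) ws U"

lemma cons_add: "cons n ws (\<lambda>T. U T + W T) = (\<lambda>T. cons n ws U T + cons n ws W T)"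
  by (induction ws) (simp_all add: con_add)

lemma cons_scale: "cons n ws (\<lambda>T. c * U T) = (\<lambda>T. c * cons n ws U T)"
  by (induction ws) (simp_all add: con_scale)

lemma cons_repeated: "w \<in> set ws \<Longrightarrow> con n w (cons n ws U) = (\<lambda>T. 0)"
proof (induction ws)
  case (Cons v ws)
  show ?case
  proof (cases "v = w")
    case False
    then have "con n w (cons n ws U) = (\<lambda>T. 0)" using Cons by simp
    then show ?thesis using con_con[of n w v "cons n ws U"] by (simp add: con_zero)
  qed (simp add: con_same)
qed simp

text \<open>The factor \<open>c\<close> is a sign; recording \<open>c * c = 1\<close> is enough to
  cancel it later.\<close>

lemma cons_insort:
  "\<exists>c. c * c = 1 \<and> cons n (map f (x # xs)) U = (\<lambda>T. c * cons n (map f (insort x xs)) U T)"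
proof (induction xs)
  case Nil
  show ?case by (intro exI[of _ 1]) simp
next
  case (Cons y xs)
  show ?case
  proof (cases "x \<le> y")
    case True
    then show ?thesis by (intro exI[of _ 1]) simp
  next
    case False
    obtain c where c1: "c * c = 1"
      and c: "cons n (map f (x # xs)) U = (\<lambda>T. c * cons n (map f (insort x xs)) U T)"
      using Cons by blast
    have "cons n (map f (x # y # xs)) U = (\<lambda>T. - con n (f y) (cons n (map f (x # xs)) U) T)"
      using con_con[of n "f x" "f y" "cons n (map f xs) U"] by simp
    also have "\<dots> = (\<lambda>T. (- c) * cons n (map f (insort x (y # xs))) U T)"
      unfolding c con_scale using False by simp
    finally show ?thesis using c1 by (intro exI[of _ "- c"]) simp
  qed
qed

lemma cons_sort:
  "\<exists>c. c * c = 1 \<and> cons n (map f xs) U = (\<lambda>T. c * cons n (map f (sort xs)) U T)"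
proof (induction xs)
  case Nil
  show ?case by (intro exI[of _ 1]) simp
next
  case (Cons x xs)
  obtain c where c1: "c * c = 1" and c: "cons n (map f xs) U = (\<lambda>T. c * cons n (map f (sort xs)) U T)"
    using Cons by blast
  obtain d where d1: "d * d = 1" and d: "cons n (map f (x # sort xs)) U = (\<lambda>T. d * cons n (map f (insort x (sort xs))) U T)"
    using cons_insort by blast
  have "cons n (map f (x # xs)) U = (\<lambda>T. c * cons n (map f (x # sort xs)) U T)"
    using c by (simp add: con_scale)
  then have "cons n (map f (x # xs)) U = (\<lambda>T. (c * d) * cons n (map f (sort (x # xs))) U T)"
    unfolding d by (simp add: mult.assoc)
  moreover have "(c * d) * (c * d) = 1"
    using c1 d1 by (metis mult.assoc mult.left_commute mult_1_right)
  ultimately show ?case by blast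
qed

lemma cons_not_distinct: "\<not> distinct xs \<Longrightarrow> cons n (map f xs) U = (\<lambda>T. 0)"
  by (induction xs) (auto simp: cons_repeated con_zero)

text \<open>The polynomial combinations of the \<open>pv r\<close>. They may be used for
  contraction, by \<open>cons_covs_mem\<close>, and for multiplication, by
  \<open>perp_wed\<close>.\<close>

inductive_set covs :: "nat \<Rightarrow> (nat \<Rightarrow> mpol) set" for n where
  pv: "r \<in> {1..n} \<Longrightarrow> pv r \<in> covs n"
| scale: "v \<in> covs n \<Longrightarrow> (\<lambda>i. c * v i) \<in> covs n"
| add: "v \<in> covs n \<Longrightarrow> w \<in> covs n \<Longrightarrow> (\<lambda>i. v i + w i) \<in> covs n"

text \<open>Expanding one factor of the product either raises \<open>a\<close> by one or multiplies
  by a polynomial that does not depend on \<open>l\<close>.\<close>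

lemma covs_prod:
  assumes "finite B"
  shows "1 \<le> a \<Longrightarrow> a + card B \<le> n \<Longrightarrow> (\<lambda>l. X l ^ (2 * a - 1) * (\<Prod>i\<in>B. (X l)\<^sup>2 - (X i)\<^sup>2)) \<in> covs n"
  using assms
proof (induction B arbitrary: a rule: finite_induct[consumes 1])
  case empty
  then show ?case using covs.pv[of a n] by (simp add: pv_def)
next
  case (insert b B)
  let ?P = "\<lambda>l. \<Prod>i\<in>B. (X l)\<^sup>2 - (X i)\<^sup>2"
  have "(\<lambda>l. X l ^ (2 * (a + 1) - 1) * ?P l) \<in> covs n"
    by (rule insert.IH) (use insert.prems insert.hyps in simp_all)
  moreover have "(\<lambda>l. X l ^ (2 * a - 1) * ?P l) \<in> covs n"
    by (rule insert.IH) (use insert.prems insert.hyps in simp_all)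
  ultimately have "(\<lambda>l. X l ^ (2 * (a + 1) - 1) * ?P l + (- (X b)\<^sup>2) * (X l ^ (2 * a - 1) * ?P l)) \<in> covs n"
    by (intro covs.add covs.scale)
  moreover define k where "k = 2 * a - 1"
  moreover have "2 * (a + 1) - 1 = k + 2" using insert.prems by (simp add: k_def)
  ultimately have "(\<lambda>l. X l ^ (k + 2) * ?P l + (- (X b)\<^sup>2) * (X l ^ k * ?P l)) \<in> covs n" by simp
  moreover have "(\<lambda>l. X l ^ k * (\<Prod>i\<in>insert b B. (X l)\<^sup>2 - (X i)\<^sup>2))
      = (\<lambda>l. X l ^ (k + 2) * ?P l + (- (X b)\<^sup>2) * (X l ^ k * ?P l))"
    using insert.hyps by (simp only: prod.insert power_add) (simp add: algebra_simps)
  ultimately show ?case unfolding k_def by simp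
qed

text \<open>Contraction is linear in the vector field, so each \<open>w\<close> is expanded into the
  \<open>pv r\<close>; the innermost one is treated first and joins \<open>xs\<close>. Scalars come
  out because \<open>I\<close> is an ideal.\<close>

lemma cons_covs_mem:
  assumes I: "ideal.subspace I"
    and base: "\<And>xs. set xs \<subseteq> {1..n} \<Longrightarrow> cons n (map pv xs) U {} \<in> I"
    and "set ws \<subseteq> covs n" "set xs \<subseteq> {1..n}"
  shows "cons n (ws @ map pv xs) U {} \<in> I"
  using assms(3,4)
proof (induction ws arbitrary: xs rule: rev_induct)
  case Nil
  then show ?case using base by simp
next
  case (snoc w ws)
  have ws: "set ws \<subseteq> covs n" and xs: "set xs \<subseteq> {1..n}" using snoc.prems by auto
  have "w \<in> covs n" using snoc.prems by simp
  then have "cons n ws (con n w (cons n (map pv xs) U)) {} \<in> I"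
  proof induction
    case (pv r)
    then show ?case using snoc.IH[OF ws, of "r # xs"] xs by simp
  next
    case (scale v c)
    then show ?case by (simp add: con_scale_v cons_scale ideal.subspace_scale[OF I])
  next
    case (add v w)
    then show ?case by (simp add: con_add_v cons_add ideal.subspace_add[OF I])
  qed
  then show ?case by simp
qed

text \<open>The vector field that vanishes at all \<open>l > j\<close> up to \<open>n\<close> and
  has component \<open>phi n j\<close> at \<open>j\<close>; it makes the elimination
  triangular.\<close>

definition wj :: "nat \<Rightarrow> nat \<Rightarrow> nat \<Rightarrow> mpol" where
  "wj n j = (\<lambda>l. X l * (\<Prod>i\<in>{j<..n}. (X l)\<^sup>2 - (X i)\<^sup>2))"

lemma wj_zero: "j < l \<Longrightarrow> l \<le> n \<Longrightarrow> wj n j l = 0"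
proof -
  assume l: "j < l" "l \<le> n"
  then have "(\<Prod>i\<in>{j<..n}. (X l)\<^sup>2 - (X i)\<^sup>2) = 0"
    by (intro prod_zero) auto
  then show ?thesis by (simp add: wj_def)
qed

lemma wj_covs: "j \<in> {1..n} \<Longrightarrow> wj n j \<in> covs n"
  using covs_prod[of "{j<..n}" 1 n] by (auto simp: wj_def)

lemma wj_diag: "wj n j j = phi n j"
  by (simp add: wj_def phi_def)

text \<open>The contraction with \<open>wj n j\<close> replaces a \<open>\<theta>\<^sub>l\<close> with \<open>l \<le> j\<close>, so contracting with all
  \<open>j \<in> js\<close> only sees components \<open>T\<close> with \<open>\<Sum>T \<le> \<Sum>js\<close>, with equality only for \<open>T = js\<close>.\<close>
lemma cons_wj_vanish:
  assumes "\<And>L. \<Sum>L < s \<Longrightarrow> U L = 0"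
  shows "finite T \<Longrightarrow> \<Sum>T + sum_list js < s \<Longrightarrow> cons n (map (wj n) js) U T = 0"
proof (induction js arbitrary: T)
  case Nil
  then show ?case using assms by simp
next
  case (Cons j js)
  have "wj n j i * econ i (cons n (map (wj n) js) U) T = 0" if i: "i \<in> {1..n}" for i
  proof (cases "i \<in> T \<or> j < i")
    case True
    then show ?thesis using i by (auto simp: econ_def wj_zero)
  next
    case False
    then have "cons n (map (wj n) js) U (insert i T) = 0"
      using Cons.prems by (intro Cons.IH) auto
    then show ?thesis by (simp add: econ_def)
  qed
  then have "con n (wj n j) (cons n (map (wj n) js) U) T = 0"
    unfolding con_def[of n "wj n j" "cons n (map (wj n) js) U"] by (intro sum.neutral ballI)
  then show ?case by simp
qed

lemma cons_wj_leading:
  assumes U: "\<And>L. \<Sum>L < s \<Longrightarrow> U L = 0"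
  shows "finite T \<Longrightarrow> \<Sum>T + sum_list js = s \<Longrightarrow> distinct js \<Longrightarrow> T \<inter> set js = {} \<Longrightarrow> set js \<subseteq> {1..n} \<Longrightarrow>
    \<exists>c. c * c = 1 \<and> cons n (map (wj n) js) U T = c * (prod (phi n) (set js) * U (T \<union> set js))"
proof (induction js arbitrary: T)
  case Nil
  show ?case by (intro exI[of _ 1]) simp
next
  case (Cons j js)
  let ?C = "cons n (map (wj n) js) U"
  have jT: "j \<notin> T" and j: "j \<in> {1..n}" using Cons.prems by auto
  obtain c where c: "c * c = 1" "?C (insert j T) = c * (prod (phi n) (set js) * U (insert j T \<union> set js))"
    using Cons.IH[of "insert j T"] Cons.prems jT by auto
  have "wj n j i * econ i ?C T = 0" if i: "i \<in> {1..n}" "i \<noteq> j" for i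
  proof (cases "i \<in> T \<or> j < i")
    case True
    then show ?thesis using i by (auto simp: econ_def wj_zero)
  next
    case False
    \<comment> \<open>An index \<open>i < j\<close> in place of \<open>j\<close> lowers the total
      below \<open>s\<close>, so \<open>cons_wj_vanish\<close> applies.\<close>
    then have "\<Sum>(insert i T) + sum_list js < s" using Cons.prems i by auto
    then have "?C (insert i T) = 0"
      using Cons.prems by (intro cons_wj_vanish[OF U, where s = s]) auto
    then show ?thesis by (simp add: econ_def)
  qed
  then have "con n (wj n j) ?C T = wj n j j * econ j ?C T"
    unfolding con_def[of n "wj n j" ?C] using j by (subst sum.remove[of _ j]) (auto intro!: sum.neutral)
  also have "\<dots> = (sgp j T * c) * (prod (phi n) (set (j # js)) * U (T \<union> set (j # js)))"
    using jT Cons.prems by (simp add: econ_def c wj_diag mult_ac)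
  finally have "cons n (map (wj n) (j # js)) U T = (sgp j T * c) * (prod (phi n) (set (j # js)) * U (T \<union> set (j # js)))"
    by simp
  moreover have "(sgp j T * c) * (sgp j T * c) = 1"
    using c(1) by (metis mult.assoc mult.left_commute mult_1_right sgp_sq(1))
  ultimately show ?case by blast
qed

subsection \<open>The equations cut out by the generators\<close>

text \<open>The space \<open>H\<close> of the overview, cut out by the operators of
  \<open>p\<^sub>2\<^sub>r\<close> and \<open>\<omega>\<^sub>r\<close> for \<open>r\<close> up to
  \<open>n\<close>.\<close>

definition pharm :: "nat \<Rightarrow> om set" where
  "pharm n = {g \<in> Omega n. \<forall>r\<in>{1..n}. (\<Sum>i=1..n. (dx i ^^ (2 * r)) g) = 0 \<and>
    (\<Sum>i=1..n. dth i ((dx i ^^ (2 * r - 1)) g)) = 0}"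

definition perp :: "nat \<Rightarrow> coefs set" where
  "perp n = {U. \<forall>g\<in>pharm n. pair n U g = 0}"

lemma mulx_pow_const: "0 < k \<Longrightarrow> (mulx i ^^ k) f (\<lambda>_. 0, S) = 0"
  by (cases k) (simp_all add: mulx_apply)

lemma invariant_sum:
  assumes f: "\<And>i. i \<in> {1..n} \<Longrightarrow> f i \<in> Omega n"
    and inv: "\<And>i \<pi>. i \<in> {1..n} \<Longrightarrow> signed_perm n \<pi> \<Longrightarrow> act n \<pi> (f i) = f (pidx \<pi> i)"
    and const: "\<And>i. i \<in> {1..n} \<Longrightarrow> f i (\<lambda>_. 0, {}) = 0"
  shows "(\<Sum>i=1..n. f i) \<in> invariants0 n"
proof -
  have "act n \<pi> (\<Sum>i=1..n. f i) = (\<Sum>i=1..n. f i)" if \<pi>: "signed_perm n \<pi>" for \<pi>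
  proof -
    have "act n \<pi> (\<Sum>i=1..n. f i) = (\<Sum>i=1..n. f (pidx \<pi> i))"
      by (subst act_sum) (use f inv[OF _ \<pi>] in auto)
    also have "\<dots> = (\<Sum>i=1..n. f i)"
      by (rule sum.reindex_bij_betw[OF signed_perm_pidx(5)[OF \<pi>]])
    finally show ?thesis .
  qed
  moreover have "(\<Sum>i=1..n. f i) (\<lambda>_. 0, {}) = 0"
    unfolding sum_fun_apply by (rule sum.neutral) (use const in auto)
  moreover have "(\<Sum>i=1..n. f i) \<in> Omega n" by (rule Omega_sum[OF f])
  ultimately show ?thesis by (simp add: invariants0_def)
qed

lemma sgnc_power_even:
  assumes "signed_perm n \<pi>" "i \<in> {1..n}" shows "sgnc (\<pi> (int i)) ^ (2 * r) = 1"
  using signed_perm_pidx(2)[OF assms] by (simp add: power_mult power2_eq_square)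

text \<open>The two families are invariants without constant term: in each summand the index occurs
  with even total degree, so its sign cancels.\<close>

lemma SH_subset_pharm: "SH n \<subseteq> pharm n"
proof
  fix g assume g: "g \<in> SH n"
  then have gO: "g \<in> Omega n" and SI: "\<And>f. f \<in> invariants0 n \<Longrightarrow> odot n f g = 0"
    by (auto simp: SH_def SI_def om_zero_eq intro: gen_ideal.gen)
  have "(\<Sum>i=1..n. (dx i ^^ (2 * r)) g) = 0 \<and> (\<Sum>i=1..n. dth i ((dx i ^^ (2 * r - 1)) g)) = 0"
    if r: "r \<in> {1..n}" for r
  proof
    have 1: "(\<Sum>i=1..n. (mulx i ^^ (2 * r)) om_one) \<in> invariants0 n"
    proof (rule invariant_sum)
      show "act n \<pi> ((mulx i ^^ (2 * r)) om_one) = (mulx (pidx \<pi> i) ^^ (2 * r)) om_one"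
        if "i \<in> {1..n}" "signed_perm n \<pi>" for i \<pi>
        using that by (simp add: act_mulx_pow sgnc_power_even act_simps(1))
    qed (use r in \<open>auto simp: mulx_pow_const intro: Omega_mulx_pow\<close>)
    have "(\<Sum>i=1..n. (dx i ^^ (2 * r)) g) = odot n (\<Sum>i=1..n. (mulx i ^^ (2 * r)) om_one) g"
      by (subst odot_sum) (auto simp: odot_mulx_pow odot_simps intro: Omega_mulx_pow)
    then show "(\<Sum>i=1..n. (dx i ^^ (2 * r)) g) = 0" using SI[OF 1] by simp
  next
    have k: "0 < 2 * r - 1" and k2: "Suc (2 * r - 1) = 2 * r" using r by auto
    have 1: "(\<Sum>i=1..n. (mulx i ^^ (2 * r - 1)) (multh i om_one)) \<in> invariants0 n"
    proof (rule invariant_sum)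
      show "act n \<pi> ((mulx i ^^ (2 * r - 1)) (multh i om_one)) = (mulx (pidx \<pi> i) ^^ (2 * r - 1)) (multh (pidx \<pi> i) om_one)"
        if i: "i \<in> {1..n}" and \<pi>: "signed_perm n \<pi>" for i \<pi>
      proof -
        let ?s = "sgnc (\<pi> (int i))"
        have "act n \<pi> ((mulx i ^^ (2 * r - 1)) (multh i om_one))
            = om_smult (?s ^ (2 * r - 1) * ?s) ((mulx (pidx \<pi> i) ^^ (2 * r - 1)) (multh (pidx \<pi> i) om_one))"
          by (simp only: act_mulx_pow[OF Omega_multh[OF om_one_Omega i] i] act_simps(5)[OF om_one_Omega i] act_simps(1)
              lin_smult[OF lin_funpow[OF lin_ops(1)]] om.scale_scale)
        also have "?s ^ (2 * r - 1) * ?s = 1"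
          unfolding power_Suc2[symmetric] k2 by (rule sgnc_power_even[OF \<pi> i])
        finally show ?thesis by simp
      qed
    qed (use k in \<open>auto simp: mulx_pow_const Omega_mulx_pow Omega_multh\<close>)
    have "(\<Sum>i=1..n. dth i ((dx i ^^ (2 * r - 1)) g))
        = odot n (\<Sum>i=1..n. (mulx i ^^ (2 * r - 1)) (multh i om_one)) g"
    proof -
      have "dth i ((dx i ^^ k) g) = (dx i ^^ k) (dth i g)" for i k
        by (induction k) (simp_all add: dx_dth[symmetric])
      then show ?thesis
        by (subst odot_sum) (auto simp: odot_mulx_pow odot_simps Omega_multh Omega_mulx_pow)
    qed
    then show "(\<Sum>i=1..n. dth i ((dx i ^^ (2 * r - 1)) g)) = 0" using SI[OF 1] by simp
  qed
  then show "g \<in> pharm n" using gO by (auto simp: pharm_def)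
qed

lemma pharm_Omega: "g \<in> pharm n \<Longrightarrow> g \<in> Omega n"
  by (simp add: pharm_def)

lemma perpD: "U \<in> perp n \<Longrightarrow> g \<in> pharm n \<Longrightarrow> pair n U g = 0"
  by (simp add: perp_def)

lemma perp_zero: "(\<lambda>T. 0) \<in> perp n"
  by (simp add: perp_def)

lemma perp_add: "U \<in> perp n \<Longrightarrow> V \<in> perp n \<Longrightarrow> (\<lambda>T. U T + V T) \<in> perp n"
  by (simp add: perp_def pair_add_left)

lemma perp_sum: "(\<And>x. x \<in> F \<Longrightarrow> U x \<in> perp n) \<Longrightarrow> (\<lambda>T. \<Sum>x\<in>F. U x T) \<in> perp n"
  by (simp add: perp_def pair_sum_left)

lemma perp_X_outside: "a \<notin> {1..n} \<Longrightarrow> (\<lambda>T. X a * U T) \<in> perp n"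
  by (auto simp: perp_def intro: pair_X_outside pharm_Omega)

lemma perp_psum: "r \<in> {1..n} \<Longrightarrow> (\<lambda>T. psum n r * U T) \<in> perp n"
  unfolding perp_def using pair_psum[OF pharm_Omega] by (auto simp: pharm_def)

lemma perp_wed: "v \<in> covs n \<Longrightarrow> wed n v U \<in> perp n"
proof (induction arbitrary: U rule: covs.induct)
  case (pv r)
  then show ?case unfolding perp_def using pair_wed[OF pharm_Omega] by (auto simp: pharm_def)
qed (auto simp: wed_scale_v wed_add_v intro: perp_add)

lemma pair_single_general:
  assumes g: "g \<in> Omega n"
  shows "pair n (\<lambda>T. single a 1 * U T) g
    = (if \<forall>i. i \<notin> {1..n} \<longrightarrow> a i = 0 then pair n U (odot n (basis (a, {})) g) else 0)"
proof (cases "\<forall>i. i \<notin> {1..n} \<longrightarrow> a i = 0")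
  case True
  show ?thesis unfolding pair_single[OF g True] by (rule if_P[OF True, symmetric])
next
  case False
  then obtain i where i: "i \<notin> {1..n}" "0 < a i" by auto
  have "(\<lambda>_. 0)(i := 1) + a(i := a i - 1) = a" using i by (auto simp: fun_eq_iff fun_op_apply)
  then have "single a 1 = X i * single (a(i := a i - 1)) 1" by (simp add: X_def mult_single)
  then have "pair n (\<lambda>T. single a 1 * U T) g = 0"
    using pair_X_outside[OF g i(1), of "\<lambda>T. single (a(i := a i - 1)) 1 * U T"] by (simp only: mult.assoc)
  then show ?thesis using False by (simp only: if_False)
qed

lemma pair_const: "pair n (\<lambda>T. single 0 c * U T) g = c * pair n U g"
proof -
  have "lookup (single 0 c * p) a = c * lookup p a" for p :: mpol and a
  proof (induction p rule: mpol_induct)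
    case (single b d)
    then show ?case by (simp add: mult_single lookup_single when_def)
  qed (simp add: distrib_left lookup_add)
  then show ?thesis by (simp add: pair_def sum_distrib_left mult.assoc)
qed

lemma pair_poly:
  assumes "g \<in> Omega n"
    and "\<And>a. \<forall>i. i \<notin> {1..n} \<longrightarrow> a i = 0 \<Longrightarrow> pair n U (odot n (basis (a, {})) g) = 0"
  shows "pair n (\<lambda>T. p * U T) g = 0"
proof (induction p rule: mpol_induct)
  case (single a c)
  have "single a c = single 0 c * single a 1" by (simp add: mult_single)
  then have "pair n (\<lambda>T. single a c * U T) g = c * pair n (\<lambda>T. single a 1 * U T) g"
    by (simp only: mult.assoc pair_const)
  also have "\<dots> = 0" using assms(2)[of a] by (simp add: pair_single_general[OF assms(1)])
  finally show ?case .
qed (simp add: distrib_right pair_add_left)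

lemma invharm_subset_pharm: "invharm n \<subseteq> pharm n"
  using invharm_subset_SH SH_subset_pharm by blast

text \<open>Under the pairing \<open>p\<close> becomes a differential operator on \<open>g\<close>,
  and \<open>invharm n\<close> is stable under these.\<close>

lemma perp_scale_invharm:
  assumes U: "U \<in> perp n" and g: "g \<in> invharm n"
  shows "pair n (\<lambda>T. p * U T) g = 0"
proof (rule pair_poly)
  show "g \<in> Omega n" using g by (rule invharmD)
  fix a :: "nat \<Rightarrow> nat" assume "\<forall>i. i \<notin> {1..n} \<longrightarrow> a i = 0"
  then have "basis (a, {}) \<in> Omega n" by (simp add: basis_Omega_iff)
  then have "odot n (basis (a, {})) g \<in> pharm n" using g invharm_odot invharm_subset_pharm by blast
  then show "pair n U (odot n (basis (a, {})) g) = 0" by (rule perpD[OF U])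
qed

subsection \<open>The annihilator of \<open>\<delta>\<^sup>B\<^sub>n\<close>\<close>

text \<open>Quantifying over the multiples \<open>p * q\<close> expresses that \<open>q\<close>, as
  a differential operator, kills delta, and makes the ideal property immediate.\<close>

definition annd :: "nat \<Rightarrow> mpol set" where
  "annd n = {q. \<forall>p. pair n (\<lambda>T. if T = {} then p * q else 0) (deltaB n) = 0}"

lemma subspace_annd: "ideal.subspace (annd n)"
proof (rule ideal.subspaceI)
  have "(\<lambda>T::nat set. if T = {} then p * 0 else 0) = (\<lambda>T. 0 :: mpol)" for p by auto
  then show "0 \<in> annd n" by (simp only: annd_def pair_zero_left) simp
next
  fix x y assume xy: "x \<in> annd n" "y \<in> annd n"
  have "(\<lambda>T::nat set. if T = {} then p * (x + y) else 0)
      = (\<lambda>T. (if T = {} then p * x else 0) + (if T = {} then p * y else 0))" for p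
    by (auto simp: distrib_left)
  then show "x + y \<in> annd n" using xy by (simp add: annd_def pair_add_left)
next
  fix c x assume "x \<in> annd n"
  then have "pair n (\<lambda>T. if T = {} then (p * c) * x else 0) (deltaB n) = 0" for p
    by (simp only: annd_def mem_Collect_eq)
  then show "c * x \<in> annd n" unfolding annd_def mem_Collect_eq mult.assoc by blast
qed

lemma xgens_annd: "xgens n {1..n} n \<subseteq> annd n"
proof
  fix q assume "q \<in> xgens n {1..n} n"
  then consider a where "a \<notin> {1..n}" "q = X a" | r where "r \<in> {1..n}" "q = psum n r"
    by (auto simp: xgens_def)
  then have *: "(\<lambda>T. q * W T) \<in> perp n" for W
    by cases (auto intro: perp_X_outside perp_psum)
  have eq: "(\<lambda>T::nat set. if T = {} then p * q else 0) = (\<lambda>T. q * (if T = {} then p else 0))" for p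
    by (auto simp: mult.commute)
  have "deltaB n \<in> pharm n" using deltaB_invharm invharm_subset_pharm by blast
  then show "q \<in> annd n" unfolding annd_def mem_Collect_eq eq by (intro allI perpD[OF *])
qed

text \<open>Delta pairs with itself to a sum of positively weighted squares of its real
  coefficients, not all zero.\<close>

lemma vdm_not_annd: "vdm n \<notin> annd n"
proof
  assume "vdm n \<in> annd n"
  then have "pair n (\<lambda>T. if T = {} then 1 * vdm n else 0) (deltaB n) = 0"
    unfolding annd_def by blast
  moreover have "supp (deltaB n) \<subseteq> (\<lambda>a. (a, {})) ` keys (vdm n)"
    by (auto simp: supp_def deltaB_emb(1) emb_def in_keys_iff split: if_splits)
  ultimately have "0 = (\<Sum>m\<in>(\<lambda>a. (a, {})) ` keys (vdm n).
      lookup (if snd m = {} then 1 * vdm n else 0) (fst m) * of_real (wt n (fst m)) * deltaB n m)"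
    using pair_superset[of "(\<lambda>a. (a, {})) ` keys (vdm n)" "deltaB n" n "\<lambda>T. if T = {} then 1 * vdm n else 0"] by simp
  also have "\<dots> = (\<Sum>a\<in>keys (vdm n). lookup (vdm n) a * of_real (wt n a) * lookup (vdm n) a)"
    by (subst sum.reindex) (auto simp: inj_on_def deltaB_emb(1) emb_apply)
  also have "\<dots> = of_real (\<Sum>a\<in>keys (vdm n). wt n a * (Re (lookup (vdm n) a))\<^sup>2)"
  proof -
    have "lookup (vdm n) a = of_real (Re (lookup (vdm n) a))" for a
      using vdm_real[of n a] by (simp add: of_real_Re)
    then have "lookup (vdm n) a * of_real (wt n a) * lookup (vdm n) a
        = of_real (wt n a * (Re (lookup (vdm n) a))\<^sup>2)" for a
      by (metis (no_types, lifting) mult.assoc mult.commute of_real_mult power2_eq_square)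
    then show ?thesis unfolding of_real_sum by (intro sum.cong refl)
  qed
  finally have "(\<Sum>a\<in>keys (vdm n). wt n a * (Re (lookup (vdm n) a))\<^sup>2) = 0" using of_real_eq_0_iff by metis
  moreover have "0 < (\<Sum>a\<in>keys (vdm n). wt n a * (Re (lookup (vdm n) a))\<^sup>2)"
  proof (rule sum_pos)
    have "vdm n \<noteq> 0" using vdm_not_coinv[of n] ideal.span_zero by metis
    then show "keys (vdm n) \<noteq> {}" by (simp add: keys_eq_empty)
    fix a assume "a \<in> keys (vdm n)"
    then have "lookup (vdm n) a \<noteq> 0" by (simp add: in_keys_iff)
    then have "Re (lookup (vdm n) a) \<noteq> 0" using vdm_real[of n a] by (metis of_real_0 of_real_Re)
    then show "0 < wt n a * (Re (lookup (vdm n) a))\<^sup>2" by (simp add: wt_pos)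
  qed simp
  ultimately show False by simp
qed

lemma annd_coinv: "annd n \<subseteq> coinv n"
  by (rule coinv_maximal[OF subspace_annd xgens_annd vdm_not_annd[unfolded vdm_def]])

text \<open>The orthogonal complement of the right-hand side of the theorem: multiplying
  \<open>U\<close> by \<open>p\<close> amounts to applying \<open>p\<close> as a differential
  operator on the other side.\<close>

definition dperp :: "nat \<Rightarrow> coefs set" where
  "dperp n = {U. \<forall>p I. I \<subseteq> {1..n} \<longrightarrow> pair n (\<lambda>T. p * U T) (dI n I (deltaB n)) = 0}"

lemma perp_dperp: "U \<in> perp n \<Longrightarrow> U \<in> dperp n"
  using perp_scale_invharm dI_invharm by (simp add: dperp_def)

lemma dperp_diff: "U \<in> dperp n \<Longrightarrow> W \<in> dperp n \<Longrightarrow> (\<lambda>T. U T - W T) \<in> dperp n"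
  by (simp add: dperp_def right_diff_distrib pair_diff_left)

text \<open>Passing to adjoints reverses the order of composition.\<close>

lemma pair_dpr_list:
  "set xs \<subseteq> {1..n} \<Longrightarrow> pair n U (foldr (\<lambda>i. dpr n (2 * i - 1)) xs (deltaB n))
    = pair n (cons n (map pv (rev xs)) U) (deltaB n)"
proof (induction xs arbitrary: U)
  case (Cons r xs)
  let ?w = "foldr (\<lambda>i. dpr n (2 * i - 1)) xs (deltaB n)"
  have "?w \<in> Omega n" using Cons.prems by (intro invharmD(1) dpr_list_invharm) auto
  then have "pair n U (dpr n (2 * r - 1) ?w) = pair n (con n (pv r) U) ?w" by (simp only: pair_con)
  then show ?case using Cons by simp
qed simp

lemma pair_deltaB: "pair n U (deltaB n) = pair n (\<lambda>T. if T = {} then U {} else 0) (deltaB n)"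
  unfolding pair_def
  by (rule sum.cong) (auto simp: supp_def deltaB_emb(1) emb_def split: if_splits)

text \<open>The \<open>dI\<close> supply only increasing lists without repetition; contractions
  alternate, so any other list gives zero or differs by a sign.\<close>

lemma dperp_cons:
  assumes U: "U \<in> dperp n" and xs: "set xs \<subseteq> {1..n}"
  shows "cons n (map pv xs) U {} \<in> annd n"
proof (cases "distinct xs")
  case False
  then show ?thesis
    using ideal.subspace_0[OF subspace_annd] by (simp add: cons_not_distinct)
next
  case True
  let ?L = "sort xs"
  have L: "sorted_list_of_set (set xs) = ?L" using True by (simp add: sorted_list_of_set_sort_remdups distinct_remdups_id)
  have rev: "cons n (map pv (rev ?L)) U {} \<in> annd n"
    unfolding annd_def
  proof (intro CollectI allI)
    fix p
    obtain c where c: "c \<noteq> 0" "dI n (set xs) (deltaB n) = om_smult c (foldr (\<lambda>i. dpr n (2 * i - 1)) ?L (deltaB n))"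
      using dI_eq[OF deltaB_emb(2) par_deltaB, of n "set xs"] unfolding L by blast
    have wO: "foldr (\<lambda>i. dpr n (2 * i - 1)) ?L (deltaB n) \<in> Omega n"
      using xs by (intro invharmD(1) dpr_list_invharm) auto
    have "0 = pair n (\<lambda>T. p * U T) (dI n (set xs) (deltaB n))"
      using U xs by (simp add: dperp_def)
    also have "\<dots> = c * pair n (\<lambda>T. p * U T) (foldr (\<lambda>i. dpr n (2 * i - 1)) ?L (deltaB n))"
      unfolding c(2) by (rule pair_smult_right[OF wO])
    finally have "pair n (\<lambda>T. p * U T) (foldr (\<lambda>i. dpr n (2 * i - 1)) ?L (deltaB n)) = 0"
      using c(1) by simp
    then have "pair n (cons n (map pv (rev ?L)) (\<lambda>T. p * U T)) (deltaB n) = 0"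
      using xs by (subst (asm) pair_dpr_list) auto
    then have "pair n (\<lambda>T. p * cons n (map pv (rev ?L)) U T) (deltaB n) = 0"
      unfolding cons_scale .
    then show "pair n (\<lambda>T. if T = {} then p * cons n (map pv (rev ?L)) U {} else 0) (deltaB n) = 0"
      by (subst (asm) pair_deltaB) simp
  qed
  have "sort (rev (sort xs)) = sort xs" by (rule sym) (rule properties_for_sort, simp_all)
  then obtain c where c: "c * c = 1" "cons n (map pv (rev ?L)) U = (\<lambda>T. c * cons n (map pv ?L) U T)"
    using cons_sort[of n pv "rev ?L" U] by auto
  obtain d where d: "cons n (map pv xs) U = (\<lambda>T. d * cons n (map pv ?L) U T)"
    using cons_sort[of n pv xs U] by blast
  have "(d * c) * cons n (map pv (rev ?L)) U {} \<in> annd n"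
    by (rule ideal.subspace_scale[OF subspace_annd rev])
  moreover have "(d * c) * cons n (map pv (rev ?L)) U {} = d * ((c * c) * cons n (map pv ?L) U {})"
    unfolding c(2) by (simp only: mult.assoc)
  ultimately show ?thesis unfolding d c(1) by simp
qed

subsection \<open>Elimination of leading terms\<close>

text \<open>An element of \<open>perp n\<close> with leading coefficient \<open>g\<close> at
  \<open>J\<close>, sets being ordered by their element sum.\<close>

definition lifts :: "nat \<Rightarrow> nat set \<Rightarrow> mpol \<Rightarrow> coefs \<Rightarrow> bool" where
  "lifts n J g U \<longleftrightarrow> U \<in> perp n \<and> U J = g \<and> (\<forall>T. T \<noteq> J \<and> U T \<noteq> 0 \<longrightarrow> T \<subseteq> {1..n} \<and> \<Sum>J < \<Sum>T)"

lemma lifts_monomial: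
  assumes "\<And>W. (\<lambda>T. x * W T) \<in> perp n"
  shows "\<exists>U. lifts n J (c * x) U"
proof -
  have "lifts n J (c * x) (\<lambda>T. x * (if T = J then c else 0))"
    using assms[of "\<lambda>T. if T = J then c else 0"] by (auto simp: lifts_def mult.commute)
  then show ?thesis by blast
qed

text \<open>Multiplying \<open>\<theta>\<^bsub>J - {j}\<^esub>\<close> by the one-form \<open>q\<close> that vanishes at the \<open>l < j\<close> outside \<open>J\<close>
  leaves \<open>\<theta>\<^sub>J\<close> and terms in which \<open>j\<close> is replaced by something larger.\<close>
lemma lifts_pfac:
  assumes J: "J \<subseteq> {1..n}" and j: "j \<in> J"
  shows "\<exists>U. lifts n J (c * pfac J j) U"
proof -
  have fin: "finite J" using J finite_subset by blast
  have jn: "j \<in> {1..n}" using J j by auto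
  define q where "q = (\<lambda>l. X l ^ (2 * 1 - 1) * (\<Prod>i\<in>{1..<j} - J. (X l)\<^sup>2 - (X i)\<^sup>2))"
  have "card ({1..<j} - J) \<le> card {1..<j}" by (intro card_mono) auto
  then have "1 + card ({1..<j} - J) \<le> n" using jn by auto
  then have q: "q \<in> covs n" unfolding q_def by (intro covs_prod) auto
  \<comment> \<open>\<open>sgp j J\<close> compensates the sign of putting \<open>j\<close> back
    into \<open>J - {j}\<close>.\<close>
  define W where "W = (\<lambda>T. if T = J - {j} then sgp j J * c else 0)"
  have 1: "wed n q W J = c * pfac J j"
  proof -
    have "q i * emul i W J = 0" if "i \<in> {1..n}" "i \<noteq> j" for i
    proof (cases "i \<in> J")
      case True
      then have "J - {i} \<noteq> J - {j}" using that j by blast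
      then show ?thesis by (simp add: emul_def W_def)
    qed (simp add: emul_def)
    then have "wed n q W J = q j * emul j W J"
      unfolding wed_def using jn by (subst sum.remove[of _ j]) (auto intro!: sum.neutral)
    then show ?thesis using j by (simp add: emul_def W_def q_def pfac_def mult_ac)
  qed
  have 2: "T \<subseteq> {1..n} \<and> \<Sum>J < \<Sum>T" if T: "T \<noteq> J" "wed n q W T \<noteq> 0" for T
  proof -
    obtain i where i: "i \<in> {1..n}" "q i * emul i W T \<noteq> 0"
      by (rule sum.not_neutral_contains_not_neutral[OF T(2)[unfolded wed_def]])
    have qi: "q i \<noteq> 0"
    proof
      assume "q i = 0" then show False using i(2) by simp
    qed
    have iT: "i \<in> T"
    proof (rule ccontr)
      assume "i \<notin> T" then show False using i(2) by (simp add: emul_def)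
    qed
    have TJ: "T - {i} = J - {j}"
    proof (rule ccontr)
      assume "T - {i} \<noteq> J - {j}"
      then have "W (T - {i}) = 0" unfolding W_def by (rule if_not_P)
      then have "emul i W T = 0" unfolding emul_def by simp
      then show False using i(2) by simp
    qed
    have ij: "i \<noteq> j" using T(1) TJ iT j by blast
    then have iJ: "i \<notin> J" using TJ by blast
    have "i \<notin> {1..<j} - J"
    proof
      assume "i \<in> {1..<j} - J"
      then have "(\<Prod>k\<in>{1..<j} - J. (X i)\<^sup>2 - (X k)\<^sup>2) = 0" by (intro prod_zero) auto
      then show False using qi by (simp add: q_def)
    qed
    then have "j < i" using i(1) iJ ij by auto
    have T': "T = insert i (J - {j})" using TJ iT by blast
    then have "\<Sum>T = i + \<Sum>(J - {j})" using fin iJ by simp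
    moreover have "\<Sum>J = j + \<Sum>(J - {j})" using fin j by (simp add: sum.remove)
    moreover have "T \<subseteq> {1..n}" unfolding T' using J i(1) by auto
    ultimately show ?thesis using \<open>j < i\<close> by linarith
  qed
  have "lifts n J (c * pfac J j) (wed n q W)"
    unfolding lifts_def using perp_wed[OF q] 1 2 by blast
  then show ?thesis by blast
qed

text \<open>Lifts add up, so multiples of the generators suffice. Outer variables and power sums
  send every coefficient family into \<open>perp n\<close>; \<open>pfac\<close> is covered by
  \<open>lifts_pfac\<close>.\<close>

lemma lifts_jgens:
  assumes J: "J \<subseteq> {1..n}" and m: "m \<le> n" and g: "g \<in> ideal.span (jgens n J m)"
  shows "\<exists>U. lifts n J g U"
  using g
proof (induction rule: ideal.span_induct_alt)
  case base
  have "lifts n J 0 (\<lambda>T. 0)" by (simp add: lifts_def perp_zero)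
  then show ?case by blast
next
  case (step c x y)
  then obtain V where V: "lifts n J y V" by blast
  consider a where "a \<notin> {1..n}" "x = X a" | j where "j \<in> J" "x = pfac J j" | r where "r \<in> {1..n}" "x = psum n r"
  proof -
    have "{1..m} \<subseteq> {1..n}" using m by auto
    then have "x \<in> X ` (- {1..n}) \<or> x \<in> pfac J ` J \<or> x \<in> psum n ` {1..n}"
      using step(1) unfolding jgens_def by blast
    then show thesis using that by blast
  qed
  then obtain U where U: "lifts n J (c * x) U"
  proof cases
    case 1
    then show ?thesis using lifts_monomial[of x n J c] perp_X_outside that by blast
  next
    case 2
    then show ?thesis using lifts_pfac[OF J] that by blast
  next
    case 3
    then show ?thesis using lifts_monomial[of x n J c] perp_psum that by blast
  qed
  have 1: "T \<subseteq> {1..n} \<and> \<Sum>J < \<Sum>T" if T: "T \<noteq> J" "U T + V T \<noteq> 0" for T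
  proof -
    have "U T \<noteq> 0 \<or> V T \<noteq> 0" using T(2) by auto
    then show ?thesis using T(1) U V unfolding lifts_def by blast
  qed
  have 2: "(\<lambda>T. U T + V T) \<in> perp n"
    by (rule perp_add) (use U V in \<open>simp_all only: lifts_def\<close>)
  have 3: "U J + V J = c * x + y" using U V by (simp only: lifts_def)
  have "lifts n J (c * x + y) (\<lambda>T. U T + V T)"
    unfolding lifts_def using 1 2 3 by (intro conjI allI impI) blast+
  then show ?case by blast
qed

text \<open>Contracting with \<open>wj n j\<close> for all \<open>j\<close> in \<open>J\<close>
  isolates, up to sign, \<open>U J\<close> times the product of the \<open>phi n j\<close>. This
  lies in \<open>annd n\<close>, hence in \<open>coinv n\<close>, so \<open>U J\<close> lies in the
  colon ideal, whose elements lift.\<close>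

lemma dperp_leading:
  assumes U: "U \<in> dperp n" and J: "J \<subseteq> {1..n}" and low: "\<And>L. \<Sum>L < \<Sum>J \<Longrightarrow> U L = 0"
  shows "\<exists>W. lifts n J (U J) W"
proof -
  have fin: "finite J" using J finite_subset by blast
  define js where "js = sorted_list_of_set J"
  have js: "set js = J" "distinct js" "sum_list js = \<Sum>J"
    using fin sum_list_distinct_conv_sum_set[of js "\<lambda>x. x"] by (auto simp: js_def)
  have "cons n (map (wj n) js @ map pv []) U {} \<in> annd n"
    by (rule cons_covs_mem[OF subspace_annd dperp_cons[OF U]]) (use J js wj_covs in auto)
  moreover obtain c where c: "c * c = 1" "cons n (map (wj n) js) U {} = c * (prod (phi n) J * U J)"
    using cons_wj_leading[of "\<Sum>J" U "{}" js n] low js J by auto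
  ultimately have "c * (prod (phi n) J * U J) \<in> annd n" by simp
  then have "c * (c * (prod (phi n) J * U J)) \<in> annd n" by (rule ideal.subspace_scale[OF subspace_annd])
  then have "prod (phi n) J * U J \<in> annd n" using c(1) by (simp flip: mult.assoc)
  then have "prod (phi n) J * U J \<in> coinv n" using annd_coinv by blast
  then have "U J \<in> ideal.span (jgens n J (n - card J))" by (rule coinv_colon[OF J])
  then show ?thesis by (intro lifts_jgens[OF J]) auto
qed

text \<open>All coefficients of element sum \<open>s\<close> are removed at once by subtracting
  lifts, which lie in \<open>perp n\<close> and so in \<open>dperp n\<close>; the element sums that
  occur are bounded by that of \<open>{1..n}\<close>.\<close>

lemma dperp_perp_aux:
  assumes "U \<in> dperp n" "\<And>T. U T \<noteq> 0 \<Longrightarrow> T \<subseteq> {1..n}" "\<And>T. \<Sum>T < s \<Longrightarrow> U T = 0"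
  shows "U \<in> perp n"
  using assms
proof (induction "Suc (\<Sum>{1..n}) - s" arbitrary: U s)
  case 0
  have "U T = 0" for T
  proof (rule ccontr)
    assume T: "U T \<noteq> 0"
    then have "T \<subseteq> {1..n}" by (rule 0)
    then have "\<Sum>T \<le> \<Sum>{1..n}" by (intro sum_mono2) auto
    then have "\<Sum>T < s" using 0(1) by simp
    then show False using T 0(4) by blast
  qed
  then have "U = (\<lambda>T. 0)" by auto
  then show ?case by (simp add: perp_zero)
next
  case (Suc k)
  define \<J> where "\<J> = {J \<in> Pow {1..n}. \<Sum>J = s}"
  have "\<forall>J\<in>\<J>. \<exists>W. lifts n J (U J) W"
    using dperp_leading[OF Suc.prems(1)] Suc.prems(3) by (auto simp: \<J>_def)
  then obtain W where W: "\<And>J. J \<in> \<J> \<Longrightarrow> lifts n J (U J) (W J)" by metis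
  define V where "V = (\<lambda>T. \<Sum>J\<in>\<J>. W J T)"
  have fin: "finite \<J>" by (simp add: \<J>_def)
  have V: "V \<in> perp n" unfolding V_def by (rule perp_sum) (use W in \<open>auto simp: lifts_def\<close>)
  have Vsupp: "T \<subseteq> {1..n} \<and> s \<le> \<Sum>T" if VT: "V T \<noteq> 0" for T
  proof -
    obtain J where J: "J \<in> \<J>" "W J T \<noteq> 0" 
      by (rule sum.not_neutral_contains_not_neutral[OF VT[unfolded V_def]])
    then show ?thesis using W[OF J(1)] by (cases "T = J") (auto simp: lifts_def \<J>_def)
  qed
  \<comment> \<open>The lift for another \<open>J\<close> vanishes at \<open>T\<close>, whose
    element sum is not larger.\<close>
  have Vlead: "V T = U T" if T: "T \<in> \<J>" for T
  proof -
    have "W J T = 0" if "J \<in> \<J>" "J \<noteq> T" for J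
      using W[OF that(1)] that T by (auto simp: lifts_def \<J>_def)
    then have "V T = W T T" unfolding V_def using fin T by (subst sum.remove[of _ T]) auto
    then show ?thesis using W[OF T] by (simp add: lifts_def)
  qed
  have "(\<lambda>T. U T - V T) \<in> perp n"
  proof (rule Suc.hyps(1)[of "Suc s"])
    show "k = Suc (\<Sum>{1..n}) - Suc s" using Suc.hyps(2) by simp
    show "(\<lambda>T. U T - V T) \<in> dperp n" by (intro dperp_diff Suc.prems perp_dperp V)
    show "T \<subseteq> {1..n}" if "U T - V T \<noteq> 0" for T
    proof -
      have "U T \<noteq> 0 \<or> V T \<noteq> 0" using that by auto
      then show ?thesis using Suc.prems(2) Vsupp by blast
    qed
    show "U T - V T = 0" if T: "\<Sum>T < Suc s" for T
    proof (cases "T \<in> \<J>")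
      case True
      then show ?thesis by (simp add: Vlead)
    next
      case False
      show ?thesis
      proof (cases "\<Sum>T < s")
        case True
        then have "U T = 0" "V T = 0" using Suc.prems(3) Vsupp[of T] by (auto simp: not_le)
        then show ?thesis by simp
      next
        case s: False
        then have "\<not> T \<subseteq> {1..n}" using T False by (auto simp: \<J>_def)
        then have "U T = 0" "V T = 0" using Suc.prems(2) Vsupp[of T] by blast+
        then show ?thesis by simp
      qed
    qed
  qed
  from perp_add[OF this V] show ?case by simp
qed

lemma dperp_perp:
  assumes "U \<in> dperp n" "\<And>T. U T \<noteq> 0 \<Longrightarrow> T \<subseteq> {1..n}"
  shows "U \<in> perp n"
  by (rule dperp_perp_aux[where s = 0, OF assms]) auto

subsection \<open>The span of the derivatives of \<open>\<delta>\<^sup>B\<^sub>n\<close>\<close>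

definition dspan :: "nat \<Rightarrow> om set" where
  "dspan n = {\<Sum>I\<in>Pow {1..n}. odot n (F I) (dI n I (deltaB n)) | F. \<forall>I. I \<subseteq> {1..n} \<longrightarrow> F I \<in> Poly n}"

lemma Poly_Omega: "f \<in> Poly n \<Longrightarrow> f \<in> Omega n"
  by (simp add: Poly_def)

lemma dspan_subset_invharm: "dspan n \<subseteq> invharm n"
  unfolding dspan_def by (auto intro!: invharm_sum invharm_odot dI_invharm Poly_Omega)

lemma Poly_add: "f \<in> Poly n \<Longrightarrow> g \<in> Poly n \<Longrightarrow> f + g \<in> Poly n"
  by (auto simp: Poly_def Omega_add fun_op_apply)

lemma Poly_smult: "f \<in> Poly n \<Longrightarrow> om_smult c f \<in> Poly n"
  by (auto simp: Poly_def Omega_smult om_smult_apply)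

lemma Poly_0: "0 \<in> Poly n"
  by (auto simp: Poly_def fun_op_apply)

lemma subspace_dspan: "om.subspace (dspan n)"
proof (rule om.subspaceI)
  show "0 \<in> dspan n"
    unfolding dspan_def by (auto intro!: exI[of _ "\<lambda>_. 0"] simp: Poly_0)
next
  fix v w assume "v \<in> dspan n" "w \<in> dspan n"
  then obtain F G where F: "\<And>I. I \<subseteq> {1..n} \<Longrightarrow> F I \<in> Poly n" "v = (\<Sum>I\<in>Pow {1..n}. odot n (F I) (dI n I (deltaB n)))"
    and G: "\<And>I. I \<subseteq> {1..n} \<Longrightarrow> G I \<in> Poly n" "w = (\<Sum>I\<in>Pow {1..n}. odot n (G I) (dI n I (deltaB n)))"
    by (auto simp: dspan_def)
  have "v + w = (\<Sum>I\<in>Pow {1..n}. odot n (F I + G I) (dI n I (deltaB n)))"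
    unfolding F(2) G(2) sum.distrib[symmetric]
    by (rule sum.cong) (use F(1) G(1) in \<open>auto simp: odot_simps(2) Poly_Omega\<close>)
  then show "v + w \<in> dspan n"
    unfolding dspan_def using F(1) G(1) by (auto intro!: exI[of _ "\<lambda>I. F I + G I"] Poly_add)
next
  fix c v assume "v \<in> dspan n"
  then obtain F where F: "\<And>I. I \<subseteq> {1..n} \<Longrightarrow> F I \<in> Poly n" "v = (\<Sum>I\<in>Pow {1..n}. odot n (F I) (dI n I (deltaB n)))"
    by (auto simp: dspan_def)
  have "om_smult c v = (\<Sum>I\<in>Pow {1..n}. odot n (om_smult c (F I)) (dI n I (deltaB n)))"
    unfolding F(2) om.scale_sum_right
    by (rule sum.cong) (use F(1) in \<open>auto simp: odot_simps(3) Poly_Omega\<close>)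
  then show "om_smult c v \<in> dspan n"
    unfolding dspan_def using F(1) by (auto intro!: exI[of _ "\<lambda>I. om_smult c (F I)"] Poly_smult)
qed

lemma odot_dI_dspan:
  assumes "f \<in> Poly n" "I \<subseteq> {1..n}" shows "odot n f (dI n I (deltaB n)) \<in> dspan n"
proof -
  define F where "F = (\<lambda>J. if J = I then f else 0)"
  have "(\<Sum>J\<in>Pow {1..n}. odot n (F J) (dI n J (deltaB n))) = odot n (F I) (dI n I (deltaB n))"
    by (subst sum.remove[of _ I]) (use assms(2) in \<open>auto simp: F_def intro!: sum.neutral\<close>)
  moreover have "\<forall>J. J \<subseteq> {1..n} \<longrightarrow> F J \<in> Poly n" using assms(1) Poly_0 by (simp add: F_def)
  ultimately show ?thesis unfolding dspan_def F_def by (auto intro!: exI[of _ F] simp: F_def)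
qed

text \<open>Delta has degree \<open>n^2\<close> and none of the operators raises the degree in the
  \<open>x_i\<close>. Hence \<open>dspan n\<close> involves finitely many monomials, so a functional
  on it can be represented by polynomial coefficients.\<close>

definition degbound :: "nat \<Rightarrow> om set" where
  "degbound n = {v \<in> Omega n. \<forall>a T. v (a, T) \<noteq> 0 \<longrightarrow> sum a {1..n} \<le> n\<^sup>2}"

lemma degbound_add: "v \<in> degbound n \<Longrightarrow> w \<in> degbound n \<Longrightarrow> v + w \<in> degbound n"
  by (auto simp: degbound_def Omega_add fun_op_apply) (metis add_0)

lemma degbound_smult: "v \<in> degbound n \<Longrightarrow> om_smult c v \<in> degbound n"
  by (auto simp: degbound_def Omega_smult om_smult_apply)

lemma degbound_0: "0 \<in> degbound n"
  by (auto simp: degbound_def fun_op_apply)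

lemma degbound_sum: "(\<And>x. x \<in> F \<Longrightarrow> f x \<in> degbound n) \<Longrightarrow> sum f F \<in> degbound n"
  by (induction F rule: infinite_finite_induct) (auto simp: degbound_0 degbound_add)

lemma degbound_dx: "v \<in> degbound n \<Longrightarrow> dx i v \<in> degbound n"
proof -
  assume v: "v \<in> degbound n"
  have "sum a {1..n} \<le> n\<^sup>2" if "dx i v (a, T) \<noteq> 0" for a T
  proof -
    have "v (a(i := a i + 1), T) \<noteq> 0" using that by (auto simp: dx_apply)
    then have "sum (a(i := a i + 1)) {1..n} \<le> n\<^sup>2" using v unfolding degbound_def by blast
    moreover have "sum a {1..n} \<le> sum (a(i := a i + 1)) {1..n}" by (rule sum_mono) simp
    ultimately show ?thesis by (rule order_trans[rotated])
  qed
  moreover have "dx i v \<in> Omega n" using v by (simp add: degbound_def Omega_dx)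
  ultimately show ?thesis unfolding degbound_def by blast
qed

lemma degbound_multh: "v \<in> degbound n \<Longrightarrow> i \<in> {1..n} \<Longrightarrow> multh i v \<in> degbound n"
  by (auto simp: degbound_def Omega_multh multh_apply split: if_splits)

lemma degbound_dth: "v \<in> degbound n \<Longrightarrow> dth i v \<in> degbound n"
  by (auto simp: degbound_def Omega_dth dth_apply split: if_splits)

lemma degbound_odot: "h \<in> Omega n \<Longrightarrow> v \<in> degbound n \<Longrightarrow> odot n h v \<in> degbound n"
  by (induction rule: Omega_gen_induct)
    (simp_all add: odot_simps degbound_add degbound_smult degbound_dx degbound_dth)

lemma degbound_dpr: "v \<in> degbound n \<Longrightarrow> dpr n j v \<in> degbound n"
proof -
  assume v: "v \<in> degbound n"
  have "(dx i ^^ k) v \<in> degbound n" for i k by (induction k) (simp_all add: v degbound_dx)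
  then show ?thesis unfolding dpr_def by (intro degbound_sum degbound_multh)
qed

lemma dspan_degbound: "dspan n \<subseteq> degbound n"
proof -
  have delta: "deltaB n \<in> degbound n"
    using vdm_degree[of n] deltaB_emb[of n] by (auto simp: degbound_def emb_apply split: if_splits)
  have "dI n I (deltaB n) \<in> degbound n" for I
  proof -
    have "foldr (\<lambda>i. dpr n (2 * i - 1)) xs (deltaB n) \<in> degbound n" for xs
      by (induction xs) (simp_all add: delta degbound_dpr)
    then show ?thesis using dI_eq[OF deltaB_emb(2) par_deltaB, of n I] degbound_smult by metis
  qed
  then show ?thesis
    unfolding dspan_def by (auto intro!: degbound_sum degbound_odot Poly_Omega)
qed

interpretation complex_functional: vector_space_pair om_smult "(*) :: complex \<Rightarrow> complex \<Rightarrow> complex"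
  by unfold_locales (simp_all add: algebra_simps)

text \<open>Extend a basis of \<open>V\<close> by \<open>g\<close> and prescribe 0 on the basis and
  1 at \<open>g\<close>.\<close>

lemma separating_functional:
  assumes V: "om.subspace V" and g: "g \<notin> V"
  obtains L where "\<And>f h. L (f + h) = L f + L h" "\<And>c f. L (om_smult c f) = c * L f"
    "\<And>v. v \<in> V \<Longrightarrow> L v = (0 :: complex)" "L g = 1"
proof -
  obtain B where B: "B \<subseteq> V" "om.independent B" "V \<subseteq> om.span B"
    using om.maximal_independent_subset[of V] by blast
  have BV: "om.span B \<subseteq> V" by (rule om.span_minimal[OF B(1) V])
  then have gB: "g \<notin> om.span B" using g by blast
  then have "om.independent (insert g B)" using B(2) by (simp add: om.independent_insert om.span_base)
  from complex_functional.linear_independent_extend[OF this, of "\<lambda>x. if x = g then 1 else 0"]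
  obtain L where L: "Vector_Spaces.linear om_smult (*) L"
    and LB: "\<forall>x\<in>insert g B. L x = (if x = g then 1 else (0 :: complex))" by blast
  interpret L: Vector_Spaces.linear om_smult "(*)" L by (rule L)
  have "L v = 0" if "v \<in> V" for v
  proof -
    have "v \<in> om.span B" using that B(3) by blast
    then show ?thesis
      by (rule complex_functional.linear_eq_0_on_span[OF L, rotated])
        (use LB gB om.span_base in auto)
  qed
  moreover have "L g = 1" using LB by simp
  ultimately show thesis using that L.add L.scale by blast
qed

text \<open>A functional that vanishes on \<open>dspan n\<close> but not at \<open>g\<close> is
  represented by some \<open>U\<close>. This \<open>U\<close> lies in \<open>dperp n\<close>, hence
  in \<open>perp n\<close>, and so pairs to zero with \<open>g\<close>, a contradiction.\<close>

lemma SH_subset_dspan: "SH n \<subseteq> dspan n"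
proof (rule ccontr)
  assume "\<not> SH n \<subseteq> dspan n"
  then obtain g where g: "g \<in> SH n" "g \<notin> dspan n" by blast
  obtain L where L: "\<And>f h. L (f + h) = L f + L h" "\<And>c f. L (om_smult c f) = c * L f"
    "\<And>v. v \<in> dspan n \<Longrightarrow> L v = (0 :: complex)" "L g = 1"
    using separating_functional[OF subspace_dspan g(2)] by blast
  have gO: "g \<in> Omega n" using g(1) by (simp add: SH_def)
  \<comment> \<open>A finite box containing all exponents allowed by \<open>degbound n\<close>;
    \<open>M\<close> adds the support of \<open>g\<close>.\<close>
  define E where "E = {a::nat\<Rightarrow>nat. \<forall>i. (i \<in> {1..n} \<longrightarrow> a i \<in> {..n\<^sup>2}) \<and> (i \<notin> {1..n} \<longrightarrow> a i = 0)}"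
  define M where "M = supp g \<union> E \<times> Pow {1..n}"
  have "finite E" unfolding E_def by (rule finite_set_of_finite_funs) auto
  then have finM: "finite M" using gO by (simp add: M_def Omega_finite)
  have MT: "T \<subseteq> {1..n}" if "(a, T) \<in> M" for a T
    using that OmegaD(2)[OF gO] by (auto simp: M_def supp_def)
  have suppM: "supp v \<subseteq> M" if v: "v \<in> degbound n" for v
  proof
    fix m assume "m \<in> supp v"
    then obtain a T where m: "m = (a, T)" "v (a, T) \<noteq> 0" by (cases m) (auto simp: supp_def)
    have vO: "v \<in> Omega n" and deg: "sum a {1..n} \<le> n\<^sup>2" using v m(2) by (auto simp: degbound_def)
    have "a i \<le> n\<^sup>2" if "i \<in> {1..n}" for i
      using member_le_sum[of i "{1..n}" a] that deg by simp
    then have "a \<in> E" using OmegaD(1)[OF vO m(2)] by (auto simp: E_def)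
    then show "m \<in> M" using OmegaD(2)[OF vO m(2)] m(1) by (auto simp: M_def)
  qed
  \<comment> \<open>Division by \<open>wt n a\<close> compensates the weight in
    \<open>pair\<close>.\<close>
  define U where "U = (\<lambda>T. \<Sum>a\<in>fst ` M. single a (if (a, T) \<in> M then L (basis (a, T)) / of_real (wt n a) else 0))"
  have lookU: "lookup (U T) a = (if (a, T) \<in> M then L (basis (a, T)) / of_real (wt n a) else 0)" for a T
  proof -
    have "lookup (U T) a = (\<Sum>b\<in>fst ` M. if b = a then (if (a, T) \<in> M then L (basis (a, T)) / of_real (wt n a) else 0) else 0)"
      unfolding U_def lookup_sum by (rule sum.cong) (auto simp: lookup_single when_def)
    also have "\<dots> = (if (a, T) \<in> M then L (basis (a, T)) / of_real (wt n a) else 0)"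
      using finM by (auto simp: image_iff)
    finally show ?thesis .
  qed
  have L0: "L 0 = 0" using L(2)[of 0 0] by simp
  have Lsum: "L (sum f F) = (\<Sum>x\<in>F. L (f x))" for f and F :: "mon set"
    by (induction F rule: infinite_finite_induct) (auto simp: L0 L(1))
  have pairU: "pair n U v = L v" if v: "supp v \<subseteq> M" for v
  proof -
    have "pair n U v = (\<Sum>m\<in>M. L (basis m) * v m)"
      unfolding pair_superset[OF finM v]
    proof (rule sum.cong)
      fix m assume "m \<in> M"
      then show "lookup (U (snd m)) (fst m) * of_real (wt n (fst m)) * v m = L (basis m) * v m"
        using wt_pos[of n "fst m"] by (simp add: lookU)
    qed simp
    also have "\<dots> = L (\<Sum>m\<in>M. om_smult (v m) (basis m))"
      by (simp add: Lsum L(2) mult.commute)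
    also have "\<dots> = L v" using om_expand[OF finM v] by simp
    finally show ?thesis .
  qed
  have "U \<in> dperp n"
    unfolding dperp_def
  proof (intro CollectI allI impI)
    fix p I assume I: "I \<subseteq> {1..n}"
    show "pair n (\<lambda>T. p * U T) (dI n I (deltaB n)) = 0"
    proof (rule pair_poly)
      show "dI n I (deltaB n) \<in> Omega n" using I by (intro invharmD(1) dI_invharm)
      fix a :: "nat \<Rightarrow> nat" assume "\<forall>i. i \<notin> {1..n} \<longrightarrow> a i = 0"
      then have "basis (a, {}) \<in> Omega n" by (simp add: basis_Omega_iff)
      then have "basis (a, {}) \<in> Poly n" by (simp add: Poly_def) (simp add: basis_def)
      then have v: "odot n (basis (a, {})) (dI n I (deltaB n)) \<in> dspan n" using I by (rule odot_dI_dspan)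
      then show "pair n U (odot n (basis (a, {})) (dI n I (deltaB n))) = 0"
        using pairU suppM dspan_degbound L(3) by (metis subsetD)
    qed
  qed
  moreover have "T \<subseteq> {1..n}" if "U T \<noteq> 0" for T
  proof -
    obtain a where "lookup (U T) a \<noteq> 0" using \<open>U T \<noteq> 0\<close> by (metis lookup_zero poly_mapping_eqI)
    then show ?thesis using MT by (auto simp: lookU split: if_splits)
  qed
  ultimately have "U \<in> perp n" by (rule dperp_perp)
  then have "pair n U g = 0" using g(1) SH_subset_pharm perpD by blast
  moreover have "pair n U g = 1" using L(4) by (subst pairU) (auto simp: M_def)
  ultimately show False by simp
qed

theorem mainTheorem10:
  fixes n :: nat
  shows "SH n = {g. \<exists>F. (\<forall>I. I \<subseteq> {1..n} \<longrightarrow> F I \<in> Poly n) \<and>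
                     g = (\<lambda>k. \<Sum>I\<in>Pow {1..n}. odot n (F I) (dI n I (deltaB n)) k)}"
proof -
  have "(\<lambda>k. \<Sum>I\<in>Pow {1..n}. odot n (F I) (dI n I (deltaB n)) k)
      = (\<Sum>I\<in>Pow {1..n}. odot n (F I) (dI n I (deltaB n)))" for F
    by (rule ext) (simp only: sum_fun_apply)
  then have "{g. \<exists>F. (\<forall>I. I \<subseteq> {1..n} \<longrightarrow> F I \<in> Poly n) \<and>
      g = (\<lambda>k. \<Sum>I\<in>Pow {1..n}. odot n (F I) (dI n I (deltaB n)) k)} = dspan n"
    by (auto simp: dspan_def)
  moreover have "SH n = dspan n"
    using SH_subset_dspan dspan_subset_invharm invharm_subset_SH by blast
  ultimately show ?thesis by simp
qed

end
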